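(* Let $k$ be a positive integer and let $G$ be a claw-free graph of order $n$. If $\sigma_{k+1}(G)\geq n$ and every nonempty independent set $I$ of $G$ satisfies $|I|\leq \delta_G(I)-1$, then $G$ has a 2-factor with at most $k$ cycles.
   Context: All graphs are simple, finite, and undirected. The order of a graph is its number of vertices. A graph is claw-free if it contains no induced subgraph isomorphic to $K_{1,3}$. A 2-factor of $G$ is a 2-regular spanning subgraph of $G$; it is a vertex-disjoint union of cycles (its components), and "at most $k$ cycles" means that it has at most $k$ components. For a nonempty independent set $I$ of $G$, $\delta_G(I)=\min\{d_G(v) : v\in I\}$ denotes the minimum degree in $G$ of the vertices contained in $I$. Let $\alpha(G)$ denote the independence number of $G$. For a positive integer $m$, $\sigma_m(G)=\min\{\sum_{v\in I}d_G(v) : I \text{ is an independent set of } G \text{ with } |I|=m\}$ if $\alpha(G)\geq m$, and $\sigma_m(G)=\infty$ otherwise. *)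

theory Defs
  imports "Graph_Theory.Graph_Theory" "HOL-Library.Extended_Nat"
begin

text \<open>
  Simple, finite, undirected graphs are finite, symmetric, loop-free digraphs whose arcs are
  pairs of vertices (\<^locale>\<open>pair_graph\<close>): the edge \<open>uv\<close> is the pair of arcs \<open>(u,v)\<close>, \<open>(v,u)\<close>.
  The degree of a vertex is then its \<^const>\<open>out_degree\<close>, and the connected components are
  the strongly connected components \<^const>\<open>pre_digraph.sccs\<close>.
\<close>

definition claw_free :: "'a pair_pre_digraph \<Rightarrow> bool" where
  "claw_free G \<longleftrightarrow>
    \<not> (\<exists>H :: 'a pair_pre_digraph. induced_subgraph H G \<and> complete_bipartite_digraph 1 3 H)"

definition independent_set :: "'a pair_pre_digraph \<Rightarrow> 'a set \<Rightarrow> bool" where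
  "independent_set G I \<longleftrightarrow> I \<subseteq> pverts G \<and> (\<forall>u \<in> I. \<forall>v \<in> I. (u, v) \<notin> parcs G)"

definition independence_number :: "'a pair_pre_digraph \<Rightarrow> nat" where
  "independence_number G = Max {card I | I. independent_set G I}"

text \<open>Only meaningful for nonempty finite \<open>I\<close>.\<close>

definition min_degree_in :: "'a pair_pre_digraph \<Rightarrow> 'a set \<Rightarrow> nat" where
  "min_degree_in G I = Min {out_degree G v | v. v \<in> I}"

definition degree_sum_min :: "nat \<Rightarrow> 'a pair_pre_digraph \<Rightarrow> enat" where
  "degree_sum_min m G =
    (if m \<le> independence_number G
     then enat (Min {\<Sum>v\<in>I. out_degree G v | I. independent_set G I \<and> card I = m})
     else \<infinity>)"

text \<open>
  The requirement \<^term>\<open>pair_graph H\<close> makes the subdigraph \<open>H\<close> symmetric, i.e. an undirected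
  subgraph. As \<open>H\<close> is simple, its components are cycles of length at least 3.
\<close>

definition two_factor :: "'a pair_pre_digraph \<Rightarrow> 'a pair_pre_digraph \<Rightarrow> bool" where
  "two_factor H G \<longleftrightarrow>
    pair_graph H \<and> spanning H G \<and> (\<forall>v \<in> pverts H. out_degree H v = 2)"

end

theory Submission
  imports Defs
begin

text \<open>
  The proof has two halves.

  The first half reduces to closed graphs. If the neighbourhood of a vertex of a claw-free graph
  contains an induced path on three vertices, all missing edges in this neighbourhood may be
  added: the graph stays claw-free, and a 2-factor with at most \<open>k\<close> cycles in the larger graph
  can be converted into one of the smaller graph (\<open>local_completion.cycle_cover_pullback\<close>). This
  is Ryjacek's closure. The hypotheses survive, since new edges only raise degrees and destroy
  independent sets. At the end every neighbourhood is a disjoint union of at most two cliques,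
  and the graph is the line graph of a triangle-free graph \<open>H\<close>.

  The second half works in \<open>H\<close>. Vertices of the given graph are edges of \<open>H\<close>, independent sets
  are matchings, and the degree of an edge \<open>pq\<close> is the sum of the degrees of \<open>p\<close> and \<open>q\<close> minus
  two. Consider a family of vertex-disjoint closed trails and further vertices, the centres of
  stars, such that every edge of \<open>H\<close> has an end on a trail or at a centre. It gives a 2-factor
  with one cycle for each trail and each centre, provided that every centre can be given three
  of the edges off the trails. Take such a family, regardless of the size of the stars, with the
  fewest members, and among these one whose trails contain the most vertices. Three consequences
  of this choice carry the proof.

  First, a set of vertices that contains from each trail at most the two ends of one of its
  edges spans no cycle, as the symmetric difference with that cycle would merge members
  (\<open>optimal_system.thin_acyclic\<close>). It follows that the centres of stars can be matched to
  vertices outside the family (\<open>optimal_system.hall_condition\<close>).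

  Second, if there were more than \<open>k\<close> members, one edge from each of \<open>k + 1\<close> of them would form
  a matching whose ends span too few edges for the degree sum condition
  (\<open>optimal_system.card_reps_le\<close>).

  Third, a vertex outside the family cannot be added to a trail, which bounds the number of its
  neighbours on trails by the size of a matching (\<open>optimal_system.neighbours_matched\<close>).
  Comparing with the condition on independent sets shows that every centre of a star has degree
  at least three, and at least four if centres are adjacent (\<open>optimal_system.star_degree\<close>). This
  is enough to give every star three edges.
\<close>

section \<open>Cyclic lists, cycle covers and path covers\<close>

abbreviation path :: "'a rel \<Rightarrow> 'a list \<Rightarrow> bool" where
  "path R P \<equiv> successively (\<lambda>a b. (a, b) \<in> R) P"

definition cyc :: "'a rel \<Rightarrow> 'a list \<Rightarrow> bool" where
  "cyc R L \<longleftrightarrow> distinct L \<and> 3 \<le> length L \<and> path R L \<and> (last L, hd L) \<in> R"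

text \<open>
  A cycle cover by at most \<open>m\<close> lists is a 2-factor with at most \<open>m\<close> cycles; each cycle is listed
  from an arbitrary starting vertex in an arbitrary direction.
\<close>

definition cycle_cover :: "'a rel \<Rightarrow> 'a set \<Rightarrow> nat \<Rightarrow> bool" where
  "cycle_cover R V m \<longleftrightarrow> (\<exists>Ls. length Ls \<le> m \<and> distinct (concat Ls) \<and> set (concat Ls) = V
     \<and> (\<forall>L\<in>set Ls. cyc R L))"

text \<open>
  What is left of a cycle cover when one edge of one cycle is deleted. The path takes the place
  of a cycle, hence the strict bound.
\<close>

definition path_cover :: "'a rel \<Rightarrow> 'a set \<Rightarrow> nat \<Rightarrow> 'a list \<Rightarrow> 'a list list \<Rightarrow> bool" where
  "path_cover R V m P Ls \<longleftrightarrow> path R P \<and> distinct (P @ concat Ls) \<and> set (P @ concat Ls) = V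
     \<and> length Ls < m \<and> (\<forall>L\<in>set Ls. cyc R L)"

lemma path_rev:
  assumes "sym R"
  shows "path R (rev P) \<longleftrightarrow> path R P"
proof -
  have "(\<lambda>a b. (b, a) \<in> R) = (\<lambda>a b. (a, b) \<in> R)" using assms by (auto simp: sym_def fun_eq_iff)
  then show ?thesis by (simp only: successively_rev)
qed

lemma cyc_nonempty: "cyc R L \<Longrightarrow> L \<noteq> []"
  by (auto simp: cyc_def)

lemma cyc_rotate:
  assumes "cyc R (A @ B)"
  shows "cyc R (B @ A)"
proof (cases "A = [] \<or> B = []")
  case False
  then show ?thesis using assms by (auto simp: cyc_def successively_append_iff)
qed (use assms in auto)

lemma cyc_rotate_to:
  assumes "cyc R L" "y \<in> set L"
  obtains M where "cyc R (y # M)" "set (y # M) = set L"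
proof -
  obtain A B where L: "L = A @ y # B" using assms(2) by (meson split_list)
  have "cyc R ((y # B) @ A)" using cyc_rotate[of R A "y # B"] assms(1) L by simp
  then show ?thesis using that[of "B @ A"] L by auto
qed

text \<open>
  All surgery on covers below ends with this step, so it suffices to produce a path cover whose
  path has adjacent ends.
\<close>

lemma path_cover_closes:
  assumes "path_cover R V m P Ls" "(last P, hd P) \<in> R" "3 \<le> length P"
  shows "cycle_cover R V m"
  using assms unfolding path_cover_def cycle_cover_def
  by (intro exI[of _ "P # Ls"]) (auto simp: cyc_def)

lemma path_cover_split_cycle:
  assumes "path_cover R V m P Ls" "y \<in> V" "y \<notin> set P"
  obtains M Ls' where "cyc R (y # M)" "path R P" "Suc (length Ls') < m"
    "distinct (P @ (y # M) @ concat Ls')" "set (P @ (y # M) @ concat Ls') = V"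
    "\<forall>L\<in>set Ls'. cyc R L"
proof -
  obtain L where L: "L \<in> set Ls" "y \<in> set L" using assms by (auto simp: path_cover_def)
  obtain Xs Ys where Ls: "Ls = Xs @ L # Ys" using L(1) by (meson split_list)
  obtain M where M: "cyc R (y # M)" "set (y # M) = set L"
    using cyc_rotate_to[of R L y] L assms(1) by (auto simp: path_cover_def)
  have dM: "distinct (y # M)" using M by (simp add: cyc_def)
  show ?thesis
  proof (rule that[of M "Xs @ Ys"])
    have d: "distinct (P @ concat Ls)" using assms by (simp add: path_cover_def)
    show "distinct (P @ (y # M) @ concat (Xs @ Ys))"
      using d dM M(2)[symmetric] unfolding Ls by auto
    show "set (P @ (y # M) @ concat (Xs @ Ys)) = V"
      using assms(1) M(2) unfolding Ls path_cover_def by auto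
    show "cyc R (y # M)" by (rule M)
    show "path R P" "Suc (length (Xs @ Ys)) < m" "\<forall>L\<in>set (Xs @ Ys). cyc R L"
      using assms(1) unfolding path_cover_def Ls by simp_all
  qed
qed

text \<open>
  A cycle of length at least three runs through the pair \<open>u\<close>, \<open>v\<close> at most once, so one can start
  the list behind the place where the new edge is used and only old edges remain.
\<close>

lemma cyc_or_path_after_edge_removal:
  assumes "cyc (R \<union> {(u, v), (v, u)}) L" "\<not> cyc R L" "sym R"
  obtains P where "set P = set L" "distinct P" "3 \<le> length P" "path R P" "hd P = u" "last P = v"
proof -
  let ?E = "R \<union> {(u, v), (v, u)}"
  have "\<exists>K. cyc ?E K \<and> set K = set L \<and> (last K, hd K) \<notin> R"
  proof (cases "path R L")
    case True
    then have "(last L, hd L) \<notin> R" using assms(1,2) by (simp add: cyc_def)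
    then show ?thesis using assms(1) by (intro exI[of _ L]) simp
  next
    case False
    then obtain i where i: "Suc i < length L" "(L ! i, L ! Suc i) \<notin> R"
      by (auto simp: successively_conv_nth)
    let ?A = "take (Suc i) L" and ?B = "drop (Suc i) L"
        have "cyc ?E (?B @ ?A)" using cyc_rotate[of ?E ?A ?B] assms(1) by simp
    moreover have "set (?B @ ?A) = set L" by (metis append_take_drop_id set_append sup_commute)
    moreover have "last (?B @ ?A) = L ! i" using i by (simp add: take_Suc_conv_app_nth)
    moreover have "hd (?B @ ?A) = L ! Suc i" using i by (simp add: hd_drop_conv_nth)
    ultimately show ?thesis using i by metis
  qed
  then obtain K where K: "cyc ?E K" "set K = set L" "(last K, hd K) \<notin> R" by blast
  have uv: "(last K, hd K) \<in> {(u, v), (v, u)}" using K by (auto simp: cyc_def)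
  have d: "distinct K" "3 \<le> length K" "path ?E K" using K by (auto simp: cyc_def)
  have "path R K"
    unfolding successively_conv_nth
  proof (intro allI impI)
    fix i assume i: "Suc i < length K"
    have "(K ! i, K ! Suc i) \<in> ?E" using d i by (auto simp: successively_conv_nth)
    moreover have "(K ! i, K ! Suc i) \<noteq> (last K, hd K)" "(K ! i, K ! Suc i) \<noteq> (hd K, last K)"
    proof -
      have "K \<noteq> []" using i by auto
      then have e: "hd K = K ! 0" "last K = K ! (length K - 1)" by (auto simp: hd_conv_nth last_conv_nth)
      have "K ! i \<noteq> K ! (length K - 1)"
        using nth_eq_iff_index_eq[OF d(1), of i "length K - 1"] i by linarith
      then show "(K ! i, K ! Suc i) \<noteq> (last K, hd K)" unfolding e by blast
      have "\<not> (K ! i = K ! 0 \<and> K ! Suc i = K ! (length K - 1))"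
        using nth_eq_iff_index_eq[OF d(1), of i 0] i d(2)
          nth_eq_iff_index_eq[OF d(1), of "Suc i" "length K - 1"] by linarith
      then show "(K ! i, K ! Suc i) \<noteq> (hd K, last K)" unfolding e by blast
    qed
    ultimately show "(K ! i, K ! Suc i) \<in> R" using uv by auto
  qed
  show ?thesis
  proof (cases "hd K = u \<and> last K = v")
    case True
    then show ?thesis using that[of K] K d \<open>path R K\<close> by auto
  next
    case False
    then have "hd K = v" "last K = u" using uv by auto
    then show ?thesis using that[of "rev K"] K d \<open>path R K\<close> assms(3)
      by (auto simp: path_rev hd_rev last_rev simp del: successively_rev)
  qed
qed

lemma cycle_cover_or_path_cover:
  assumes "cycle_cover (R \<union> {(u, v), (v, u)}) V m" "\<not> cycle_cover R V m" "sym R"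
  obtains P Ls where "path_cover R V m P Ls" "hd P = u" "last P = v" "3 \<le> length P"
proof -
  let ?E = "R \<union> {(u, v), (v, u)}"
  obtain Ls where Ls: "length Ls \<le> m" "distinct (concat Ls)" "set (concat Ls) = V"
    "\<forall>L\<in>set Ls. cyc ?E L" using assms(1) unfolding cycle_cover_def by metis
  have "\<not> (\<forall>L\<in>set Ls. cyc R L)" using assms(2) Ls unfolding cycle_cover_def by blast
  then obtain L where L: "L \<in> set Ls" "\<not> cyc R L" by blast
  then obtain Xs Ys where XY: "Ls = Xs @ L # Ys" by (meson split_list)
  obtain P where P: "set P = set L" "distinct P" "3 \<le> length P" "path R P" "hd P = u" "last P = v"
    using cyc_or_path_after_edge_removal[of R u v L] L Ls(4) assms(3) by blast
  have u: "u \<in> set L" using P by (metis hd_in_set list.size(3) not_numeral_le_zero)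
  have others: "cyc R K" if K: "K \<in> set (Xs @ Ys)" for K
  proof (rule ccontr)
    assume "\<not> cyc R K"
    then obtain Q where "set Q = set K" "3 \<le> length Q" "hd Q = u"
      using cyc_or_path_after_edge_removal[of R u v K] K Ls(4) XY assms(3) by (metis Un_iff set_append list.set_intros(2) set_ConsD)
    then have "u \<in> set K" by (metis hd_in_set list.size(3) not_numeral_le_zero)
    then show False using u K Ls(2) unfolding XY by auto
  qed
  have "path_cover R V m P (Xs @ Ys)"
    unfolding path_cover_def
  proof (intro conjI)
    show "distinct (P @ concat (Xs @ Ys))" using Ls(2) P(1)[symmetric] P(2) unfolding XY by auto
    show "set (P @ concat (Xs @ Ys)) = V" using Ls(3) P(1) unfolding XY by auto
    show "path R P" by (rule P)
    show "length (Xs @ Ys) < m" using Ls(1) XY by simp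
    show "\<forall>L\<in>set (Xs @ Ys). cyc R L" using others by blast
  qed
  then show ?thesis using that P by blast
qed

section \<open>Removing one edge from a cycle cover\<close>

lemma disjoint_ends:
  assumes "set X \<inter> set Y = {}" "X \<noteq> []" "Y \<noteq> []"
  shows "hd X \<noteq> hd Y" "hd X \<noteq> last Y" "last X \<noteq> hd Y" "last X \<noteq> last Y"
  using assms by (metis disjoint_iff hd_in_set last_in_set)+

text \<open>
  The situation in which a cycle cover of \<open>R\<close> together with the edge \<open>uv\<close> cannot be replaced by
  one of \<open>R\<close> alone. In a claw-free graph a common neighbour \<open>x\<close> of the nonadjacent vertices \<open>u\<close>
  and \<open>v\<close> has all its neighbours in the closed neighbourhoods of \<open>u\<close> and \<open>v\<close>; this is all that
  is kept of claw-freeness here, since the graphs between a graph and its completion may contain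
  claws.

  Deleting \<open>uv\<close> from a cover leaves a path from \<open>u\<close> to \<open>v\<close> and some cycles. Each lemma names
  edges that would allow the pieces of this path, possibly after absorbing a cycle, to be put
  together to a single cycle; as no cover of \<open>R\<close> exists, these edges are missing.
\<close>

locale blocked_chord =
  fixes R :: "'a rel" and V :: "'a set" and m :: nat and u v x :: 'a
  assumes sym: "sym R" and irrefl: "\<And>a. (a, a) \<notin> R" and vertices: "R \<subseteq> V \<times> V"
    and no_cover: "\<not> cycle_cover R V m"
    and x_adj: "(x, u) \<in> R" "(x, v) \<in> R"
    and x_dominated: "\<And>s. (x, s) \<in> R \<Longrightarrow> s = u \<or> s = v \<or> (s, u) \<in> R \<or> (s, v) \<in> R"
begin

text \<open>
  A common neighbour \<open>y\<close> of \<open>u\<close>, \<open>v\<close> and \<open>x\<close> can obstruct the rearrangements only if the cover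
  runs from \<open>y\<close> to a far vertex.
\<close>

definition far :: "'a \<Rightarrow> bool" where
  "far s \<longleftrightarrow> s \<noteq> u \<and> s \<noteq> v \<and> (s, u) \<notin> R \<and> (s, v) \<notin> R"

definition chord_cover :: "'a list \<Rightarrow> 'a list list \<Rightarrow> bool" where
  "chord_cover P Ls \<longleftrightarrow> path_cover R V m P Ls \<and> hd P = u \<and> last P = v \<and> P \<noteq> []"

lemma adj_sym: "(a, b) \<in> R \<longleftrightarrow> (b, a) \<in> R"
  using sym by (auto dest: symD)

lemma not_closable:
  assumes "path R Q" "distinct (Q @ concat Ls)" "set (Q @ concat Ls) = V" "length Ls < m"
    "\<forall>L\<in>set Ls. cyc R L" "3 \<le> length Q"
  shows "(last Q, hd Q) \<notin> R"
  using path_cover_closes[of R V m Q Ls] assms no_cover by (auto simp: path_cover_def)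

lemmas list_simps = successively_append_iff successively_Cons path_rev[OF sym] hd_rev last_rev
  hd_append last_append

lemma reverse: "blocked_chord R V m v u x"
  using sym irrefl vertices no_cover x_adj x_dominated by unfold_locales blast+

lemma chord_cover_reverse:
  assumes "chord_cover P Ls"
  shows "blocked_chord.chord_cover R V m v u (rev P) Ls"
proof -
  interpret r: blocked_chord R V m v u x by (rule reverse)
  show ?thesis using assms
    by (auto simp: chord_cover_def r.chord_cover_def path_cover_def list_simps simp del: successively_rev)
qed

lemma far_reverse: "blocked_chord.far R v u s = far s"
proof -
  interpret r: blocked_chord R V m v u x by (rule reverse)
  show ?thesis by (auto simp: far_def r.far_def)
qed

text \<open>
  If \<open>y\<close> lies on another cycle, that cycle can be opened at \<open>y\<close> and spliced in between \<open>v\<close> and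
  \<open>u\<close>: one end is \<open>y\<close>, adjacent to both, and the other end is a cycle neighbour of \<open>y\<close>, which
  therefore must be adjacent to neither.
\<close>

lemma off_path_neighbours_far:
  assumes P: "path R P" "hd P = u" "last P = v" "P \<noteq> []"
    and M: "cyc R (y # M)" "Suc (length Ls) < m" "distinct (P @ (y # M) @ concat Ls)"
      "set (P @ (y # M) @ concat Ls) = V" "\<forall>L\<in>set Ls. cyc R L"
    and y: "(y, u) \<in> R" "(y, v) \<in> R"
  shows "far (hd M)" "far (last M)"
proof -
  have cM: "path R M" "M \<noteq> []" "2 \<le> length M" "(y, hd M) \<in> R" "(last M, y) \<in> R"
    using M(1) by (auto simp: cyc_def successively_Cons split: if_splits)
  have uv_M: "u \<notin> set M" "v \<notin> set M" using M(3) P by (auto dest: hd_in_set last_in_set)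
  have close: "(last Q, hd Q) \<notin> R" if "path R Q" "set Q = set (P @ y # M)" "distinct Q"
      "length Q = length (P @ y # M)" for Q
  proof (rule not_closable[of Q Ls])
    show "distinct (Q @ concat Ls)" using M(3) that by auto
    show "set (Q @ concat Ls) = V" using M(4) that by auto
  qed (use that M cM in auto)
  have d: "distinct (P @ y # M)" using M(3) by auto
  have 1: "(last M, u) \<notin> R"
    using close[of "P @ y # M"] d P cM y by (auto simp: list_simps adj_sym)
  have 2: "(hd M, u) \<notin> R"
    using close[of "P @ y # rev M"] d P cM y by (auto simp: list_simps adj_sym simp del: successively_rev)
  have 3: "(hd M, v) \<notin> R"
    using close[of "P @ M @ [y]"] d P cM y by (auto simp: list_simps adj_sym)
  have 4: "(last M, v) \<notin> R"
    using close[of "P @ rev M @ [y]"] d P cM y by (auto simp: list_simps adj_sym simp del: successively_rev)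
  show "far (hd M)" "far (last M)" using 1 2 3 4 uv_M cM(2) by (auto simp: far_def)
qed

lemma off_path_far:
  assumes P: "chord_cover P Ls" and y: "y \<notin> set P" "(y, u) \<in> R" "(y, v) \<in> R"
  obtains M Ls' where "cyc R (y # M)" "far (hd M)" "far (last M)" "Suc (length Ls') < m"
    "distinct (P @ (y # M) @ concat Ls')" "set (P @ (y # M) @ concat Ls') = V" "\<forall>L\<in>set Ls'. cyc R L"
proof -
  have "y \<in> V" using y vertices by auto
  then obtain M Ls' where M: "cyc R (y # M)" "path R P" "Suc (length Ls') < m"
    "distinct (P @ (y # M) @ concat Ls')" "set (P @ (y # M) @ concat Ls') = V"
    "\<forall>L\<in>set Ls'. cyc R L"
    using path_cover_split_cycle[of R V m P Ls y] P y unfolding chord_cover_def by metis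
  then show ?thesis
    using that off_path_neighbours_far[OF M(2) _ _ _ M(1,3-6) y(2,3)] P by (auto simp: chord_cover_def)
qed

lemma chord_cover_rearrange:
  assumes "chord_cover P Ls" "path R Q" "set Q = set P" "distinct Q" "3 \<le> length Q"
  shows "(last Q, hd Q) \<notin> R"
  using not_closable[of Q Ls] assms unfolding chord_cover_def path_cover_def by auto

text \<open>
  Three ways to close the path: turn round the part behind \<open>y\<close>, turn round the part before \<open>y\<close>,
  or bypass \<open>y\<close> and use it to connect \<open>v\<close> with \<open>u\<close>.
\<close>

lemma on_path:
  assumes P: "chord_cover (A @ y # B) Ls" and y: "(y, u) \<in> R" "(y, v) \<in> R"
  shows "A \<noteq> []" "B \<noteq> []" "(hd B, u) \<notin> R" "(last A, v) \<notin> R" "(last A, hd B) \<notin> R"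
proof -
  have P': "path R (A @ y # B)" "hd (A @ y # B) = u" "last (A @ y # B) = v" "distinct (A @ y # B)"
    using P by (auto simp: chord_cover_def path_cover_def)
  show A: "A \<noteq> []" using P'(2) y irrefl by auto
  show B: "B \<noteq> []" using P'(3) y irrefl by auto
  have len: "3 \<le> length (A @ y # B)" using A B by (cases A; cases B) auto
  show "(hd B, u) \<notin> R"
    using chord_cover_rearrange[OF P, of "A @ y # rev B"] P' A B y len
    by (auto simp: list_simps adj_sym simp del: successively_rev)
  show "(last A, v) \<notin> R"
    using chord_cover_rearrange[OF P, of "rev A @ y # B"] P' A B y len
    by (auto simp: list_simps adj_sym simp del: successively_rev)
  show "(last A, hd B) \<notin> R"
    using chord_cover_rearrange[OF P, of "A @ B @ [y]"] P' A B y len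
    by (auto simp: list_simps adj_sym)
qed

lemma x_on_path:
  assumes P: "chord_cover P Ls"
  obtains A B where "P = A @ x # B"
proof -
  have "x \<in> set P"
  proof (rule ccontr)
    assume "x \<notin> set P"
    then obtain M where M: "cyc R (x # M)" "far (hd M)" using off_path_far[OF P _ x_adj] by metis
    then have "(x, hd M) \<in> R" by (auto simp: cyc_def successively_Cons)
    then show False using x_dominated M(2) by (auto simp: far_def)
  qed
  then show ?thesis using that by (meson split_list)
qed

lemma x_neighbours:
  assumes P: "chord_cover (A @ x # B) Ls"
  shows "last A = u \<or> (last A, u) \<in> R" "hd B = v \<or> (hd B, v) \<in> R"
proof -
  note o = on_path[OF P x_adj]
  have P': "path R (A @ x # B)" "hd (A @ x # B) = u" "last (A @ x # B) = v" "distinct (A @ x # B)"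
    using P by (auto simp: chord_cover_def path_cover_def)
  have "(x, last A) \<in> R" "(x, hd B) \<in> R" using P'(1) o by (auto simp: list_simps adj_sym)
  moreover have "last A \<noteq> v" "hd B \<noteq> u" using P'(2-4) o(1,2) disjoint_ends[of A B] by auto
  ultimately show "last A = u \<or> (last A, u) \<in> R" "hd B = v \<or> (hd B, v) \<in> R"
    using x_dominated o by blast+
qed

text \<open>
  With \<open>y\<close> before \<open>x\<close> on the path, the predecessor of \<open>x\<close> is adjacent to \<open>u\<close>. If the successor
  of \<open>y\<close> were adjacent to \<open>v\<close>, the segments in the order \<open>M\<close>, \<open>A\<close>, \<open>y\<close>, \<open>x\<close>, \<open>B\<close> would form a
  cycle.
\<close>

lemma successor_far:
  assumes P: "chord_cover (A @ y # M @ x # B) Ls" and y: "(y, u) \<in> R" "(y, v) \<in> R" "(y, x) \<in> R"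
  shows "M \<noteq> []" "far (hd M)"
proof -
  note oy = on_path[OF P y(1,2)]
  have Px: "chord_cover ((A @ y # M) @ x # B) Ls" using P by simp
  note ox = on_path[OF Px x_adj] and nx = x_neighbours[OF Px]
  have P': "path R (A @ y # M @ x # B)" "hd (A @ y # M @ x # B) = u" "last (A @ y # M @ x # B) = v"
      "distinct (A @ y # M @ x # B)"
    using P by (auto simp: chord_cover_def path_cover_def)
  show M: "M \<noteq> []"
  proof
    assume [simp]: "M = []"
    show False
      using chord_cover_rearrange[OF P, of "[y] @ rev A @ x # B"] P' oy ox(2) y x_adj
      by (cases B) (auto simp: list_simps adj_sym simp del: successively_rev split: if_splits)
  qed
  have lM: "(last M, u) \<in> R" using nx M P' oy(1) disjoint_ends[of A M] by (auto simp: Int_Un_distrib)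
  have "(hd M, v) \<notin> R"
  proof
    assume "(hd M, v) \<in> R"
    then show False
      using chord_cover_rearrange[OF P, of "M @ A @ y # x # B"] P' oy ox(2) y x_adj M lM
      by (cases B) (auto simp: list_simps adj_sym split: if_splits)
  qed
  moreover have "hd M \<noteq> u" "hd M \<noteq> v" using P' oy(1) ox(2) M disjoint_ends[of A M] disjoint_ends[of M B] by (auto simp: Int_Un_distrib)
  ultimately show "far (hd M)" using oy(3) M by (auto simp: far_def)
qed


lemma predecessor_far:
  assumes P: "chord_cover (A @ x # M @ y # B) Ls" and y: "(y, u) \<in> R" "(y, v) \<in> R" "(y, x) \<in> R"
  shows "M \<noteq> []" "far (last M)"
proof -
  interpret r: blocked_chord R V m v u x by (rule reverse)
  have "r.chord_cover (rev B @ y # rev M @ x # rev A) Ls"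
    using chord_cover_reverse[OF P] by simp
  from r.successor_far[OF this y(2,1,3)] show "M \<noteq> []" "far (last M)"
    by (auto simp: far_reverse hd_rev)
qed

lemma not_far: "(y, u) \<in> R \<Longrightarrow> \<not> far y"
  by (simp add: far_def)

text \<open>
  Consequently an edge \<open>uv\<close> is dispensable as soon as \<open>u\<close>, \<open>v\<close>, \<open>x\<close> have a common neighbour
  without far neighbours.
\<close>

lemma ex_far_neighbour:
  assumes P: "chord_cover P Ls" and y: "(y, u) \<in> R" "(y, v) \<in> R" "(y, x) \<in> R"
  obtains s where "(y, s) \<in> R" "far s"
proof (cases "y \<in> set P")
  case False
  then obtain M where "cyc R (y # M)" "far (hd M)" using off_path_far[OF P False y(1,2)] by metis
  then show ?thesis using that by (auto simp: cyc_def successively_Cons)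
next
  case True
  obtain A B where AB: "P = A @ x # B" using x_on_path[OF P] .
  have pP: "path R P" using P by (simp add: chord_cover_def path_cover_def)
  have "y \<noteq> x" using y irrefl by auto
  with True AB consider "y \<in> set A" | "y \<in> set B" by auto
  then show ?thesis
  proof cases
    case 1
    then obtain A1 M where A: "A = A1 @ y # M" by (meson split_list)
    have "M \<noteq> []" "far (hd M)" using successor_far[of A1 y M B Ls] P y unfolding AB A by auto
    moreover have "(y, hd M) \<in> R" using pP \<open>M \<noteq> []\<close> unfolding AB A by (auto simp: list_simps)
    ultimately show ?thesis using that by blast
  next
    case 2
    then obtain M B1 where B: "B = M @ y # B1" by (meson split_list)
    have "M \<noteq> []" "far (last M)" using predecessor_far[of A M y B1 Ls] P y unfolding AB B by auto
    moreover have "(y, last M) \<in> R" using pP \<open>M \<noteq> []\<close> unfolding AB B by (auto simp: list_simps adj_sym)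
    ultimately show ?thesis using that by blast
  qed
qed

end

text \<open>
  The situation when \<open>u\<close> and \<open>v\<close> have distance three in the neighbourhood of \<open>x\<close>, with \<open>u a b v\<close>
  a shortest path there and the chords \<open>av\<close>, \<open>bu\<close> already present. Now \<open>a\<close> and \<open>b\<close> may have far
  neighbours, as in the 3-sun, but these form one clique that is joined completely to \<open>a\<close> and
  \<open>b\<close>. Both \<open>a\<close> and \<open>b\<close> meet a far vertex on the cover, and in each of the possible positions of
  \<open>a\<close> and \<open>b\<close> the edges of this clique permit a rearrangement.
\<close>

locale blocked_sun = blocked_chord +
  fixes a b :: 'a
  assumes a: "(a, u) \<in> R" "(a, v) \<in> R" "(a, x) \<in> R"
    and b: "(b, u) \<in> R" "(b, v) \<in> R" "(b, x) \<in> R"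
    and ab: "(a, b) \<in> R"
    and far_common: "\<And>s. far s \<Longrightarrow> (a, s) \<in> R \<longleftrightarrow> (b, s) \<in> R"
    and far_clique: "\<And>s t. far s \<Longrightarrow> far t \<Longrightarrow> (a, s) \<in> R \<Longrightarrow> (a, t) \<in> R \<Longrightarrow> s = t \<or> (s, t) \<in> R"
begin

lemma swap: "blocked_sun R V m u v x b a"
  using a b ab far_common far_clique adj_sym by unfold_locales blast+

lemma reverse_sun: "blocked_sun R V m v u x a b"
proof -
  interpret r: blocked_chord R V m v u x by (rule reverse)
  show ?thesis
    using a b ab far_common far_clique by unfold_locales (auto simp: far_reverse)
qed

text \<open>
  Turning round the segment between \<open>a\<close> and the far successor of \<open>b\<close> makes \<open>b\<close> the successor of
  \<open>a\<close>, although \<open>b\<close> is not far.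
\<close>

lemma both_before:
  assumes P: "chord_cover (A @ a # M @ b # N @ x # B) Ls"
  shows False
proof -
  have P': "path R (A @ a # M @ b # N @ x # B)" "distinct (A @ a # M @ b # N @ x # B)"
     "hd (A @ a # M @ b # N @ x # B) = u" "last (A @ a # M @ b # N @ x # B) = v"
    using P by (auto simp: chord_cover_def path_cover_def)
  have Pa: "chord_cover (A @ a # (M @ b # N) @ x # B) Ls"
    and Pb: "chord_cover ((A @ a # M) @ b # N @ x # B) Ls" using P by auto
  note sa = successor_far[OF Pa a] and sb = successor_far[OF Pb b]
  have M: "M \<noteq> []" using sa(2) not_far[OF b(1)] by (cases M) auto
  have "A \<noteq> []" using on_path(1)[OF Pa a(1,2)] .
  have s: "far (hd M)" "(a, hd M) \<in> R" using sa M P'(1) by (auto simp: list_simps)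
  have t: "far (hd N)" "(a, hd N) \<in> R" using sb P'(1) far_common by (auto simp: list_simps)
  have "hd M \<noteq> hd N" using P'(2) M sb(1) disjoint_ends[of M N] by (auto simp: Int_Un_distrib)
  then have st: "(hd M, hd N) \<in> R" using far_clique s t by blast
  have "chord_cover (A @ a # (b # rev M @ N) @ x # B) Ls"
    using P P' M sb(1) ab st \<open>A \<noteq> []\<close> unfolding chord_cover_def path_cover_def
    by (auto simp: list_simps adj_sym simp del: successively_rev)
  from successor_far(2)[OF this a] show False using not_far[OF b(1)] by simp
qed

text \<open>
  The path is cut at \<open>a\<close>, \<open>x\<close> and \<open>b\<close>: joining \<open>a\<close> to \<open>b\<close> frees the segment around \<open>x\<close>, whose
  two far ends are adjacent, so that it can be traversed from \<open>x\<close> and inserted between \<open>v\<close> and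
  \<open>u\<close>.
\<close>

lemma on_both_sides:
  assumes P: "chord_cover (A @ a # M @ x # N @ b # B) Ls"
  shows False
proof -
  have P': "path R (A @ a # M @ x # N @ b # B)" "distinct (A @ a # M @ x # N @ b # B)"
     "hd (A @ a # M @ x # N @ b # B) = u" "last (A @ a # M @ x # N @ b # B) = v"
    using P by (auto simp: chord_cover_def path_cover_def)
  have Pa: "chord_cover (A @ a # M @ x # (N @ b # B)) Ls"
    and Pb: "chord_cover ((A @ a # M) @ x # N @ b # B) Ls" 
    and Pb': "chord_cover ((A @ a # M @ x # N) @ b # B) Ls" using P by auto
  note sa = successor_far[OF Pa a] and sb = predecessor_far[OF Pb b]
  have A: "A \<noteq> []" using on_path(1)[OF Pa a(1,2)] .
  have B: "B \<noteq> []" using on_path(2)[OF Pb' b(1,2)] .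
  have s: "far (hd M)" "(a, hd M) \<in> R" using sa P'(1) by (auto simp: list_simps)
  have "(b, last N) \<in> R" using sb(1) P'(1) by (auto simp: list_simps adj_sym)
  then have t: "far (last N)" "(a, last N) \<in> R" using sb(2) far_common by auto
  have "hd M \<noteq> last N" using P'(2) sa(1) sb(1) disjoint_ends[of M N] by (auto simp: Int_Un_distrib)
  then have st: "(hd M, last N) \<in> R" using far_clique s t by blast
  have "last M \<noteq> u" using P' A sa(1) disjoint_ends[of A M] by (auto simp: Int_Un_distrib)
  then have lM: "(last M, u) \<in> R" using x_neighbours(1)[OF Pb] sa(1) by auto
  show False
    using chord_cover_rearrange[OF P, of "A @ a # b # B @ x # N @ M"] P' A B sa(1) sb(1) ab st lM x_adj
    by (auto simp: list_simps adj_sym)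
qed

text \<open>
  The cycle through \<open>a\<close> is inserted behind \<open>b\<close>, after which the successor of \<open>b\<close> is \<open>a\<close>, which
  is not far.
\<close>

lemma one_off_path_before:
  assumes P: "chord_cover (A @ b # N @ x # B) Ls" and off: "a \<notin> set (A @ b # N @ x # B)"
  shows False
proof -
  let ?P = "A @ b # N @ x # B"
  have P': "path R ?P" "distinct ?P" "hd ?P = u" "last ?P = v"
    using P by (auto simp: chord_cover_def path_cover_def)
  obtain K Ls' where K: "cyc R (a # K)" "far (hd K)" "far (last K)" "Suc (length Ls') < m"
    "distinct (?P @ (a # K) @ concat Ls')" "set (?P @ (a # K) @ concat Ls') = V" "\<forall>L\<in>set Ls'. cyc R L"
    using off_path_far[OF P off a(1,2)] .
  have cK: "path R K" "K \<noteq> []" "(a, hd K) \<in> R" "(last K, a) \<in> R"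
    using K(1) by (auto simp: cyc_def successively_Cons split: if_splits)
  note sb = successor_far[OF P b]
  have A: "A \<noteq> []" using on_path(1)[OF P b(1,2)] .
  have t: "far (hd N)" "(a, hd N) \<in> R" using sb P'(1) far_common by (auto simp: list_simps)
  have "hd K \<noteq> hd N" using K(5) cK sb(1) disjoint_ends[of K N] by (auto simp: Int_Un_distrib Int_commute)
  then have st: "(hd K, hd N) \<in> R" using far_clique K(2) cK(3) t by blast
  have "chord_cover (A @ b # (a # rev K @ N) @ x # B) Ls'"
    unfolding chord_cover_def path_cover_def
  proof (intro conjI)
    show "path R (A @ b # (a # rev K @ N) @ x # B)"
      using P'(1) A cK sb(1) ab st by (auto simp: list_simps adj_sym simp del: successively_rev)
    show "distinct ((A @ b # (a # rev K @ N) @ x # B) @ concat Ls')" using K(5) by auto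
    show "set ((A @ b # (a # rev K @ N) @ x # B) @ concat Ls') = V" using K(6) by auto
    show "hd (A @ b # (a # rev K @ N) @ x # B) = u" using P'(3) A by simp
    show "last (A @ b # (a # rev K @ N) @ x # B) = v" using P'(4) by (simp split: if_splits)
  qed (use K in auto)
  from successor_far(2)[OF this b] show False using not_far[OF a(1)] by simp
qed

text \<open>
  Two far neighbours, one of \<open>a\<close> and one of \<open>b\<close>, are adjacent. They turn the cycle or the two
  cycles through \<open>a\<close> and \<open>b\<close> into a path from \<open>a\<close> to \<open>b\<close>, which fits between \<open>v\<close> and \<open>u\<close>.
\<close>

lemma both_off_path:
  assumes P: "chord_cover P Ls" and off: "a \<notin> set P" "b \<notin> set P"
  shows False
proof -
  have P': "path R P" "hd P = u" "last P = v" "P \<noteq> []"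
    using P by (auto simp: chord_cover_def path_cover_def)
  obtain K Ls' where K: "cyc R (a # K)" "far (hd K)" "far (last K)" "Suc (length Ls') < m"
    "distinct (P @ (a # K) @ concat Ls')" "set (P @ (a # K) @ concat Ls') = V" "\<forall>L\<in>set Ls'. cyc R L"
    using off_path_far[OF P off(1) a(1,2)] .
  have cK: "path R K" "K \<noteq> []" "(a, hd K) \<in> R" "(last K, a) \<in> R"
    using K(1) by (auto simp: cyc_def successively_Cons split: if_splits)
  show False
  proof (cases "b \<in> set K")
    case True
    then obtain K1 K2 where K12: "K = K1 @ b # K2" by (meson split_list)
    have K1: "K1 \<noteq> []" using K(2) not_far[OF b(1)] K12 by (cases K1) auto
    have K2: "K2 \<noteq> []" using K(3) not_far[OF b(1)] K12 by (cases K2) auto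
    have "cyc R (b # K2 @ a # K1)" using K(1) cyc_rotate[of R "a # K1" "b # K2"] K12 by simp
    then have "far (hd (K2 @ a # K1))"
      by (rule off_path_neighbours_far(1)[OF P' _ K(4) _ _ K(7) b(1,2)]) (use K(5,6) K12 in auto)
    then have t: "far (hd K2)" "(a, hd K2) \<in> R" using K2 cK(1) K12 far_common by (auto simp: list_simps)
    have "hd K1 \<noteq> hd K2" using K(5) K1 K2 K12 disjoint_ends[of K1 K2] by (auto simp: Int_Un_distrib)
    then have st: "(hd K1, hd K2) \<in> R" using far_clique[of "hd K1" "hd K2"] K(2) cK(3) t K12 K1 by auto
    let ?Q = "P @ a # rev K2 @ K1 @ [b]"
    have "(last ?Q, hd ?Q) \<notin> R"
    proof (rule not_closable[of _ Ls'])
      show "path R ?Q" using P' cK K1 K2 K12 st a b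
        by (auto simp: list_simps adj_sym simp del: successively_rev)
      show "distinct (?Q @ concat Ls')" "set (?Q @ concat Ls') = V" using K(5,6) K12 by auto
    qed (use K(4,7) P'(4) in \<open>auto simp: Suc_le_eq\<close>)
    then show False using P' b by simp
  next
    case False
    have "b \<in> V" using b vertices by auto
    have "path_cover R (V - set (a # K)) (m - 1) P Ls'"
      using P' K unfolding path_cover_def by auto
    then obtain K' Ls'' where K': "cyc R (b # K')" "Suc (length Ls'') < m - 1"
        "distinct (P @ (b # K') @ concat Ls'')" "set (P @ (b # K') @ concat Ls'') = V - set (a # K)"
        "\<forall>L\<in>set Ls''. cyc R L"
      using path_cover_split_cycle[of R "V - set (a # K)" "m - 1" P Ls' b] \<open>b \<in> V\<close> off False ab irrefl
      by (metis Diff_iff set_ConsD)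
    have cK': "path R K'" "K' \<noteq> []" "(b, hd K') \<in> R" "(last K', b) \<in> R"
      using K'(1) by (auto simp: cyc_def successively_Cons split: if_splits)
    have sub: "set (a # K) \<subseteq> V" using K(6) by auto
    have disj: "set (P @ (b # K') @ concat Ls'') \<inter> set (a # K) = {}" unfolding K'(4) by blast
    have dK: "distinct (a # K)" using K(5) by auto
    have full: "set (P @ (b # K') @ concat Ls'') \<union> set (a # K) = V" unfolding K'(4) using sub by blast
    have "far (hd K')"
    proof (rule off_path_neighbours_far(1)[OF P' K'(1) _ _ _ _ b(1,2), of "(a # K) # Ls''"])
      show "distinct (P @ (b # K') @ concat ((a # K) # Ls''))" using K'(3) disj dK by auto
      show "set (P @ (b # K') @ concat ((a # K) # Ls'')) = V" using full by auto
    qed (use K'(2,5) K(1) in auto)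
    then have t: "far (hd K')" "(a, hd K') \<in> R" using cK' far_common by auto
    have "last K \<noteq> hd K'" using disj cK cK' disjoint_ends[of K K'] by (auto simp: Int_Un_distrib Int_Un_distrib2 Int_commute)
    then have st: "(last K, hd K') \<in> R" using far_clique[of "last K" "hd K'"] K(3) cK(4) t adj_sym by blast
    let ?Q = "P @ a # K @ K' @ [b]"
    have "(last ?Q, hd ?Q) \<notin> R"
    proof (rule not_closable[of _ Ls''])
      show "path R ?Q" using P' cK cK' st a b by (auto simp: list_simps adj_sym)
      show "distinct (?Q @ concat Ls'')" using K'(3) disj dK by auto
      show "set (?Q @ concat Ls'') = V" using full by auto
    qed (use K'(2,5) P'(4) in \<open>auto simp: Suc_le_eq\<close>)
    then show False using P' b by simp
  qed
qed

end

context blocked_sun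
begin

lemma one_off_path:
  assumes P: "chord_cover P Ls" and off: "a \<notin> set P" and on: "b \<in> set P"
  shows False
proof -
  interpret r: blocked_sun R V m v u x a b by (rule reverse_sun)
  obtain A B where AB: "P = A @ x # B" using x_on_path[OF P] .
  have "b \<noteq> x" using b irrefl by auto
  with on AB consider "b \<in> set A" | "b \<in> set B" by auto
  then show False
  proof cases
    case 1
    then obtain A1 N where "A = A1 @ b # N" by (meson split_list)
    then show False using one_off_path_before[of A1 N B Ls] P off AB by auto
  next
    case 2
    then obtain N B1 where "B = N @ b # B1" by (meson split_list)
    then show False using r.one_off_path_before[of "rev B1" "rev N" "rev A" Ls]
       chord_cover_reverse[OF P] off AB by auto
  qed
qed

lemma before_implies_False:
  assumes P: "chord_cover (A @ a # M @ x # B) Ls" and on: "b \<in> set (A @ a # M @ x # B)"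
  shows False
proof -
  interpret s: blocked_sun R V m u v x b a by (rule swap)
  have "b \<noteq> x" "b \<noteq> a" using b ab irrefl by auto
  with on consider "b \<in> set A" | "b \<in> set M" | "b \<in> set B" by auto
  then show False
  proof cases
    case 1
    then obtain A1 N where "A = A1 @ b # N" by (meson split_list)
    then show False using s.both_before[of A1 N M B Ls] P by auto
  next
    case 2
    then obtain M1 N where "M = M1 @ b # N" by (meson split_list)
    then show False using both_before[of A M1 N B Ls] P by auto
  next
    case 3
    then obtain N B1 where "B = N @ b # B1" by (meson split_list)
    then show False using on_both_sides[of A M N B1 Ls] P by auto
  qed
qed

theorem no_chord_cover: "\<not> chord_cover P Ls"
proof
  assume P: "chord_cover P Ls"
  interpret s: blocked_sun R V m u v x b a by (rule swap)
  interpret r: blocked_sun R V m v u x a b by (rule reverse_sun)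
  show False
  proof (cases "a \<in> set P \<and> b \<in> set P")
    case False
    then show False using both_off_path[OF P] one_off_path[OF P] s.one_off_path[OF P] by blast
  next
    case True
    obtain A B where AB: "P = A @ x # B" using x_on_path[OF P] .
    have "a \<noteq> x" using a irrefl by auto
    with True AB consider "a \<in> set A" | "a \<in> set B" by auto
    then show False
    proof cases
      case 1
      then obtain A1 M where "A = A1 @ a # M" by (meson split_list)
      then show False using before_implies_False[of A1 M B Ls] P True AB by auto
    next
      case 2
      then obtain M B1 where "B = M @ a # B1" by (meson split_list)
      then show False using r.before_implies_False[of "rev B1" "rev M" "rev A" Ls]
        chord_cover_reverse[OF P] True AB by auto
    qed
  qed
qed

end

section \<open>The closure of a claw-free graph\<close>

definition simple_graph_on :: "'a set \<Rightarrow> 'a rel \<Rightarrow> bool" where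
  "simple_graph_on V E \<longleftrightarrow> finite V \<and> E \<subseteq> V \<times> V \<and> sym E \<and> irrefl E"

definition no_claw :: "'a rel \<Rightarrow> bool" where
  "no_claw E \<longleftrightarrow> (\<forall>c p q r. (c, p) \<in> E \<longrightarrow> (c, q) \<in> E \<longrightarrow> (c, r) \<in> E \<longrightarrow>
     p \<noteq> q \<longrightarrow> q \<noteq> r \<longrightarrow> p \<noteq> r \<longrightarrow> (p, q) \<in> E \<or> (q, r) \<in> E \<or> (p, r) \<in> E)"

definition locally_transitive :: "'a rel \<Rightarrow> bool" where
  "locally_transitive E \<longleftrightarrow> (\<forall>x u y v. (x, u) \<in> E \<longrightarrow> (x, y) \<in> E \<longrightarrow> (x, v) \<in> E \<longrightarrow>
     (u, y) \<in> E \<longrightarrow> (y, v) \<in> E \<longrightarrow> u \<noteq> v \<longrightarrow> (u, v) \<in> E)"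

lemma no_clawD:
  "\<lbrakk>no_claw E; (c, p) \<in> E; (c, q) \<in> E; (c, r) \<in> E; p \<noteq> q; q \<noteq> r; p \<noteq> r\<rbrakk>
    \<Longrightarrow> (p, q) \<in> E \<or> (q, r) \<in> E \<or> (p, r) \<in> E"
  unfolding no_claw_def by blast

text \<open>
  Covers are pulled back along one edge at a time, so a condition has to be checked only for a
  graph \<open>R\<close> between the two graphs and one missing edge.
\<close>

lemma cycle_cover_remove_edges:
  assumes "finite E'" "E \<subseteq> E'" "sym E" "sym E'"
    and step: "\<And>R u v. \<lbrakk>E \<subseteq> R; R \<subseteq> E'; sym R; (u, v) \<in> E'; (u, v) \<notin> R;
      cycle_cover (R \<union> {(u, v), (v, u)}) V m\<rbrakk> \<Longrightarrow> cycle_cover R V m"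
    and "cycle_cover E' V m"
  shows "cycle_cover E V m"
  using assms(2,3) step
proof (induction "card (E' - E)" arbitrary: E rule: less_induct)
  case less
  show ?case
  proof (cases "E = E'")
    case True
    then show ?thesis using assms(6) by simp
  next
    case False
    then obtain u v where uv: "(u, v) \<in> E'" "(u, v) \<notin> E" using less.prems(1) by auto
    let ?R = "E \<union> {(u, v), (v, u)}"
    have R: "E \<subseteq> ?R" "?R \<subseteq> E'" "sym ?R"
      using less.prems(1,2) uv assms(4) by (auto simp: sym_def)
    have "card (E' - ?R) < card (E' - E)"
      using uv assms(1) by (intro psubset_card_mono) auto
    then have "cycle_cover ?R V m"
      using R(2,3) by (rule less.hyps) (use less.prems(3) R(1) in blast)
    then show ?thesis using less.prems(1,2) less.prems(3)[of E u v] uv by blast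
  qed
qed

locale local_completion =
  fixes V :: "'a set" and E :: "'a rel" and x :: 'a
  assumes graph: "simple_graph_on V E" and claws: "no_claw E"
begin

definition N :: "'a set" where "N = E `` {x}"

text \<open>
  The neighbourhood of \<open>x\<close> is completed in two stages, pairs at distance two in it first. The
  removal of an edge between vertices at distance three relies on the presence of all edges of
  the first stage.
\<close>

definition dist2_completion :: "'a rel" where
  "dist2_completion = E \<union> {(u, v). u \<in> N \<and> v \<in> N \<and> u \<noteq> v \<and> (\<exists>y\<in>N. (u, y) \<in> E \<and> (y, v) \<in> E)}"

definition completion :: "'a rel" where
  "completion = E \<union> {(u, v). u \<in> N \<and> v \<in> N \<and> u \<noteq> v}"

lemma adj_sym: "(a, b) \<in> E \<longleftrightarrow> (b, a) \<in> E"
  using graph by (auto simp: simple_graph_on_def dest: symD)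

lemma no_loop: "(a, a) \<notin> E"
  using graph by (auto simp: simple_graph_on_def irrefl_def)

lemma N_iff: "s \<in> N \<longleftrightarrow> (x, s) \<in> E"
  by (simp add: N_def)

lemma x_notin_N: "x \<notin> N"
  using no_loop by (simp add: N_iff)

lemma dominated:
  assumes "u \<in> N" "v \<in> N" "u \<noteq> v" "(u, v) \<notin> E" "s \<in> N"
  shows "s = u \<or> s = v \<or> (s, u) \<in> E \<or> (s, v) \<in> E"
  using no_clawD[OF claws, of x u v s] assms by (auto simp: N_iff adj_sym)

lemma completion_chain: "E \<subseteq> dist2_completion" "dist2_completion \<subseteq> completion" by (auto simp: dist2_completion_def completion_def)

lemma sym_dist2: "sym dist2_completion" by (auto simp: dist2_completion_def sym_def adj_sym)

lemma graph_completion: "simple_graph_on V completion"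
  using graph by (auto simp: simple_graph_on_def completion_def sym_def irrefl_def N_def)

lemma graph_between:
  assumes "E \<subseteq> R" "R \<subseteq> completion" "sym R"
  shows "simple_graph_on V R"
  using graph_completion assms by (auto simp: simple_graph_on_def irrefl_def)

lemma x_edges: "R \<subseteq> completion \<Longrightarrow> (x, s) \<in> R \<Longrightarrow> s \<in> N"
  using x_notin_N by (auto simp: completion_def N_iff)

lemma outside_edges: "R \<subseteq> completion \<Longrightarrow> (y, s) \<in> R \<Longrightarrow> s \<notin> N \<Longrightarrow> (y, s) \<in> E"
  by (auto simp: completion_def)

lemma blocked:
  assumes R: "E \<subseteq> R" "R \<subseteq> completion" "sym R" and uv: "u \<in> N" "v \<in> N" "u \<noteq> v" "(u, v) \<notin> R"
    and no: "\<not> cycle_cover R V m"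
  shows "blocked_chord R V m u v x"
proof
  show "R \<subseteq> V \<times> V" "\<And>a. (a, a) \<notin> R" using graph_between[OF R] by (auto simp: simple_graph_on_def irrefl_def)
  show "(x, u) \<in> R" "(x, v) \<in> R" using uv R by (auto simp: N_iff)
  fix s assume "(x, s) \<in> R"
  then have "s \<in> N" using x_edges R by blast
  then show "s = u \<or> s = v \<or> (s, u) \<in> R \<or> (s, v) \<in> R"
    using dominated[of u v s] uv R by blast
qed (use R no in auto)

lemma blocked_cover:
  assumes R: "E \<subseteq> R" "R \<subseteq> completion" "sym R" and uv: "u \<in> N" "v \<in> N" "u \<noteq> v" "(u, v) \<notin> R"
    and no: "\<not> cycle_cover R V m" and cov: "cycle_cover (R \<union> {(u, v), (v, u)}) V m"
  obtains P Ls where "blocked_chord.chord_cover R V m u v P Ls"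
proof -
  interpret blocked_chord R V m u v x by (rule blocked[OF R uv no])
  obtain P Ls where "path_cover R V m P Ls" "hd P = u" "last P = v" "3 \<le> length P"
    using cycle_cover_or_path_cover[OF cov no R(3)] .
  moreover from this have "P \<noteq> []" by auto
  ultimately show ?thesis using that[of P Ls] by (simp add: chord_cover_def)
qed

text \<open>
  The middle vertex \<open>y\<close> of the path from \<open>u\<close> to \<open>v\<close> has no far neighbour: together with \<open>u\<close> and
  \<open>v\<close> such a neighbour would form a claw centred at \<open>x\<close> or \<open>y\<close>.
\<close>

lemma distance_two_step:
  assumes R: "E \<subseteq> R" "R \<subseteq> dist2_completion" "sym R" and uv: "(u, v) \<in> dist2_completion" "(u, v) \<notin> R"
    and cov: "cycle_cover (R \<union> {(u, v), (v, u)}) V m"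
  shows "cycle_cover R V m"
proof (rule ccontr)
  assume no: "\<not> cycle_cover R V m"
  have R2: "R \<subseteq> completion" using R completion_chain by blast
  obtain y where y: "y \<in> N" "(u, y) \<in> E" "(y, v) \<in> E" and uv': "u \<in> N" "v \<in> N" "u \<noteq> v" "(u, v) \<notin> E"
    using uv R by (auto simp: dist2_completion_def)
  interpret blocked_chord R V m u v x by (rule blocked[OF R(1) R2 R(3) uv'(1-3) uv(2) no])
  obtain P Ls where P: "chord_cover P Ls" using blocked_cover[OF R(1) R2 R(3) uv'(1-3) uv(2) no cov] .
  have "(y, u) \<in> R" "(y, v) \<in> R" "(y, x) \<in> R" using y R by (auto simp: N_iff local_completion.adj_sym[OF local_completion_axioms])
  then obtain s where s: "(y, s) \<in> R" "far s" using ex_far_neighbour[OF P] by blast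
  have "s \<notin> N" using dominated[OF uv', of s] s(2) R(1) by (auto simp: far_def)
  then have "(y, s) \<in> E" using outside_edges[OF R2] s by blast
  then show False
    using no_clawD[OF claws, of y u v s] y uv' s(2) R(1)
    by (auto simp: far_def local_completion.adj_sym[OF local_completion_axioms])
qed

text \<open>
  The closed neighbourhoods of \<open>u\<close> and \<open>v\<close> split the neighbourhood of \<open>x\<close> into two disjoint
  cliques \<open>A\<close> and \<open>B\<close>. As \<open>u0 y0 v0\<close> is an induced path, there is an edge \<open>ab\<close> between them. The
  absence of claws at \<open>a\<close> and \<open>b\<close> shows that their far neighbours coincide and form a clique.
\<close>

lemma distance_three_step:
  assumes el: "(x, u0) \<in> E" "(x, y0) \<in> E" "(x, v0) \<in> E" "(u0, y0) \<in> E" "(y0, v0) \<in> E" "u0 \<noteq> v0" "(u0, v0) \<notin> E"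
    and R: "dist2_completion \<subseteq> R" "R \<subseteq> completion" "sym R" and uv: "(u, v) \<in> completion" "(u, v) \<notin> R"
    and cov: "cycle_cover (R \<union> {(u, v), (v, u)}) V m"
  shows "cycle_cover R V m"
proof (rule ccontr)
  assume no: "\<not> cycle_cover R V m"
  have RE: "E \<subseteq> R" using R completion_chain by blast
  have uv': "u \<in> N" "v \<in> N" "u \<noteq> v" "(u, v) \<notin> E"
    using uv RE by (auto simp: completion_def)
  have no_common: "\<not> (y \<in> N \<and> (u, y) \<in> E \<and> (y, v) \<in> E)" for y
    using uv uv' R(1) by (auto simp: dist2_completion_def)
  define A where "A = {s \<in> N. s = u \<or> (s, u) \<in> E}"
  define B where "B = {s \<in> N. s = v \<or> (s, v) \<in> E}"
  have AB: "N = A \<union> B" using dominated[OF uv'] by (auto simp: A_def B_def)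
  have clique_A: "s = t \<or> (s, t) \<in> E" if "s \<in> A" "t \<in> A" for s t
  proof -
    have "s \<noteq> v" "t \<noteq> v" "(s, v) \<notin> E" "(t, v) \<notin> E"
      using that no_common[of s] no_common[of t] uv' adj_sym[of s u] adj_sym[of t u] adj_sym[of v u]
      by (auto simp: A_def)
    moreover have "(x, s) \<in> E" "(x, t) \<in> E" "(x, v) \<in> E" using that uv' by (auto simp: A_def N_iff)
    ultimately show ?thesis using no_clawD[OF claws, of x s t v] by blast
  qed
  have clique_B: "s = t \<or> (s, t) \<in> E" if "s \<in> B" "t \<in> B" for s t
  proof -
    have "s \<noteq> u" "t \<noteq> u" "(s, u) \<notin> E" "(t, u) \<notin> E"
      using that no_common[of s] no_common[of t] uv' adj_sym[of s u] adj_sym[of t u] adj_sym[of v u]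
      by (auto simp: B_def)
    moreover have "(x, s) \<in> E" "(x, t) \<in> E" "(x, u) \<in> E" using that uv' by (auto simp: B_def N_iff)
    ultimately show ?thesis using no_clawD[OF claws, of x s t u] by blast
  qed
  have "u0 \<in> N" "y0 \<in> N" "v0 \<in> N" using el(1-3) by (simp_all add: N_iff)
  then have "u0 \<in> A \<union> B" "y0 \<in> A \<union> B" "v0 \<in> A \<union> B" unfolding AB by simp_all
  then have "u0 \<in> A \<and> v0 \<in> B \<or> u0 \<in> B \<and> v0 \<in> A" "y0 \<in> A \<or> y0 \<in> B"
    using clique_A[of u0 v0] clique_B[of u0 v0] el(6,7) by auto
  moreover have "(y0, u0) \<in> E" "(v0, y0) \<in> E" using el(4,5) adj_sym by auto
  ultimately obtain a b where ab: "a \<in> A" "b \<in> B" "(a, b) \<in> E" using el(4,5) by metis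
  have nub: "(u, b) \<notin> E" and nav: "(a, v) \<notin> E"
    using ab no_common uv' by (auto simp: A_def B_def adj_sym)
  have a: "a \<in> N" "(a, u) \<in> E" and b: "b \<in> N" "(b, v) \<in> E"
    using ab nub nav by (auto simp: A_def B_def adj_sym)
  have ne: "a \<noteq> v" "b \<noteq> u" using a b uv' by (auto simp: adj_sym)
  moreover have "(b, a) \<in> E" using ab(3) adj_sym by blast
  ultimately have "(a, v) \<in> dist2_completion" "(b, u) \<in> dist2_completion"
    using a b ab(3) uv' unfolding dist2_completion_def by auto
  then have av: "(a, v) \<in> R" "(b, u) \<in> R" using R(1) by auto
  interpret c: blocked_chord R V m u v x by (rule blocked[OF RE R(2,3) uv'(1-3) uv(2) no])
  have far_outside: "s \<notin> N" if "c.far s" for s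
    using dominated[OF uv', of s] that RE by (auto simp: c.far_def)
  have far_nonadj: "s \<noteq> a" "s \<noteq> b" "s \<noteq> u" "s \<noteq> v" "(s, u) \<notin> E" "(s, v) \<notin> E" if "c.far s" for s
    using far_outside[OF that] a b that RE by (auto simp: c.far_def)
  have far_ab: "(b, s) \<in> E" if "c.far s" "(a, s) \<in> E" for s
    using no_clawD[OF claws, of a s u b] far_nonadj[OF that(1)] that(2) a ab(3) nub ne adj_sym by blast
  have far_ba: "(a, s) \<in> E" if "c.far s" "(b, s) \<in> E" for s
    using no_clawD[OF claws, of b s v a] far_nonadj[OF that(1)] that(2) b ab(3) nav ne adj_sym by metis
  have outside: "(y, s) \<in> R \<longleftrightarrow> (y, s) \<in> E" if "c.far s" for y s
    using outside_edges[OF R(2), of y s] far_outside[OF that] RE by blast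
  interpret blocked_sun R V m u v x a b
  proof
    show "(a, u) \<in> R" "(a, v) \<in> R" "(b, u) \<in> R" "(b, v) \<in> R" "(a, b) \<in> R"
      using av a b ab RE by auto
    show "(a, x) \<in> R" "(b, x) \<in> R" using a b RE by (auto simp: N_iff adj_sym)
    show "(a, s) \<in> R \<longleftrightarrow> (b, s) \<in> R" if "c.far s" for s
      using far_ab far_ba outside that by blast
    show "s = t \<or> (s, t) \<in> R" if "c.far s" "c.far t" "(a, s) \<in> R" "(a, t) \<in> R" for s t
      using no_clawD[OF claws, of a s t u] that outside a RE far_nonadj[OF that(1)] far_nonadj[OF that(2)]
      by blast
  qed
  obtain P Ls where P: "c.chord_cover P Ls" using blocked_cover[OF RE R(2,3) uv'(1-3) uv(2) no cov] .
  then show False using no_chord_cover by blast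
qed

lemma cycle_cover_pullback:
  assumes el: "(x, u0) \<in> E" "(x, y0) \<in> E" "(x, v0) \<in> E" "(u0, y0) \<in> E" "(y0, v0) \<in> E" "u0 \<noteq> v0" "(u0, v0) \<notin> E"
    and cov: "cycle_cover completion V m"
  shows "cycle_cover E V m"
proof -
  have fin: "finite completion" "sym completion" using graph_completion by (auto simp: simple_graph_on_def intro: finite_subset)
  have fin1: "finite dist2_completion" by (rule finite_subset[OF completion_chain(2) fin(1)])
  have "cycle_cover dist2_completion V m"
    by (rule cycle_cover_remove_edges[OF fin(1) completion_chain(2) sym_dist2 fin(2) _ cov])
       (rule distance_three_step[OF el])
  note c1 = this
  have "sym E" using graph by (simp add: simple_graph_on_def)
  show ?thesis
    by (rule cycle_cover_remove_edges[OF fin1 completion_chain(1) \<open>sym E\<close> sym_dist2 _ c1]) (rule distance_two_step)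
qed

text \<open>
  A neighbour \<open>c\<close> of \<open>x\<close> sees the clique on \<open>x\<close> and its neighbours, and its remaining neighbours
  form a second clique, as two nonadjacent ones would have made a claw with \<open>x\<close>.
\<close>

lemma no_claw_completion: "no_claw completion"
  unfolding no_claw_def
proof (intro allI impI)
  fix c p q r assume c: "(c, p) \<in> completion" "(c, q) \<in> completion" "(c, r) \<in> completion" and ne: "p \<noteq> q" "q \<noteq> r" "p \<noteq> r"
  show "(p, q) \<in> completion \<or> (q, r) \<in> completion \<or> (p, r) \<in> completion"
  proof (cases "c \<in> N")
    case False
    then have "(c, p) \<in> E" "(c, q) \<in> E" "(c, r) \<in> E" using c by (auto simp: completion_def)
    then show ?thesis using no_clawD[OF claws _ _ _ ne] completion_chain by blast
  next
    case True
    have outer: "(s, t) \<in> E" if "(c, s) \<in> completion" "(c, t) \<in> completion" "s \<noteq> t" "s \<notin> insert x N" "t \<notin> insert x N" for s t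
    proof -
      have "(c, s) \<in> E" "(c, t) \<in> E" "(c, x) \<in> E" "(s, x) \<notin> E" "(t, x) \<notin> E"
        using that True adj_sym by (auto simp: N_iff completion_def)
      then show ?thesis using no_clawD[OF claws, of c s t x] that by blast
    qed
    have inner: "(s, t) \<in> completion" if "s \<noteq> t" "s \<in> insert x N" "t \<in> insert x N" for s t
      using that by (auto simp: completion_def N_iff adj_sym)
    show ?thesis
      using inner[of p q] inner[of q r] inner[of p r] outer[of p q] outer[of q r] outer[of p r] c ne completion_chain
      by blast
  qed
qed

lemma completion_larger: "\<lbrakk>(x, u) \<in> E; (x, v) \<in> E; u \<noteq> v; (u, v) \<notin> E\<rbrakk> \<Longrightarrow> E \<subset> completion"
  by (auto simp: completion_def N_iff)

end

text \<open>
  Ryjacek's closure: completing neighbourhoods until it is no longer possible leaves a graph in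
  which adjacency is transitive inside every neighbourhood.
\<close>

theorem closure_exists:
  assumes "simple_graph_on V E" "no_claw E"
  obtains E' where "E \<subseteq> E'" "simple_graph_on V E'" "no_claw E'" "locally_transitive E'"
    "\<And>m. cycle_cover E' V m \<Longrightarrow> cycle_cover E V m"
proof -
  have "\<exists>E'. E \<subseteq> E' \<and> simple_graph_on V E' \<and> no_claw E' \<and> locally_transitive E'
      \<and> (\<forall>m. cycle_cover E' V m \<longrightarrow> cycle_cover E V m)"
    using assms
  proof (induction "card (V \<times> V - E)" arbitrary: E rule: less_induct)
    case less
    show ?case
    proof (cases "locally_transitive E")
      case True
      then show ?thesis using less.prems by blast
    next
      case False
      then obtain x u y v where el: "(x, u) \<in> E" "(x, y) \<in> E" "(x, v) \<in> E" "(u, y) \<in> E" "(y, v) \<in> E"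
          "u \<noteq> v" "(u, v) \<notin> E" unfolding locally_transitive_def by blast
      interpret local_completion V E x using less.prems by unfold_locales
      have sub: "E \<subset> completion" using completion_larger el by blast
      moreover have "completion \<subseteq> V \<times> V" "finite V" using graph_completion by (auto simp: simple_graph_on_def)
      ultimately have "card (V \<times> V - completion) < card (V \<times> V - E)" by (intro psubset_card_mono) auto
      from less.hyps[OF this graph_completion no_claw_completion] obtain E' where
        "completion \<subseteq> E'" "simple_graph_on V E'" "no_claw E'" "locally_transitive E'"
        "\<forall>m. cycle_cover E' V m \<longrightarrow> cycle_cover completion V m" by (elim exE conjE)
      then show ?thesis using sub cycle_cover_pullback[OF el] by (intro exI[of _ E']) auto
    qed
  qed
  then show ?thesis using that by blast
qed

section \<open>Even edge sets and optimal systems in a triangle-free graph\<close>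

text \<open>
  A finite simple triangle-free graph whose edges are abstract objects with a set of two ends.
  The edges will be the vertices of the closed claw-free graph.
\<close>

locale triangle_free_incidence =
  fixes E :: "'a set" and ends :: "'a \<Rightarrow> 'b set"
  assumes finite_E: "finite E" and card_ends: "e \<in> E \<Longrightarrow> card (ends e) = 2"
    and inj_ends: "inj_on ends E"
    and triangle_free: "\<lbrakk>e \<in> E; f \<in> E; g \<in> E; p \<noteq> q; q \<noteq> r; p \<noteq> r;
      ends e = {p, q}; ends f = {q, r}; ends g = {p, r}\<rbrakk> \<Longrightarrow> False"
begin

definition "V = \<Union> (ends ` E)"

definition edges_at :: "'a set \<Rightarrow> 'b \<Rightarrow> 'a set" where
  "edges_at F p = {e \<in> F. p \<in> ends e}"

definition even_set :: "'a set \<Rightarrow> bool" where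
  "even_set F \<longleftrightarrow> F \<subseteq> E \<and> (\<forall>p. even (card (edges_at F p)))"

definition supp :: "'a set \<Rightarrow> 'b set" where
  "supp F = \<Union> (ends ` F)"

definition link :: "'a set \<Rightarrow> 'b rel" where
  "link F = {(p, q). \<exists>e\<in>F. ends e = {p, q}}"

definition reach :: "'a set \<Rightarrow> 'b rel" where
  "reach F = (link F)\<^sup>*"

definition inside :: "'b set \<Rightarrow> 'a set" where
  "inside U = {e \<in> E. ends e \<subseteq> U}"

lemma finite_sub: "F \<subseteq> E \<Longrightarrow> finite F" using finite_E finite_subset by blast

lemma finite_ends: "e \<in> E \<Longrightarrow> finite (ends e)" by (metis card_ends card.infinite zero_neq_numeral)

lemma finite_V: "finite V" using finite_E finite_ends by (auto simp: V_def)

lemma obtain_ends: assumes "e \<in> E" obtains p q where "ends e = {p, q}" "p \<noteq> q"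
  using card_ends[OF assms] by (auto simp: card_2_iff)

lemma obtain_other_end: assumes "e \<in> E" "p \<in> ends e" obtains q where "ends e = {p, q}" "p \<noteq> q"
proof -
  obtain a b where ab: "ends e = {a, b}" "a \<noteq> b" using obtain_ends[OF assms(1)] .
  then consider "p = a" | "p = b" using assms(2) by blast
  then show thesis
  proof cases
    case 1
    then show thesis using that[of b] ab by simp
  next
    case 2
    then show thesis using that[of a] ab by (simp add: insert_commute)
  qed
qed

lemma edge_eqI: "\<lbrakk>e \<in> E; f \<in> E; ends e = ends f\<rbrakk> \<Longrightarrow> e = f"
  using inj_ends by (auto dest: inj_onD)

lemma ends_sub_V: "e \<in> E \<Longrightarrow> ends e \<subseteq> V" by (auto simp: V_def)

lemma supp_sub_V: "F \<subseteq> E \<Longrightarrow> supp F \<subseteq> V" by (auto simp: V_def supp_def)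

lemma finite_supp: "F \<subseteq> E \<Longrightarrow> finite (supp F)" using supp_sub_V finite_V finite_subset by blast

lemma link_sym: "(p, q) \<in> link F \<longleftrightarrow> (q, p) \<in> link F" by (auto simp: link_def insert_commute)

lemma link_neq: assumes "F \<subseteq> E" "(p, q) \<in> link F" shows "p \<noteq> q"
proof -
  obtain e where "e \<in> E" "ends e = {p, q}" using assms unfolding link_def by blast
  then show ?thesis using card_ends[of e] by auto
qed

lemma link_triangle_free:
  assumes "(p, q) \<in> link E" "(q, r) \<in> link E" "(p, r) \<in> link E"
  shows False
proof -
  have "p \<noteq> q" "q \<noteq> r" "p \<noteq> r" using link_neq[OF order_refl] assms by blast+
  moreover obtain e f g where "e \<in> E" "ends e = {p, q}" "f \<in> E" "ends f = {q, r}" "g \<in> E" "ends g = {p, r}"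
    using assms unfolding link_def by blast
  ultimately show False using triangle_free[of e f g p q r] by blast
qed

lemma link_mono: "F \<subseteq> F' \<Longrightarrow> link F \<subseteq> link F'" by (auto simp: link_def)

lemma reach_refl [simp]: "(p, p) \<in> reach F" by (simp add: reach_def)

lemma reach_link: "(p, q) \<in> link F \<Longrightarrow> (p, q) \<in> reach F" by (simp add: reach_def)

lemma edge_reach: "e \<in> F \<Longrightarrow> ends e = {p, q} \<Longrightarrow> (p, q) \<in> reach F"
  by (rule reach_link) (auto simp: link_def)

lemma reach_trans: "(p, q) \<in> reach F \<Longrightarrow> (q, r) \<in> reach F \<Longrightarrow> (p, r) \<in> reach F"
  by (simp add: reach_def)

lemma reach_sym: "(p, q) \<in> reach F \<Longrightarrow> (q, p) \<in> reach F"
proof -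
  have "sym (link F)" using link_sym by (auto simp: sym_def)
  then show "(p, q) \<in> reach F \<Longrightarrow> (q, p) \<in> reach F" unfolding reach_def using sym_rtrancl by (metis symD)
qed

lemma reach_mono: "link F \<subseteq> reach F' \<Longrightarrow> reach F \<subseteq> reach F'"
  unfolding reach_def using rtrancl_subset_rtrancl by blast

lemma reach_neq_supp: "(p, q) \<in> reach F \<Longrightarrow> p \<noteq> q \<Longrightarrow> p \<in> supp F"
  unfolding reach_def by (erule converse_rtranclE) (auto simp: link_def supp_def)

lemma reach_supp: "(p, q) \<in> reach F \<Longrightarrow> p \<in> supp F \<Longrightarrow> q \<in> supp F"
  using reach_neq_supp reach_sym by metis

lemma edges_at_finite: "F \<subseteq> E \<Longrightarrow> finite (edges_at F p)" using finite_sub by (auto simp: edges_at_def)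

lemma double_count:
  assumes "F \<subseteq> E" "finite K"
  shows "(\<Sum>p\<in>K. card (edges_at F p)) = (\<Sum>e\<in>F. card (ends e \<inter> K))"
proof -
  have "(\<Sum>p\<in>K. card (edges_at F p)) = (\<Sum>p\<in>K. \<Sum>e | e \<in> F \<and> p \<in> ends e. 1)"
    by (simp add: edges_at_def)
  also have "\<dots> = (\<Sum>e\<in>F. \<Sum>p | p \<in> K \<and> p \<in> ends e. 1)"
    by (rule sum.swap_restrict[OF assms(2) finite_sub[OF assms(1)]])
  also have "\<dots> = (\<Sum>e\<in>F. card (ends e \<inter> K))"
    by (intro sum.cong) (auto intro: arg_cong[where f = card])
  finally show ?thesis .
qed

text \<open>
  Summing the even degrees over \<open>K\<close> counts the edges inside \<open>K\<close> twice.
\<close>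

lemma even_cut:
  assumes "even_set F" "finite K"
  shows "even (card {e \<in> F. card (ends e \<inter> K) = 1})"
proof -
  have F: "F \<subseteq> E" using assms by (simp add: even_set_def)
  have "even (\<Sum>p\<in>K. card (edges_at F p))" using assms(1) by (intro dvd_sum) (auto simp: even_set_def)
  then have ev: "even (card {e \<in> F. odd (card (ends e \<inter> K))})"
    unfolding double_count[OF F assms(2)] even_sum_iff[OF finite_sub[OF F]] .
  have odd1: "odd (card (ends e \<inter> K)) \<longleftrightarrow> card (ends e \<inter> K) = 1" if "e \<in> F" for e
  proof -
    have "card (ends e \<inter> K) \<le> 2"
      using card_mono[of "ends e" "ends e \<inter> K"] finite_ends[of e] card_ends[of e] that F by auto
    then have "card (ends e \<inter> K) \<in> {0, 1, 2}" by auto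
    then show ?thesis by auto
  qed
  have "{e \<in> F. odd (card (ends e \<inter> K))} = {e \<in> F. card (ends e \<inter> K) = 1}" using odd1 by blast
  with ev show ?thesis by simp
qed

lemma even_symdiff:
  assumes "finite A" "finite B"
  shows "even (card ((A - B) \<union> (B - A))) \<longleftrightarrow> (even (card A) \<longleftrightarrow> even (card B))"
proof -
  have "card ((A - B) \<union> (B - A)) = card (A - B) + card (B - A)"
    using assms by (intro card_Un_disjoint) auto
  moreover have "card A = card (A - B) + card (A \<inter> B)" "card B = card (B - A) + card (A \<inter> B)"
    using card_Int_Diff[OF assms(1), of B] card_Int_Diff[OF assms(2), of A] by (simp_all add: Int_commute)
  ultimately show ?thesis by auto
qed

lemma edges_at_symdiff:
  "edges_at ((F - G) \<union> (G - F)) p = (edges_at F p - edges_at G p) \<union> (edges_at G p - edges_at F p)"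
  by (auto simp: edges_at_def)

lemma even_set_symdiff:
  assumes "even_set F" "even_set G"
  shows "even_set ((F - G) \<union> (G - F))"
  using assms unfolding even_set_def edges_at_symdiff
  by (auto simp: even_symdiff edges_at_finite)

text \<open>
  By the handshake lemma a single vertex is never the set of odd vertices of an edge set, so
  there are fewer than \<open>2 ^ card U\<close> sets of odd vertices but at least that many edge sets. Two
  edge sets with the same odd vertices have an even symmetric difference.
\<close>

lemma even_set_exists:
  assumes U: "finite U" "U \<noteq> {}" "card U \<le> card (inside U)"
  obtains C where "C \<subseteq> inside U" "C \<noteq> {}" "even_set C"
proof -
  define odds where "odds F = {p \<in> U. odd (card (edges_at F p))}" for F
  have sub: "inside U \<subseteq> E" by (auto simp: inside_def)
  obtain p0 where p0: "p0 \<in> U" using U by auto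
  have "odds F \<noteq> {p0}" if "F \<subseteq> inside U" for F
  proof
    assume "odds F = {p0}"
    have F: "F \<subseteq> E" using that sub by blast
    have "even (\<Sum>e\<in>F. card (ends e \<inter> U))"
    proof (rule dvd_sum)
      fix e assume "e \<in> F"
      then have "ends e \<inter> U = ends e" "e \<in> E" using that by (auto simp: inside_def)
      then show "even (card (ends e \<inter> U))" using card_ends by simp
    qed
    then have "even (card {p \<in> U. odd (card (edges_at F p))})"
      unfolding double_count[OF F U(1), symmetric] even_sum_iff[OF U(1)] .
    then show False using \<open>odds F = {p0}\<close> by (simp add: odds_def)
  qed
  then have "odds ` Pow (inside U) \<subseteq> Pow U - {{p0}}" by (auto simp: odds_def)
  moreover have "card (Pow U - {{p0}}) < card (Pow U)" using U p0 by (intro psubset_card_mono) auto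
  moreover have "card (Pow U) \<le> card (Pow (inside U))"
    using U finite_sub[OF sub] by (simp add: card_Pow)
  moreover have "finite (Pow U - {{p0}})" using U by simp
  ultimately have "card (odds ` Pow (inside U)) < card (Pow (inside U))"
    by (meson card_mono le_less_trans less_le_trans)
  then have "\<not> inj_on odds (Pow (inside U))" using card_image by fastforce
  then obtain A B where AB: "A \<subseteq> inside U" "B \<subseteq> inside U" "A \<noteq> B" "odds A = odds B"
    by (auto simp: inj_on_def)
  let ?C = "(A - B) \<union> (B - A)"
  have "even_set ?C"
    unfolding even_set_def
  proof (intro conjI allI)
    fix p
    have fin: "finite (edges_at A p)" "finite (edges_at B p)" using AB sub edges_at_finite by blast+
    show "even (card (edges_at ?C p))"
    proof (cases "p \<in> U")
      case True
      then have "odd (card (edges_at A p)) \<longleftrightarrow> odd (card (edges_at B p))"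
        using AB(4) unfolding odds_def by blast
      then show ?thesis unfolding edges_at_symdiff by (simp add: even_symdiff[OF fin])
    next
      case False
      then have "edges_at ?C p = {}" using AB(1,2) by (auto simp: edges_at_def inside_def)
      then show ?thesis by simp
    qed
  qed (use AB sub in auto)
  then show ?thesis using that[of ?C] AB by auto
qed

lemma minimal_even_set_exists:
  assumes "C \<subseteq> F" "C \<noteq> {}" "even_set C"
  obtains C' where "C' \<subseteq> F" "C' \<noteq> {}" "even_set C'"
    "\<forall>B. B \<subseteq> C' \<longrightarrow> B \<noteq> {} \<longrightarrow> even_set B \<longrightarrow> B = C'"
proof -
  let ?P = "\<lambda>B. B \<subseteq> F \<and> B \<noteq> {} \<and> even_set B"
  obtain C' where C': "?P C'" "\<And>B. ?P B \<Longrightarrow> card C' \<le> card B"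
    using ex_has_least_nat[of ?P C card] assms by blast
  have "\<forall>B. B \<subseteq> C' \<longrightarrow> B \<noteq> {} \<longrightarrow> even_set B \<longrightarrow> B = C'"
  proof (intro allI impI)
    fix B assume B: "B \<subseteq> C'" "B \<noteq> {}" "even_set B"
    have "finite C'" using C' finite_sub by (auto simp: even_set_def)
    moreover have "card C' \<le> card B" using C' B by blast
    ultimately show "B = C'" using B by (simp add: card_seteq)
  qed
  then show ?thesis using that[of C'] C'(1) by (elim conjE)
qed

lemma component_even:
  assumes "even_set C"
  shows "even_set {e \<in> C. ends e \<subseteq> reach C `` {p}}"
proof -
  let ?B = "{e \<in> C. ends e \<subseteq> reach C `` {p}}"
  have CE: "C \<subseteq> E" using assms by (simp add: even_set_def)
  have "edges_at ?B q = (if (p, q) \<in> reach C then edges_at C q else {})" for q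
  proof -
    have "ends e \<subseteq> reach C `` {p}" if "(p, q) \<in> reach C" "e \<in> C" "q \<in> ends e" for e
    proof -
      have "e \<in> E" "q \<in> ends e" using that CE by auto
      then obtain r where r: "ends e = {q, r}" using obtain_other_end by metis
      then have "(q, r) \<in> link C" using that by (auto simp: link_def)
      then have "(p, r) \<in> reach C" using that(1) reach_link reach_trans by blast
      then show ?thesis using r that(1) by auto
    qed
    then show ?thesis by (auto simp: edges_at_def)
  qed
  then show ?thesis using assms by (auto simp: even_set_def)
qed

text \<open>
  Minimal even sets play the role of cycles: the edges inside a connected component form an even
  set again.
\<close>

lemma minimal_even_set_connected:
  assumes "even_set C" "\<forall>B. B \<subseteq> C \<longrightarrow> B \<noteq> {} \<longrightarrow> even_set B \<longrightarrow> B = C"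
    and "p \<in> supp C" "q \<in> supp C"
  shows "(p, q) \<in> reach C"
proof -
  let ?B = "{e \<in> C. ends e \<subseteq> reach C `` {p}}"
  obtain e where e: "e \<in> C" "p \<in> ends e" using assms(3) by (auto simp: supp_def)
  have CE: "C \<subseteq> E" using assms(1) by (simp add: even_set_def)
  obtain r where r: "ends e = {p, r}" using obtain_other_end[of e p] e CE by blast
  then have "(p, r) \<in> reach C" using e by (intro reach_link) (auto simp: link_def)
  then have "e \<in> ?B" using e r by auto
  then have "?B \<noteq> {}" by (rule ex_in_conv[THEN iffD1, OF exI])
  then have "?B = C" using assms(2)[rule_format, OF _ _ component_even[OF assms(1)], of p] by simp
  then show ?thesis using assms(4) unfolding supp_def by blast
qed

lemma even_set_second_edge:
  assumes "even_set C" "e \<in> C" "p \<in> ends e"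
  obtains f where "f \<in> C" "f \<noteq> e" "p \<in> ends f"
proof -
  have "finite (edges_at C p)" using assms(1) edges_at_finite by (simp add: even_set_def)
  moreover have "even (card (edges_at C p))" using assms(1) by (simp add: even_set_def)
  ultimately have "edges_at C p \<noteq> {e}" by auto
  then show ?thesis using that assms by (auto simp: edges_at_def)
qed

text \<open>
  A system describes a family of closed trails and stars that dominates all edges. The trails
  are the components of the even set \<open>D\<close>, and \<open>R\<close> contains a representative of each of them; the
  elements of \<open>R\<close> that meet no edge of \<open>D\<close> are the centres of the stars. In the line graph each
  trail and each star with at least three edges can be made into a cycle, so \<open>card R\<close> bounds the
  number of cycles.
\<close>

definition system :: "'a set \<Rightarrow> 'b set \<Rightarrow> bool" where
  "system D R \<longleftrightarrow> even_set D \<and> R \<subseteq> V \<and> (\<forall>e\<in>E. ends e \<inter> (supp D \<union> R) \<noteq> {})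
     \<and> (\<forall>p\<in>supp D. \<exists>r\<in>R. (p, r) \<in> reach D)"

text \<open>
  Fewest representatives have priority. Among these systems one whose trails meet as many
  vertices as possible is taken; the second condition is what bounds the degrees of stars from
  below.
\<close>

definition optimal :: "'a set \<Rightarrow> 'b set \<Rightarrow> bool" where
  "optimal D R \<longleftrightarrow> system D R \<and> (\<forall>D' R'. system D' R' \<longrightarrow>
     card R \<le> card R' \<and> (card R' = card R \<longrightarrow> card (supp D') \<le> card (supp D)))"

lemma optimal_exists: obtains D R where "optimal D R"
proof -
  have "system {} V"
  proof -
    have "ends e \<inter> (supp {} \<union> V) \<noteq> {}" if "e \<in> E" for e
    proof -
      have "ends e \<noteq> {}" using card_ends[OF that] by auto
      then show ?thesis using ends_sub_V[OF that] by auto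
    qed
    then show ?thesis by (simp add: system_def even_set_def edges_at_def supp_def)
  qed
  then obtain R where R: "\<exists>D. system D R" "\<And>R' D'. system D' R' \<Longrightarrow> card R \<le> card R'"
    using ex_has_least_nat[of "\<lambda>R. \<exists>D. system D R" V card] by blast
  define good where "good S \<longleftrightarrow> (\<exists>D R'. S = (D, R') \<and> system D R' \<and> card R' = card R)" for S
  have "card (supp (fst S)) < Suc (card V)" if "good S" for S
  proof -
    from that obtain D R' where "S = (D, R')" "D \<subseteq> E" by (auto simp: good_def system_def even_set_def)
    then show ?thesis using card_mono[OF finite_V supp_sub_V] by (simp add: less_Suc_eq_le)
  qed
  moreover obtain D0 where "good (D0, R)" using R(1) by (auto simp: good_def)
  ultimately obtain S where S: "good S" "\<And>S'. good S' \<Longrightarrow> card (supp (fst S')) \<le> card (supp (fst S))"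
    using ex_has_greatest_nat[of good "(D0, R)" "\<lambda>S. card (supp (fst S))" "Suc (card V)"] by blast
  from S(1) obtain D R' where D: "S = (D, R')" "system D R'" "card R' = card R" by (auto simp: good_def)
  have "card (supp D') \<le> card (supp D)" if "system D' R''" "card R'' = card R" for D' R''
    using S(2)[of "(D', R'')"] that D(1) by (auto simp: good_def)
  then have "optimal D R'" using R(2) D by (auto simp: optimal_def)
  then show ?thesis using that by blast
qed

end

locale optimal_system = triangle_free_incidence +
  fixes D R
  assumes optimal: "optimal D R"
begin

definition "Z = supp D \<union> R"

lemma sys: "system D R" using optimal by (simp add: optimal_def)

lemma D_even: "even_set D" and D_E: "D \<subseteq> E" and R_V: "R \<subseteq> V" and finite_R: "finite R"
  using sys finite_V finite_subset by (auto simp: system_def even_set_def)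

lemma cover: "e \<in> E \<Longrightarrow> \<exists>p\<in>ends e. p \<in> Z" using sys by (auto simp: system_def Z_def)

lemma Z_rep: "p \<in> Z \<Longrightarrow> \<exists>r\<in>R. (p, r) \<in> reach D"
  using sys reach_refl unfolding system_def Z_def by (metis Un_iff)

text \<open>
  Since there are no triangles, a thin set contains from each trail at most the two ends of one
  edge.
\<close>

definition thin :: "'b set \<Rightarrow> bool" where
  "thin U \<longleftrightarrow> (\<forall>p\<in>U. \<forall>q\<in>U. p \<noteq> q \<longrightarrow> (p, q) \<in> reach D \<longrightarrow> (p, q) \<in> link D)"

lemma no_smaller: "system D' R' \<Longrightarrow> card R \<le> card R'" using optimal by (auto simp: optimal_def)

text \<open>
  Inside a single component, an even set would have to run between at most two vertices, joined
  by an edge, and uncovered vertices, which are pairwise nonadjacent. That would require a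
  triangle or two edges with the same ends.
\<close>

lemma thin_even_set_meets_two_components:
  assumes thin: "thin U" and C: "C \<subseteq> inside U" "C \<noteq> {}" "even_set C"
  obtains c c' where "c \<in> supp C \<inter> Z" "c' \<in> supp C \<inter> Z" "(c, c') \<notin> reach D"
proof (rule ccontr)
  assume "\<not> thesis"
  then have conn: "(p, q) \<in> reach D" if "p \<in> supp C \<inter> Z" "q \<in> supp C \<inter> Z" for p q using that \<open>\<not> thesis\<close> \<open>\<And>c' c. \<lbrakk>c \<in> supp C \<inter> Z; c' \<in> supp C \<inter> Z; (c, c') \<notin> reach D\<rbrakk> \<Longrightarrow> thesis\<close> by blast
  have CE: "C \<subseteq> E" using C by (simp add: even_set_def)
  have supp_U: "supp C \<subseteq> U" using C(1) by (auto simp: supp_def inside_def)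
  have joined: "(p, q) \<in> link E" if "p \<in> supp C \<inter> Z" "q \<in> supp C \<inter> Z" "p \<noteq> q" for p q
    using thin conn[OF that(1,2)] that supp_U link_mono[OF D_E] unfolding thin_def by blast
  have in_link: "(p, q) \<in> link E" if "e \<in> C" "ends e = {p, q}" for e p q using that CE by (auto simp: link_def)
  have in_supp: "p \<in> supp C" if "e \<in> C" "p \<in> ends e" for e p using that by (auto simp: supp_def)
  obtain e where e: "e \<in> C" using C by auto
  then obtain p where p: "p \<in> ends e" "p \<in> Z" using cover CE by blast
  obtain f where f: "f \<in> C" "f \<noteq> e" "p \<in> ends f" using even_set_second_edge[OF C(3) e p(1)] .
  obtain q where q: "ends e = {p, q}" "p \<noteq> q" using obtain_other_end e p CE by blast
  obtain q' where q': "ends f = {p, q'}" "p \<noteq> q'" using obtain_other_end f CE by blast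
  have qq': "q \<noteq> q'" using q q' f e CE edge_eqI by (metis subsetD)
  \<comment> \<open>Two covered neighbours of \<open>p\<close> would form a triangle with \<open>p\<close>.\<close>
  have "\<exists>g r. g \<in> C \<and> ends g = {p, r} \<and> r \<notin> Z"
  proof (rule ccontr)
    assume "\<not> ?thesis"
    then have "q \<in> Z" "q' \<in> Z" using q q' e f by blast+
    then have "(q, q') \<in> link E" using joined qq' in_supp[OF e] in_supp[OF f(1)] q q' by auto
    then show False using link_triangle_free[of p q q'] in_link e f q q' by blast
  qed
  then obtain g r where g: "g \<in> C" "ends g = {p, r}" "r \<notin> Z" by blast
  obtain h where h: "h \<in> C" "h \<noteq> g" "r \<in> ends h" using even_set_second_edge[OF C(3) g(1)] g(2) by blast
  obtain s where s: "ends h = {r, s}" "r \<noteq> s" using obtain_other_end h CE by blast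
  have "s \<in> Z" using cover[of h] h s g CE by auto
  have "s \<noteq> p" using s g h CE edge_eqI by (metis insert_commute subsetD)
  then have "(p, s) \<in> link E" using joined[of p s] in_supp[OF h(1)] in_supp[OF e] p s \<open>s \<in> Z\<close> by auto
  then show False using link_triangle_free[of p r s] in_link[OF g(1,2)] in_link[OF h(1) s(1)] by blast
qed

text \<open>
  A closed trail has no bridge. The edges of \<open>C\<close> in \<open>D\<close> lie in distinct trails, so each of these
  trails stays connected: otherwise \<open>f\<close> would be the only edge of \<open>D\<close> leaving the component of
  \<open>p\<close> in \<open>D - C\<close>, an odd cut.
\<close>

lemma thin_even_set_keeps_connection:
  assumes thin: "thin U" and C: "C \<subseteq> inside U" and f: "f \<in> D" "f \<in> C" "ends f = {p, q}"
  shows "(p, q) \<in> reach (D - C)"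
proof (rule ccontr)
  assume no: "(p, q) \<notin> reach (D - C)"
  have CU: "ends e \<subseteq> U" if "e \<in> C" for e using that C by (auto simp: inside_def)
  have "link (D - C) \<subseteq> reach D" by (auto simp: link_def intro: edge_reach)
  then have sub: "reach (D - C) \<subseteq> reach D" by (rule reach_mono)
  define K where "K = {s \<in> V. (p, s) \<in> reach (D - C)}"
  have fE: "f \<in> E" using f D_E by blast
  have "p \<in> V" "q \<in> V" using ends_sub_V[OF fE] f by auto
  then have "ends f \<inter> K = {p}" using no f by (auto simp: K_def)
  then have f_cut: "f \<in> {e \<in> D. card (ends e \<inter> K) = 1}" using f by simp
  have "finite K" using finite_V by (simp add: K_def)
  then have "even (card {e \<in> D. card (ends e \<inter> K) = 1})" by (rule even_cut[OF D_even])
  moreover have "finite {e \<in> D. card (ends e \<inter> K) = 1}" using finite_sub[OF D_E] by simp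
  ultimately have "{e \<in> D. card (ends e \<inter> K) = 1} \<noteq> {f}" by auto
  then obtain e where e: "e \<in> D" "e \<noteq> f" "card (ends e \<inter> K) = 1" using f_cut by blast
  then obtain s where s: "ends e \<inter> K = {s}" by (auto simp: card_1_singleton_iff)
  have eE: "e \<in> E" using e D_E by blast
  obtain t where t: "ends e = {s, t}" "s \<noteq> t" using obtain_other_end[OF eE, of s] s by blast
  have tV: "t \<in> V" using ends_sub_V[OF eE] t by auto
  have sK: "s \<in> K" and tK: "t \<notin> K" using s t by auto
  have "e \<in> C"
  proof (rule ccontr)
    assume "e \<notin> C"
    then have "(s, t) \<in> reach (D - C)" using edge_reach[of e "D - C"] e t by blast
    then have "t \<in> K" using sK tV reach_trans by (auto simp: K_def)
    then show False using tK by simp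
  qed
  then have U: "p \<in> U" "q \<in> U" "s \<in> U" "t \<in> U" using CU[of e] CU[OF f(2)] t f by auto
  have ps: "(p, s) \<in> reach D" using sK sub by (auto simp: K_def)
  have st: "(s, t) \<in> reach D" and pq: "(p, q) \<in> reach D"
    using edge_reach e t f by blast+
  have joined: "(a, b) \<in> link E" if "(a, b) \<in> reach D" "a \<in> U" "b \<in> U" "a \<noteq> b" for a b
    using thin that link_mono[OF D_E] unfolding thin_def by blast
  have "q \<notin> K" using no by (simp add: K_def)
  show False
  proof (cases "s = p")
    case True
    then have "t \<noteq> q" using t f e eE fE edge_eqI by metis
    then show False
      using link_triangle_free[of p q t] joined[of p q] joined[of q t] joined[of p t] U True st pq t(2)
        \<open>q \<notin> K\<close> sK reach_sym reach_trans by metis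
  next
    case False
    have "s \<noteq> q" using sK \<open>q \<notin> K\<close> by auto
    moreover have "p \<noteq> q" using \<open>q \<notin> K\<close> \<open>p \<in> V\<close> by (auto simp: K_def)
    ultimately show False
      using link_triangle_free[of p q s] joined[of p q] joined[of q s] joined[of p s] U False ps pq
        reach_sym reach_trans by metis
  qed
qed

text \<open>
  The central merging step. Otherwise \<open>U\<close> spans a minimal even set \<open>C\<close>, that is, a cycle. The
  symmetric difference of \<open>D\<close> and \<open>C\<close> joins all components met by \<open>C\<close>, which are at least two,
  and saves a representative.
\<close>

theorem thin_acyclic:
  assumes thin: "thin U" and U: "U \<subseteq> V" "U \<noteq> {}"
  shows "card (inside U) < card U"
proof (rule ccontr)
  assume "\<not> card (inside U) < card U"
  then have le: "card U \<le> card (inside U)" by simp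
  have finU: "finite U" using U(1) finite_V finite_subset by blast
  obtain C0 where C0: "C0 \<subseteq> inside U" "C0 \<noteq> {}" "even_set C0"
    using even_set_exists[OF finU U(2) le] .
  obtain C where C: "C \<subseteq> inside U" "C \<noteq> {}" "even_set C"
    and min: "\<forall>B. B \<subseteq> C \<longrightarrow> B \<noteq> {} \<longrightarrow> even_set B \<longrightarrow> B = C"
    using minimal_even_set_exists[OF C0] .
  define D' where "D' = (D - C) \<union> (C - D)"
  have D': "even_set D'" unfolding D'_def by (rule even_set_symdiff[OF D_even C(3)])
  have sub: "reach (D - C) \<subseteq> reach D'"
    by (rule reach_mono) (auto simp: D'_def link_def intro: edge_reach)
  have keep: "(p, q) \<in> reach D'" if "f \<in> D \<union> C" "ends f = {p, q}" for f p q
  proof (cases "f \<in> D \<inter> C")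
    case True
    then show ?thesis using thin_even_set_keeps_connection[OF thin C(1)] that sub by blast
  next
    case False
    then have "f \<in> D'" using that by (auto simp: D'_def)
    then show ?thesis using edge_reach that by blast
  qed
  have "reach F \<subseteq> reach D'" if "F \<subseteq> D \<union> C" for F
  proof (rule reach_mono, rule subrelI)
    fix p q assume "(p, q) \<in> link F"
    then obtain f where "f \<in> F" "ends f = {p, q}" unfolding link_def by blast
    then show "(p, q) \<in> reach D'" using keep that by blast
  qed
  then have D_D': "reach D \<subseteq> reach D'" and C_D': "reach C \<subseteq> reach D'" by simp_all
  obtain c c' where c: "c \<in> supp C \<inter> Z" "c' \<in> supp C \<inter> Z" "(c, c') \<notin> reach D"
    using thin_even_set_meets_two_components[OF thin C] .
  obtain r r' where r: "r \<in> R" "(c, r) \<in> reach D" "r' \<in> R" "(c', r') \<in> reach D"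
    using Z_rep c by blast
  have rr': "r \<noteq> r'" using r c reach_sym reach_trans by metis
  have cc': "(p, q) \<in> reach D'" if "p \<in> supp C" "q \<in> supp C" for p q
    using minimal_even_set_connected[OF C(3) min that] C_D' by blast
  have r'r: "(r', r) \<in> reach D'"
    using r cc'[of c' c] c D_D' reach_sym reach_trans by (meson IntD1 subsetD)
  have rep: "\<exists>s\<in>R - {r'}. (p, s) \<in> reach D'" if "p \<in> Z \<union> supp C" for p
  proof -
    have "\<exists>s\<in>R. (p, s) \<in> reach D'"
    proof (cases "p \<in> Z")
      case True
      then show ?thesis using Z_rep D_D' by blast
    next
      case False
      then have "(p, c) \<in> reach D'" using that cc' c by blast
      then show ?thesis using r D_D' reach_trans by blast
    qed
    then obtain s where "s \<in> R" "(p, s) \<in> reach D'" by blast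
    then show ?thesis using r r'r rr' reach_trans by (metis Diff_iff singletonD)
  qed
  have "system D' (R - {r'})"
    unfolding system_def
  proof (intro conjI ballI)
    have keepZ: "p \<in> supp D' \<union> (R - {r'})" if "p \<in> Z" for p
      using rep[of p] that reach_neq_supp by blast
    show "ends e \<inter> (supp D' \<union> (R - {r'})) \<noteq> {}" if "e \<in> E" for e
      using cover[OF that] keepZ by blast
    show "\<exists>s\<in>R - {r'}. (p, s) \<in> reach D'" if "p \<in> supp D'" for p
    proof (rule rep)
      show "p \<in> Z \<union> supp C" using that by (auto simp: D'_def supp_def Z_def)
    qed
  qed (use D' R_V in auto)
  from no_smaller[OF this] show False using r finite_R
    by (metis card_Diff1_less not_less)
qed

end

section \<open>A matching of the stars\<close>

text \<open>
  Hall's marriage theorem by the usual induction: either a proper subset satisfies its condition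
  with equality and is matched separately, or any single pair may be matched and removed.
\<close>

lemma hall_matching:
  assumes "finite A" "\<And>a. a \<in> A \<Longrightarrow> finite (N a)"
    and "\<And>X. X \<subseteq> A \<Longrightarrow> card X \<le> card (\<Union> (N ` X))"
  obtains f where "inj_on f A" "\<forall>a\<in>A. f a \<in> N a"
proof -
  have "\<exists>f. inj_on f A \<and> (\<forall>a\<in>A. f a \<in> N a)"
    using assms
  proof (induction "card A" arbitrary: A N rule: less_induct)
    case less
    have finN: "finite (\<Union> (N ` X))" if "X \<subseteq> A" for X
      using that less.prems(1,2) finite_subset by blast
    show ?case
    proof (cases "\<exists>X. X \<subset> A \<and> X \<noteq> {} \<and> card (\<Union> (N ` X)) = card X")
      case True
      then obtain X where X: "X \<subset> A" "X \<noteq> {}" "card (\<Union> (N ` X)) = card X" by blast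
      have finX: "finite X" using X less.prems(1) finite_subset by blast
      have "\<exists>f. inj_on f X \<and> (\<forall>a\<in>X. f a \<in> N a)"
      proof (rule less.hyps)
        show "card X < card A" using X less.prems(1) by (simp add: psubset_card_mono)
      qed (use X less.prems finX in auto)
      then obtain f where f: "inj_on f X" "\<forall>a\<in>X. f a \<in> N a" by blast
      let ?N = "\<lambda>a. N a - \<Union> (N ` X)"
      have "\<exists>g. inj_on g (A - X) \<and> (\<forall>a\<in>A - X. g a \<in> ?N a)"
      proof (rule less.hyps)
        show "card (A - X) < card A" using X less.prems(1) by (intro psubset_card_mono) auto
        fix Y assume Y: "Y \<subseteq> A - X"
        have finY: "finite Y" using Y less.prems(1) finite_subset by blast
        have XY: "X \<union> Y \<subseteq> A" using X Y by auto
        have "card X + card Y = card (X \<union> Y)" using finX finY Y by (subst card_Un_disjoint) auto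
        also have "\<dots> \<le> card (\<Union> (N ` (X \<union> Y)))" using less.prems(3)[OF XY] .
        also have "\<Union> (N ` (X \<union> Y)) = \<Union> (N ` X) \<union> \<Union> (?N ` Y)" by auto
        also have "card \<dots> \<le> card X + card (\<Union> (?N ` Y))" using card_Un_le X(3) by metis
        finally show "card Y \<le> card (\<Union> (?N ` Y))" by simp
      qed (use less.prems in auto)
      then obtain g where g: "inj_on g (A - X)" "\<forall>a\<in>A - X. g a \<in> ?N a" by blast
      define h where "h a = (if a \<in> X then f a else g a)" for a
      have "inj_on h (X \<union> (A - X))"
        unfolding inj_on_Un
      proof (intro conjI)
        show "inj_on h X" using f(1) by (simp add: h_def inj_on_def)
        show "inj_on h (A - X)" using g(1) by (simp add: h_def inj_on_def)
        have "h a \<noteq> h b" if "a \<in> X" "b \<in> A - X" for a b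
          using that f(2) g(2) unfolding h_def by auto
        then show "h ` (X - (A - X)) \<inter> h ` (A - X - X) = {}" by blast
      qed
      moreover have "X \<union> (A - X) = A" using X by auto
      moreover have "\<forall>a\<in>A. h a \<in> N a" using f g by (auto simp: h_def)
      ultimately show ?thesis by auto
    next
      case False
      show ?thesis
      proof (cases "A = {}")
        case True
        then show ?thesis by simp
      next
        case False
        then obtain a where a: "a \<in> A" by blast
        have "card {a} \<le> card (\<Union> (N ` {a}))" using less.prems(3)[of "{a}"] a by blast
        then have "N a \<noteq> {}" by auto
        then obtain b where b: "b \<in> N a" by blast
        let ?N = "\<lambda>x. N x - {b}"
        have "\<exists>g. inj_on g (A - {a}) \<and> (\<forall>x\<in>A - {a}. g x \<in> ?N x)"
        proof (rule less.hyps)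
          show "card (A - {a}) < card A" using a less.prems(1) by (rule card_Diff1_less[rotated])
          fix Y assume Y: "Y \<subseteq> A - {a}"
          have eq: "\<Union> (?N ` Y) = \<Union> (N ` Y) - {b}" by auto
          show "card Y \<le> card (\<Union> (?N ` Y))"
          proof (cases "Y = {}")
            case False
            have "Y \<subset> A" using Y a by blast
            then have "card (\<Union> (N ` Y)) \<noteq> card Y" "card Y \<le> card (\<Union> (N ` Y))"
              using \<open>\<not> (\<exists>X. X \<subset> A \<and> X \<noteq> {} \<and> card (\<Union> (N ` X)) = card X)\<close> False less.prems(3)[of Y] by auto
            moreover have "card (\<Union> (N ` Y)) - 1 \<le> card (\<Union> (N ` Y) - {b})"
              by (simp add: card_Diff_singleton_if)
            ultimately show ?thesis unfolding eq by linarith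
          qed simp
        qed (use less.prems in auto)
        then obtain g where g: "inj_on g (A - {a})" "\<forall>x\<in>A - {a}. g x \<in> ?N x" by blast
        have "inj_on (g(a := b)) A"
          using g by (auto simp: inj_on_def)
        moreover have "\<forall>x\<in>A. (g(a := b)) x \<in> N x" using g b by auto
        ultimately show ?thesis by blast
      qed
    qed
  qed
  then show ?thesis using that by blast
qed

context triangle_free_incidence
begin

definition neighbours :: "'a \<Rightarrow> 'a set" where
  "neighbours e = {f \<in> E. f \<noteq> e \<and> ends e \<inter> ends f \<noteq> {}}"

definition matching :: "'a set \<Rightarrow> bool" where
  "matching I \<longleftrightarrow> I \<subseteq> E \<and> (\<forall>e\<in>I. \<forall>f\<in>I. e \<noteq> f \<longrightarrow> ends e \<inter> ends f = {})"

lemma degree_sum: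
  assumes "e \<in> E" "ends e = {p, q}" "p \<noteq> q"
  shows "card (edges_at E p) + card (edges_at E q) = card (neighbours e) + 2"
proof -
  have fin: "finite (edges_at E p)" "finite (edges_at E q)" by (simp_all add: edges_at_finite)
  have "f = e" if "f \<in> edges_at E p" "f \<in> edges_at E q" for f
  proof -
    have fE: "f \<in> E" "{p, q} \<subseteq> ends f" using that by (auto simp: edges_at_def)
    then have "ends f = {p, q}"
      using card_subset_eq[of "ends f" "{p, q}"] finite_ends card_ends assms(3) by simp
    then show ?thesis using edge_eqI fE assms by simp
  qed
  then have "edges_at E p \<inter> edges_at E q = {e}" using assms by (auto simp: edges_at_def)
  moreover have "edges_at E p \<union> edges_at E q = insert e (neighbours e)"
    using assms by (auto simp: edges_at_def neighbours_def)
  moreover have "finite (neighbours e)" "e \<notin> neighbours e" using finite_E by (auto simp: neighbours_def)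
  ultimately show ?thesis using card_Un_Int[OF fin] by simp
qed

lemma link_edge: 
  assumes "F \<subseteq> E" "p \<in> supp F" obtains e q where "e \<in> F" "ends e = {p, q}" "p \<noteq> q"
proof -
  obtain e where e: "e \<in> F" "p \<in> ends e" using assms by (auto simp: supp_def)
  have "e \<in> E" using e assms(1) by blast
  then obtain q where "ends e = {p, q}" "p \<noteq> q" using obtain_other_end[OF _ e(2)] by blast
  then show ?thesis using that e(1) by blast
qed

lemma card_edges_at: 
  assumes "F \<subseteq> E"
  shows "card (edges_at F p) = card (link F `` {p})"
proof -
  have "\<exists>q. ends e = {p, q} \<and> p \<noteq> q" if "e \<in> edges_at F p" for e
  proof -
    have e: "e \<in> E" "p \<in> ends e" using that assms by (auto simp: edges_at_def)
    obtain q where "ends e = {p, q}" "p \<noteq> q" using obtain_other_end[OF e] .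
    then show ?thesis by blast
  qed
  then obtain other where other: "\<And>e. e \<in> edges_at F p \<Longrightarrow> ends e = {p, other e} \<and> p \<noteq> other e" by metis
  have "bij_betw other (edges_at F p) (link F `` {p})"
    unfolding bij_betw_def
  proof
    show "inj_on other (edges_at F p)"
    proof (rule inj_onI)
      fix e f assume ef: "e \<in> edges_at F p" "f \<in> edges_at F p" "other e = other f"
      then have "e \<in> E" "f \<in> E" using assms by (auto simp: edges_at_def)
      then show "e = f" using edge_eqI other[OF ef(1)] other[OF ef(2)] ef(3) by simp
    qed
    show "other ` edges_at F p = link F `` {p}"
    proof (intro equalityI subsetI)
      fix q assume "q \<in> other ` edges_at F p"
      then obtain e where e: "e \<in> edges_at F p" "q = other e" by blast
      then show "q \<in> link F `` {p}" using other[OF e(1)] by (auto simp: link_def edges_at_def)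
    next
      fix q assume "q \<in> link F `` {p}"
      then obtain e where e: "e \<in> F" "ends e = {p, q}" by (auto simp: link_def)
      then have eF: "e \<in> edges_at F p" by (auto simp: edges_at_def)
      have "q = other e" using other[OF eF] e(2) by (auto simp: doubleton_eq_iff)
      then show "q \<in> other ` edges_at F p" using eF by blast
    qed
  qed
  then show ?thesis by (rule bij_betw_same_card)
qed

lemma finite_link: "finite (link E `` {p})"
proof -
  have "link E `` {p} \<subseteq> V" by (auto simp: link_def V_def)
  then show ?thesis using finite_V finite_subset by blast
qed

text \<open>
  The choice is unique, as the graph is simple.
\<close>

definition edge_of :: "'b \<Rightarrow> 'b \<Rightarrow> 'a" where
  "edge_of p q = (SOME e. e \<in> E \<and> ends e = {p, q})"

lemma edge_of: assumes "(p, q) \<in> link E" shows "edge_of p q \<in> E" "ends (edge_of p q) = {p, q}"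
proof -
  have "\<exists>e. e \<in> E \<and> ends e = {p, q}" using assms by (auto simp: link_def)
  then have "edge_of p q \<in> E \<and> ends (edge_of p q) = {p, q}" unfolding edge_of_def by (rule someI_ex)
  then show "edge_of p q \<in> E" "ends (edge_of p q) = {p, q}" by auto
qed

end

context optimal_system
begin

text \<open>
  \<open>S\<close> consists of the centres of stars, \<open>W\<close> of the vertices outside the system; no two vertices
  in \<open>W\<close> are adjacent because \<open>Z\<close> covers all edges.
\<close>

definition "S = R - supp D"
definition "W = V - Z"

lemma Z_split: "Z = supp D \<union> S" "S \<inter> supp D = {}" "S \<subseteq> R" "S \<subseteq> V" "W \<subseteq> V"
  using R_V by (auto simp: Z_def S_def W_def)

lemma W_disjoint: "W \<inter> supp D = {}" "W \<inter> S = {}" "W \<inter> R = {}" by (auto simp: W_def Z_def S_def)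

lemma link_Z: "(p, q) \<in> link E \<Longrightarrow> p \<in> Z \<or> q \<in> Z"
  using cover by (fastforce simp: link_def)

lemma thin_SW: assumes "U \<subseteq> S \<union> W" shows "thin U"
proof -
  have "U \<inter> supp D = {}" using assms Z_split(2) W_disjoint(1) by blast
  then show ?thesis using reach_neq_supp unfolding thin_def by blast
qed

lemma reps_unreachable:
  assumes "r \<in> R" "r' \<in> R" "(r, r') \<in> reach D"
  shows "r = r'"
proof (rule ccontr)
  assume ne: "r \<noteq> r'"
  have "r' \<in> supp D" using assms(3) ne reach_neq_supp reach_sym by metis
  have "\<exists>s\<in>R - {r'}. (p, s) \<in> reach D" if p: "p \<in> supp D" for p
  proof -
    obtain s where s: "s \<in> R" "(p, s) \<in> reach D" using Z_rep[of p] p by (auto simp: Z_def)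
    show ?thesis
    proof (cases "s = r'")
      case True
      then have "(p, r) \<in> reach D" using s(2) reach_sym[OF assms(3)] reach_trans by blast
      then show ?thesis using assms(1) ne by blast
    qed (use s in blast)
  qed
  moreover have "supp D \<union> (R - {r'}) = supp D \<union> R" using \<open>r' \<in> supp D\<close> by auto
  ultimately have "system D (R - {r'})" using sys by (auto simp: system_def)
  then show False using no_smaller assms(2) finite_R by (meson card_Diff1_less not_less)
qed

text \<open>
  Let \<open>B\<close> be a smallest violating set. By minimality it exceeds its neighbourhood \<open>NW B\<close> in \<open>W\<close>
  by exactly one, and every vertex in \<open>NW B\<close> has at least two neighbours in \<open>B\<close>. The edges
  between \<open>B\<close> and \<open>NW B\<close> thus already attain the bound for acyclic sets, so that there is no
  edge inside \<open>B\<close>. Hence the vertices in \<open>NW B\<close> can replace those in \<open>B\<close> as centres of stars,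
  contrary to the minimality of \<open>R\<close>.
\<close>

lemma hall_condition:
  assumes "A \<subseteq> S"
  shows "card A \<le> card {w \<in> W. \<exists>z\<in>A. (z, w) \<in> link E}"
proof (rule ccontr)
  define NW where "NW A = {w \<in> W. \<exists>z\<in>A. (z, w) \<in> link E}" for A
  have finW: "finite W" using finite_V finite_subset Z_split(5) by blast
  have finS: "finite S" using finite_V finite_subset Z_split(4) by blast
  assume "\<not> card A \<le> card {w \<in> W. \<exists>z\<in>A. (z, w) \<in> link E}"
  then have "A \<subseteq> S \<and> card (NW A) < card A" using assms by (simp add: NW_def)
  then obtain B where B: "B \<subseteq> S" "card (NW B) < card B"
    and min: "\<And>B'. B' \<subseteq> S \<Longrightarrow> card (NW B') < card B' \<Longrightarrow> card B \<le> card B'"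
    using ex_has_least_nat[of "\<lambda>A. A \<subseteq> S \<and> card (NW A) < card A" A card] by blast
  have finB: "finite B" using B finS finite_subset by blast
  have finN: "finite (NW B)" using finW by (simp add: NW_def)
  have NW_W: "NW B \<subseteq> W" by (auto simp: NW_def)
  have smaller: "card B \<le> Suc (card (NW (B - {z})))" if "z \<in> B" for z
  proof -
    have "card (B - {z}) < card B" using that finB by (rule card_Diff1_less[rotated])
    then have "\<not> card (NW (B - {z})) < card (B - {z})" using min[of "B - {z}"] B by force
    then show ?thesis using that finB by (simp add: card_Diff_singleton_if)
  qed
  have mono: "NW (B - {z}) \<subseteq> NW B" for z by (auto simp: NW_def)
  obtain z0 where "z0 \<in> B" using B by fastforce
  then have card_B: "card B = Suc (card (NW B))"
    using smaller[of z0] card_mono[OF finN mono[of z0]] B(2) by linarith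
  let ?U = "B \<union> NW B"
  have U: "?U \<subseteq> S \<union> W" using B NW_W by auto
  have disj: "B \<inter> NW B = {}" using B NW_W W_disjoint by blast
  have card_U: "card ?U = 2 * card (NW B) + 1"
    using card_Un_disjoint[OF finB finN disj] card_B by simp
  have "card (inside ?U) < card ?U"
    using thin_acyclic[OF thin_SW[OF U]] U Z_split \<open>z0 \<in> B\<close> by blast
  define F where "F = inside ?U - inside B"
  have FE: "F \<subseteq> E" by (auto simp: F_def inside_def)
  have one: "card (ends e \<inter> NW B) = 1" if "e \<in> F" for e
  proof -
    have e: "e \<in> E" "ends e \<subseteq> B \<union> NW B" "\<not> ends e \<subseteq> B" using that by (auto simp: F_def inside_def)
    then obtain w where w: "w \<in> ends e" "w \<in> NW B" by blast
    obtain q where q: "ends e = {w, q}" "w \<noteq> q" using obtain_other_end[OF e(1) w(1)] .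
    have "q \<in> Z" using cover[OF e(1)] w(2) q NW_W by (auto simp: W_def)
    then have "q \<notin> NW B" using NW_W by (auto simp: W_def)
    then have "ends e \<inter> NW B = {w}" using q w by auto
    then show ?thesis by simp
  qed
  have two: "2 \<le> card (edges_at F w)" if w: "w \<in> NW B" for w
  proof -
    obtain z where z: "z \<in> B" "(z, w) \<in> link E" using w by (auto simp: NW_def)
    have "\<exists>z'\<in>B. z' \<noteq> z \<and> (z', w) \<in> link E"
    proof (rule ccontr)
      assume "\<not> ?thesis"
      then have "NW (B - {z}) \<subseteq> NW B - {w}" by (auto simp: NW_def)
      then have "card (NW (B - {z})) < card (NW B)"
        using w finN by (intro psubset_card_mono) auto
      then show False using smaller[OF z(1)] card_B by linarith
    qed
    then obtain z' where z': "z' \<in> B" "z' \<noteq> z" "(z', w) \<in> link E" by blast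
    have "edge_of z w \<in> edges_at F w" "edge_of z' w \<in> edges_at F w"
      using edge_of[OF z(2)] edge_of[OF z'(3)] z z' w disj by (auto simp: edges_at_def F_def inside_def)
    moreover have "edge_of z w \<noteq> edge_of z' w"
      using edge_of[OF z(2)] edge_of[OF z'(3)] z'(2) by (metis doubleton_eq_iff)
    ultimately show ?thesis
      using card_mono[OF edges_at_finite[OF FE], of "{edge_of z w, edge_of z' w}" w] by simp
  qed
  have "2 * card (NW B) = (\<Sum>w\<in>NW B. 2)" by simp
  also have "\<dots> \<le> (\<Sum>w\<in>NW B. card (edges_at F w))" by (rule sum_mono) (rule two)
  also have "\<dots> = (\<Sum>e\<in>F. card (ends e \<inter> NW B))" by (rule double_count[OF FE finN])
  also have "\<dots> = card F" using one by simp
  finally have "2 * card (NW B) \<le> card F" .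
  moreover have "card F = card (inside ?U) - card (inside B)"
    unfolding F_def by (rule card_Diff_subset) (auto simp: inside_def intro: finite_sub)
  ultimately have "card (inside B) = 0 \<or> card (inside ?U) < card (inside B)"
    using \<open>card (inside ?U) < card ?U\<close> card_U by linarith
  moreover have "card (inside B) \<le> card (inside ?U)"
    by (rule card_mono) (auto simp: inside_def intro: finite_sub)
  moreover have "finite (inside B)" by (rule finite_sub) (auto simp: inside_def)
  ultimately have no_inside: "inside B = {}" by simp
  have "system D ((R - B) \<union> NW B)"
    unfolding system_def
  proof (intro conjI ballI)
    show "even_set D" by (rule D_even)
    show "R - B \<union> NW B \<subseteq> V" using R_V NW_W Z_split by auto
    fix e assume e: "e \<in> E"
    then obtain p where p: "p \<in> ends e" "p \<in> Z" using cover by blast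
    show "ends e \<inter> (supp D \<union> (R - B \<union> NW B)) \<noteq> {}"
    proof (cases "p \<in> B")
      case False
      then show ?thesis using p by (auto simp: Z_def)
    next
      case True
      obtain q where q: "ends e = {p, q}" "p \<noteq> q" using obtain_other_end[OF e p(1)] .
      have "q \<notin> B" using no_inside True e q by (auto simp: inside_def)
      have "q \<in> Z \<or> q \<in> NW B"
        using True e q ends_sub_V[OF e] by (auto simp: NW_def W_def link_def)
      then show ?thesis using q \<open>q \<notin> B\<close> by (auto simp: Z_def)
    qed
  next
    fix p assume p: "p \<in> supp D"
    then obtain r where r: "r \<in> R" "(p, r) \<in> reach D" using Z_rep[of p] p by (auto simp: Z_def)
    then have "r \<notin> B" using reach_supp[OF r(2) p] B Z_split(2) by auto
    then show "\<exists>r\<in>R - B \<union> NW B. (p, r) \<in> reach D" using r by blast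
  qed
  from no_smaller[OF this] have "card R \<le> card (R - B) + card (NW B)"
    using card_Un_le le_trans by blast
  moreover have "card (R - B) = card R - card B" "card B \<le> card R"
    using B Z_split(3) finB finite_R by (auto intro: card_Diff_subset card_mono)
  ultimately show False using card_B by linarith
qed

lemma star_matching_exists:
  "\<exists>\<mu>. inj_on \<mu> S \<and> (\<forall>z\<in>S. \<mu> z \<in> W \<and> (z, \<mu> z) \<in> link E)"
proof -
  have finS: "finite S" using finite_V finite_subset Z_split(4) by blast
  have finW: "finite W" using finite_V finite_subset Z_split(5) by blast
  let ?N = "\<lambda>z. {w \<in> W. (z, w) \<in> link E}"
  have "card X \<le> card (\<Union> (?N ` X))" if "X \<subseteq> S" for X
  proof -
    have "\<Union> (?N ` X) = {w \<in> W. \<exists>z\<in>X. (z, w) \<in> link E}" by auto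
    then show ?thesis using hall_condition[OF that] by simp
  qed
  then obtain \<mu> where "inj_on \<mu> S" "\<forall>z\<in>S. \<mu> z \<in> ?N z"
    using hall_matching[OF finS, of ?N] finW by auto
  then show ?thesis by auto
qed

definition \<mu> :: "'b \<Rightarrow> 'b" where
  "\<mu> = (SOME \<mu>. inj_on \<mu> S \<and> (\<forall>z\<in>S. \<mu> z \<in> W \<and> (z, \<mu> z) \<in> link E))"

lemma \<mu>: "inj_on \<mu> S" "z \<in> S \<Longrightarrow> \<mu> z \<in> W" "z \<in> S \<Longrightarrow> (z, \<mu> z) \<in> link E"
  using someI_ex[OF star_matching_exists] unfolding \<mu>_def[symmetric] by auto

end

section \<open>Bounding the number of trails and stars\<close>

context optimal_system
begin

text \<open>
  Choose an edge of each of \<open>k + 1\<close> trails and stars: an edge of the trail at its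
  representative, or the matching edge of the star. These edges form a matching whose ends are a
  thin set \<open>U\<close> with \<open>2 * (k + 1)\<close> elements. At most \<open>card E\<close> edges meet \<open>U\<close>, so the degree sum
  condition forces \<open>U\<close> to span at least \<open>card U\<close> edges, which is impossible by \<open>thin_acyclic\<close>.
\<close>

theorem card_reps_le:
  assumes deg: "\<And>I. matching I \<Longrightarrow> card I = Suc k \<Longrightarrow> card E \<le> (\<Sum>e\<in>I. card (neighbours e))"
  shows "card R \<le> k"
proof (rule ccontr)
  assume "\<not> card R \<le> k"
  then have le: "Suc k \<le> card R" by simp
  obtain R0 where R0: "R0 \<subseteq> R" "card R0 = Suc k" "finite R0"
    using obtain_subset_with_card_n[OF le] .
  define rep where "rep r e w \<longleftrightarrow> e \<in> E \<and> ends e = {r, w} \<and> r \<noteq> w \<and>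
      (r \<in> S \<and> w = \<mu> r \<and> w \<in> W \<or> r \<in> supp D \<and> e \<in> D \<and> w \<in> supp D)" for r e w
  have "\<exists>e w. rep r e w" if "r \<in> R0" for r
  proof (cases "r \<in> supp D")
    case True
    obtain e q where eq: "e \<in> D" "ends e = {r, q}" "r \<noteq> q" using link_edge[OF D_E True] .
    then have "q \<in> supp D" by (auto simp: supp_def)
    then have "rep r e q" using eq True D_E by (auto simp: rep_def)
    then show ?thesis by blast
  next
    case False
    then have r: "r \<in> S" using that R0 by (auto simp: S_def)
    have "r \<noteq> \<mu> r" using \<mu>(2)[OF r] r W_disjoint by auto
    then have "rep r (edge_of r (\<mu> r)) (\<mu> r)"
      using edge_of[OF \<mu>(3)[OF r]] \<mu>(2)[OF r] r by (simp add: rep_def)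
    then show ?thesis by blast
  qed
  then obtain e w where "\<And>r. r \<in> R0 \<Longrightarrow> rep r (e r) (w r)" by metis
  then have ew: "e r \<in> E \<and> ends (e r) = {r, w r} \<and> r \<noteq> w r \<and>
      (r \<in> S \<and> w r = \<mu> r \<and> w r \<in> W \<or> r \<in> supp D \<and> e r \<in> D \<and> w r \<in> supp D)" if "r \<in> R0" for r
    using that unfolding rep_def by blast
  have eE: "e r \<in> E" and ends_e: "ends (e r) = {r, w r}" and r_w: "r \<noteq> w r" if "r \<in> R0" for r
    using ew[OF that] by simp_all
  have reach_w: "(r, w r) \<in> reach D" if "r \<in> R0" "r \<in> supp D" for r
    using ew[OF that(1)] that(2) edge_reach[of "e r" D r "w r"] Z_split(2) by blast
  have disj: "ends (e r) \<inter> ends (e r') = {}" if rr': "r \<in> R0" "r' \<in> R0" "r \<noteq> r'" for r r'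
  proof -
    have no: "(r, r') \<notin> reach D" using reps_unreachable R0 rr' by blast
    have cross: "s \<noteq> w t" if "s \<in> R0" "t \<in> R0" "(s, t) \<notin> reach D" for s t
    proof
      assume eq: "s = w t"
      have "s \<in> R" using that(1) R0(1) by blast
      then have "w t \<notin> W" using eq W_disjoint(3) by blast
      then have "t \<in> supp D" using ew[OF that(2)] by blast
      then show False using reach_w[OF that(2)] reach_sym that(3) eq by blast
    qed
    have no': "(r', r) \<notin> reach D" using no reach_sym by blast
    have "w r \<noteq> w r'"
    proof
      assume eq: "w r = w r'"
      show False
      proof (cases "r \<in> S")
        case True
        then have "w r \<in> W" "w r = \<mu> r" using ew[OF rr'(1)] Z_split(2) by auto
        then have "r' \<in> S" "w r' = \<mu> r'" using eq ew[OF rr'(2)] W_disjoint by auto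
        then show False using \<mu>(1) True \<open>w r = \<mu> r\<close> eq rr'(3) by (auto dest: inj_onD)
      next
        case False
        then have a: "r \<in> supp D" "w r \<in> supp D" using ew[OF rr'(1)] by auto
        then have "r' \<in> supp D" using eq ew[OF rr'(2)] W_disjoint by auto
        then have "(r, w r) \<in> reach D" "(r', w r) \<in> reach D"
          using reach_w[OF rr'(1) a(1)] reach_w[OF rr'(2)] eq by auto
        then show False using no reach_sym reach_trans by blast
      qed
    qed
    then show ?thesis
      using ends_e[OF rr'(1)] ends_e[OF rr'(2)] rr'(3) cross[OF rr'(1,2) no] cross[OF rr'(2,1) no'] by simp
  qed
  have inj_e: "inj_on e R0"
  proof (rule inj_onI)
    fix r r' assume "r \<in> R0" "r' \<in> R0" "e r = e r'"
    then show "r = r'" using disj[of r r'] ends_e[of r] by auto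
  qed
  define I where "I = e ` R0"
  have mI: "matching I" 
    unfolding matching_def I_def
  proof (intro conjI ballI impI)
    show "e ` R0 \<subseteq> E" using eE by blast
    fix a b assume "a \<in> e ` R0" "b \<in> e ` R0" "a \<noteq> b"
    then obtain r r' where "r \<in> R0" "r' \<in> R0" "a = e r" "b = e r'" "r \<noteq> r'" by blast
    then show "ends a \<inter> ends b = {}" using disj by simp
  qed
  have card_I: "card I = Suc k" unfolding I_def using R0 card_image[OF inj_e] by simp
  define U where "U = (\<Union>r\<in>R0. ends (e r))"
  have card_U: "card U = 2 * Suc k"
  proof -
    have "card U = (\<Sum>r\<in>R0. card (ends (e r)))"
      unfolding U_def using disj R0(3) eE finite_ends by (intro card_UN_disjoint) auto
    also have "\<dots> = (\<Sum>r\<in>R0. 2)" using eE card_ends by (intro sum.cong) auto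
    finally show ?thesis using R0 by simp
  qed
  have U_V: "U \<subseteq> V" unfolding U_def using eE ends_sub_V by blast
  have finU: "finite U" using U_V finite_V finite_subset by blast
  have "thin U"
    unfolding thin_def
  proof (intro ballI impI)
    fix p q assume pq: "p \<in> U" "q \<in> U" "p \<noteq> q" "(p, q) \<in> reach D"
    have own: "\<exists>r\<in>R0. p \<in> ends (e r) \<and> (r, p) \<in> reach D \<and> e r \<in> D" if "p \<in> U" "p \<in> supp D" for p
    proof -
      obtain r where r: "r \<in> R0" "p \<in> ends (e r)" using \<open>p \<in> U\<close> by (auto simp: U_def)
      have "r \<in> supp D \<and> e r \<in> D" using ew[OF r(1)] r(2) that(2) W_disjoint Z_split(2) by auto
      moreover have "p = r \<or> p = w r" using r(2) ends_e[OF r(1)] by simp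
      ultimately have "e r \<in> D" "(r, p) \<in> reach D" using reach_w[OF r(1)] by auto
      then show ?thesis using r by blast
    qed
    have "p \<in> supp D" using reach_neq_supp pq(3,4) by blast
    then have "q \<in> supp D" using reach_supp pq(4) by blast
    obtain r where r: "r \<in> R0" "p \<in> ends (e r)" "(r, p) \<in> reach D" "e r \<in> D"
      using own[OF pq(1) \<open>p \<in> supp D\<close>] by blast
    obtain r' where r': "r' \<in> R0" "q \<in> ends (e r')" "(r', q) \<in> reach D"
      using own[OF pq(2) \<open>q \<in> supp D\<close>] by blast
    have "(r, r') \<in> reach D" using r(3) r'(3) pq(4) reach_trans reach_sym by blast
    then have "r = r'" using reps_unreachable r(1) r'(1) R0(1) by blast
    then have "ends (e r) = {p, q}" using ends_e[OF r(1)] r(2) r'(2) pq(3) by auto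
    then show "(p, q) \<in> link D" using r(4) by (auto simp: link_def)
  qed
  moreover have "U \<noteq> {}" using card_U by auto
  ultimately have "card (inside U) < 2 * Suc k" using thin_acyclic U_V card_U by metis
  moreover have "card E + 2 * Suc k \<le> (\<Sum>p\<in>U. card (edges_at E p))"
  proof -
    have "(\<Sum>p\<in>U. card (edges_at E p)) = (\<Sum>r\<in>R0. \<Sum>p\<in>ends (e r). card (edges_at E p))"
      unfolding U_def using disj R0(3) eE finite_ends by (intro sum.UNION_disjoint) auto
    also have "\<dots> = (\<Sum>r\<in>R0. card (neighbours (e r)) + 2)"
    proof (rule sum.cong)
      fix r assume r: "r \<in> R0"
      note er = eE[OF r] ends_e[OF r] r_w[OF r]
      then have "(\<Sum>p\<in>ends (e r). card (edges_at E p)) = card (edges_at E r) + card (edges_at E (w r))" by auto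
      then show "(\<Sum>p\<in>ends (e r). card (edges_at E p)) = card (neighbours (e r)) + 2"
        using degree_sum[OF er] by simp
    qed simp
    also have "\<dots> = (\<Sum>r\<in>R0. card (neighbours (e r))) + (\<Sum>r\<in>R0. 2)" by (rule sum.distrib)
    also have "\<dots> = (\<Sum>e\<in>I. card (neighbours e)) + 2 * Suc k"
      unfolding I_def sum.reindex[OF inj_e] using R0 by simp
    finally show ?thesis using deg[OF mI card_I] by simp
  qed
  moreover have "(\<Sum>p\<in>U. card (edges_at E p)) \<le> card E + card (inside U)"
  proof -
    have "card (ends f \<inter> U) \<le> 1 + (if ends f \<subseteq> U then 1 else 0)" if "f \<in> E" for f
    proof (cases "ends f \<subseteq> U")
      case True
      then show ?thesis using card_ends[OF that] by (simp add: Int_absorb2)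
    next
      case False
      then have "card (ends f \<inter> U) < card (ends f)"
        using finite_ends[OF that] by (intro psubset_card_mono) auto
      then show ?thesis using card_ends[OF that] by simp
    qed
    then have "(\<Sum>f\<in>E. card (ends f \<inter> U)) \<le> (\<Sum>f\<in>E. 1 + (if ends f \<subseteq> U then 1 else 0))"
      by (rule sum_mono)
    also have "\<dots> = card E + (\<Sum>f\<in>E. if ends f \<subseteq> U then 1 else 0)" by (subst sum.distrib) simp
    also have "(\<Sum>f\<in>E. if ends f \<subseteq> U then 1 else 0) = card (inside U)"
      using finite_E by (simp add: inside_def sum.If_cases Int_def)
    finally show ?thesis by (simp add: double_count[OF order_refl finU])
  qed
  ultimately show False by linarith
qed

text \<open>
  Replacing the path \<open>x1 u x2\<close> of a trail by \<open>x1 w x2\<close> would enlarge the set of vertices on the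
  trails. It is permissible if \<open>u\<close> remains connected to \<open>x1\<close> without the two edges.
\<close>

lemma not_absorbable:
  assumes w: "w \<in> W" and g: "(w, x1) \<in> link E" "(w, x2) \<in> link E" and ne: "x1 \<noteq> x2"
    and f: "f1 \<in> D" "ends f1 = {u, x1}" "f2 \<in> D" "ends f2 = {u, x2}"
  shows "(u, x1) \<notin> reach (D - {f1, f2})"
proof
  assume conn: "(u, x1) \<in> reach (D - {f1, f2})"
  define g1 where "g1 = edge_of w x1"
  define g2 where "g2 = edge_of w x2"
  have g1: "g1 \<in> E" "ends g1 = {w, x1}" and g2: "g2 \<in> E" "ends g2 = {w, x2}"
    using edge_of[OF g(1)] edge_of[OF g(2)] by (auto simp: g1_def g2_def)
  have fE: "f1 \<in> E" "f2 \<in> E" using f D_E by auto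
  have supp: "u \<in> supp D" "x1 \<in> supp D" "x2 \<in> supp D" using f by (auto simp: supp_def)
  have wD: "w \<notin> supp D" using w W_disjoint by blast
  have dist: "w \<noteq> u" "w \<noteq> x1" "w \<noteq> x2" using wD supp by auto
  have "u \<noteq> x1" "u \<noteq> x2" using card_ends[OF fE(1)] card_ends[OF fE(2)] f by auto
  note dist = dist this ne
  have gD: "g1 \<notin> D" "g2 \<notin> D" using wD g1 g2 by (auto simp: supp_def)
  have "f1 \<noteq> f2" "g1 \<noteq> g2" using f g1 g2 dist by (auto simp: doubleton_eq_iff)
  moreover have "f1 \<noteq> g1" "f1 \<noteq> g2" "f2 \<noteq> g1" "f2 \<noteq> g2" using f gD by auto
  ultimately have dist4: "f1 \<noteq> f2" "g1 \<noteq> g2" "f1 \<noteq> g1" "f1 \<noteq> g2" "f2 \<noteq> g1" "f2 \<noteq> g2" by auto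
  define C where "C = {f1, f2, g1, g2}"
  have "even_set C"
    unfolding even_set_def
  proof (intro conjI allI)
    show "C \<subseteq> E" using fE g1 g2 by (auto simp: C_def)
    fix p
    have "edges_at C p = (if p = u then {f1, f2} else if p = w then {g1, g2} else
       if p = x1 then {f1, g1} else if p = x2 then {f2, g2} else {})"
      using f g1 g2 dist unfolding edges_at_def C_def by auto
    then show "even (card (edges_at C p))" using dist4 by simp
  qed
  define D' where "D' = (D - C) \<union> (C - D)"
  have D': "even_set D'" unfolding D'_def by (rule even_set_symdiff[OF D_even \<open>even_set C\<close>])
  have D'_eq: "D' = (D - {f1, f2}) \<union> {g1, g2}" using f gD by (auto simp: D'_def C_def)
  have sub: "reach (D - {f1, f2}) \<subseteq> reach D'"
    using link_mono[of "D - {f1, f2}" D'] unfolding reach_def D'_eq by (intro rtrancl_mono) blast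
  have ux1: "(u, x1) \<in> reach D'" using conn sub by blast
  have wx: "(w, x1) \<in> reach D'" "(w, x2) \<in> reach D'"
    using edge_reach[of g1 D' w x1] edge_reach[of g2 D' w x2] g1(2) g2(2) unfolding D'_eq by simp_all
  have ux2: "(u, x2) \<in> reach D'" using reach_trans[OF reach_trans[OF ux1 reach_sym[OF wx(1)]] wx(2)] .
  have "reach D \<subseteq> reach D'"
  proof (rule reach_mono, rule subrelI)
    fix p q assume "(p, q) \<in> link D"
    then obtain h where h: "h \<in> D" "ends h = {p, q}" by (auto simp: link_def)
    consider "h = f1" | "h = f2" | "h \<in> D'" using h D'_eq by blast
    then show "(p, q) \<in> reach D'"
    proof cases
      case 1
      then have "p = u \<and> q = x1 \<or> p = x1 \<and> q = u" using h(2) f(2) by (metis doubleton_eq_iff)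
      then show ?thesis using ux1 reach_sym[OF ux1] by blast
    next
      case 2
      then have "p = u \<and> q = x2 \<or> p = x2 \<and> q = u" using h(2) f(4) by (metis doubleton_eq_iff)
      then show ?thesis using ux2 reach_sym[OF ux2] by blast
    next
      case 3
      then show ?thesis using h edge_reach by blast
    qed
  qed
  have mono: "supp D \<subseteq> supp D'"
  proof
    fix p assume p: "p \<in> supp D"
    obtain e q where eq: "e \<in> D" "ends e = {p, q}" "p \<noteq> q" using link_edge[OF D_E p] .
    have "(p, q) \<in> reach D" using edge_reach[OF eq(1,2)] .
    with eq(3) show "p \<in> supp D'" using \<open>reach D \<subseteq> reach D'\<close> reach_neq_supp by blast
  qed
  have "supp D' \<subseteq> insert w (supp D)" using supp g1 g2 by (auto simp: D'_eq supp_def)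
  have "system D' R"
    unfolding system_def
  proof (intro conjI ballI)
    show "ends e \<inter> (supp D' \<union> R) \<noteq> {}" if "e \<in> E" for e
      using cover[OF that] mono by (auto simp: Z_def)
    fix p assume "p \<in> supp D'"
    then consider "p = w" | "p \<in> supp D" using \<open>supp D' \<subseteq> insert w (supp D)\<close> by blast
    then have "\<exists>q\<in>supp D. (p, q) \<in> reach D'"
    proof cases
      case 1
      then show ?thesis using wx(1) supp(2) by blast
    next
      case 2
      then show ?thesis using reach_refl by blast
    qed
    then obtain q where q: "q \<in> supp D" "(p, q) \<in> reach D'" by blast
    then obtain r where "r \<in> R" "(q, r) \<in> reach D" using Z_rep[of q] by (auto simp: Z_def)
    then show "\<exists>r\<in>R. (p, r) \<in> reach D'" using q \<open>reach D \<subseteq> reach D'\<close> reach_trans by blast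
  qed (fact D' R_V)+
  then have le: "card (supp D') \<le> card (supp D)" using optimal by (auto simp: optimal_def)
  have "w \<in> supp D'" using g1(2) unfolding D'_eq supp_def by simp
  then have "supp D \<subset> supp D'" using mono wD by blast
  moreover have "finite (supp D')" using D' finite_supp by (simp add: even_set_def)
  ultimately have "card (supp D) < card (supp D')" by (rule psubset_card_mono[rotated])
  with le show False by simp
qed

text \<open>
  Removing \<open>f1\<close> and \<open>f2\<close>, or \<open>f1\<close> and \<open>f3\<close>, separates \<open>u\<close> from the other ends of the removed
  edges. The vertices connected with \<open>u\<close> in both cases are then left by exactly the three edges
  \<open>f1\<close>, \<open>f2\<close>, \<open>f3\<close>, an odd cut in an even set.
\<close>

lemma at_most_two_links:
  assumes w: "w \<in> W" and g: "(w, x1) \<in> link E" "(w, x2) \<in> link E" "(w, x3) \<in> link E"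
    and ne: "x1 \<noteq> x2" "x2 \<noteq> x3" "x1 \<noteq> x3"
    and l: "(u, x1) \<in> link D" "(u, x2) \<in> link D" "(u, x3) \<in> link D"
  shows False
proof -
  obtain f1 f2 f3 where f: "f1 \<in> D" "ends f1 = {u, x1}" "f2 \<in> D" "ends f2 = {u, x2}" "f3 \<in> D" "ends f3 = {u, x3}"
    using l by (auto simp: link_def)
  define K1 where "K1 = {s \<in> V. (u, s) \<in> reach (D - {f1, f2})}"
  define K2 where "K2 = {s \<in> V. (u, s) \<in> reach (D - {f1, f3})}"
  have out: "x1 \<notin> K1" "x2 \<notin> K1" "x1 \<notin> K2" "x3 \<notin> K2"
    using not_absorbable[OF w g(1,2) ne(1) f(1-4)] not_absorbable[OF w g(2,1) ne(1)[symmetric] f(3,4,1,2)]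
      not_absorbable[OF w g(1,3) ne(3) f(1,2,5,6)] not_absorbable[OF w g(3,1) ne(3)[symmetric] f(5,6,1,2)]
    by (auto simp: K1_def K2_def insert_commute)
  have leave: "e \<in> F" if "e \<in> D" "ends e = {s, t}" "(u, s) \<in> reach (D - F)" "(u, t) \<notin> reach (D - F)" for e s t F
  proof (rule ccontr)
    assume "e \<notin> F"
    then have "(s, t) \<in> reach (D - F)" using that edge_reach by blast
    then show False using that reach_trans by blast
  qed
  have uV: "u \<in> V" using f(1,2) D_E ends_sub_V by blast
  then have u: "u \<in> K1 \<inter> K2" by (simp add: K1_def K2_def)
  have "{e \<in> D. card (ends e \<inter> (K1 \<inter> K2)) = 1} = {f1, f2, f3}"
  proof (intro equalityI subsetI)
    fix e assume "e \<in> {f1, f2, f3}"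
    moreover have "ends f1 \<inter> (K1 \<inter> K2) = {u}" "ends f2 \<inter> (K1 \<inter> K2) = {u}" "ends f3 \<inter> (K1 \<inter> K2) = {u}"
      using f u out by auto
    ultimately show "e \<in> {e \<in> D. card (ends e \<inter> (K1 \<inter> K2)) = 1}" using f by auto
  next
    fix e assume "e \<in> {e \<in> D. card (ends e \<inter> (K1 \<inter> K2)) = 1}"
    then have e: "e \<in> D" "card (ends e \<inter> (K1 \<inter> K2)) = 1" by auto
    then obtain s where s: "ends e \<inter> (K1 \<inter> K2) = {s}" by (auto simp: card_1_singleton_iff)
    have eE: "e \<in> E" using e D_E by blast
    obtain t where t: "ends e = {s, t}" "s \<noteq> t" using obtain_other_end[OF eE, of s] s by blast
    have "t \<in> V" using ends_sub_V[OF eE] t by auto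
    have "s \<in> K1 \<inter> K2" using s by blast
    moreover have "t \<notin> K1 \<inter> K2" using s t by auto
    ultimately have "e \<in> {f1, f2} \<or> e \<in> {f1, f3}"
      using leave[OF e(1) t(1), of "{f1, f2}"] leave[OF e(1) t(1), of "{f1, f3}"] \<open>t \<in> V\<close>
      unfolding K1_def K2_def by blast
    then show "e \<in> {f1, f2, f3}" by blast
  qed
  moreover have "even (card {e \<in> D. card (ends e \<inter> (K1 \<inter> K2)) = 1})"
    by (rule even_cut[OF D_even]) (simp add: K1_def finite_V)
  moreover have "f1 \<noteq> f2" "f2 \<noteq> f3" "f1 \<noteq> f3" using f ne by (auto simp: doubleton_eq_iff)
  ultimately show False by simp
qed

end

section \<open>Lower bounds for the stars\<close>

context triangle_free_incidence
begin

lemma matching_of_partners: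
  assumes "inj_on \<pi> B" "\<pi> ` B \<inter> B = {}" "\<And>b. b \<in> B \<Longrightarrow> (b, \<pi> b) \<in> link E"
  shows "matching ((\<lambda>b. edge_of b (\<pi> b)) ` B)" "card ((\<lambda>b. edge_of b (\<pi> b)) ` B) = card B"
proof -
  let ?e = "\<lambda>b. edge_of b (\<pi> b)"
  have e: "?e b \<in> E" "ends (?e b) = {b, \<pi> b}" if "b \<in> B" for b using edge_of[OF assms(3)[OF that]] by auto
  have disj: "ends (?e a) \<inter> ends (?e b) = {}" if ab: "a \<in> B" "b \<in> B" "a \<noteq> b" for a b
  proof -
    have "\<pi> a \<noteq> \<pi> b" using assms(1) ab by (auto dest: inj_onD)
    moreover have "\<pi> a \<noteq> b" "\<pi> b \<noteq> a" using assms(2) ab by blast+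
    ultimately show ?thesis using e(2)[OF ab(1)] e(2)[OF ab(2)] ab(3) by simp
  qed
  show "matching (?e ` B)"
    unfolding matching_def
  proof (intro conjI ballI impI)
    show "?e ` B \<subseteq> E" using e by blast
    fix f g assume "f \<in> ?e ` B" "g \<in> ?e ` B" "f \<noteq> g"
    then obtain a b where "a \<in> B" "b \<in> B" "f = ?e a" "g = ?e b" "a \<noteq> b" by blast
    then show "ends f \<inter> ends g = {}" using disj by simp
  qed
  have "inj_on ?e B"
  proof (rule inj_onI)
    fix a b assume ab: "a \<in> B" "b \<in> B" "?e a = ?e b"
    then show "a = b" using disj[of a b] e(2)[of a] by auto
  qed
  then show "card (?e ` B) = card B" by (rule card_image)
qed

end

context optimal_system
begin

text \<open>
  In \<open>D\<close> every vertex of \<open>X\<close> has at least two neighbours, none of them in \<open>X\<close> because there are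
  no triangles, and by \<open>at_most_two_links\<close> no vertex has more than two neighbours in \<open>X\<close>. Double
  counting gives Hall's condition.
\<close>

lemma neighbours_matched:
  assumes w: "w \<in> W"
  defines "X \<equiv> {x \<in> supp D. (w, x) \<in> link E}"
  obtains \<nu> where "inj_on \<nu> X" "\<forall>x\<in>X. \<nu> x \<in> supp D - X \<and> (x, \<nu> x) \<in> link D"
proof -
  have DE: "link D \<subseteq> link E" using link_mono[OF D_E] .
  have finX: "finite X" using finite_supp[OF D_E] by (simp add: X_def)
  have indep: "(x, y) \<notin> link E" if "x \<in> X" "y \<in> X" for x y
    using that link_triangle_free[of w x y] by (auto simp: X_def)
  have finN: "finite (link D `` {x})" for x
    using finite_subset[OF Image_mono[OF DE order_refl] finite_link] .
  have hall: "card Y \<le> card (\<Union> ((\<lambda>x. link D `` {x}) ` Y))" if Y: "Y \<subseteq> X" for Y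
  proof -
    define NY where "NY = (\<Union>x\<in>Y. link D `` {x})"
    define F where "F = {e \<in> D. ends e \<inter> Y \<noteq> {}}"
    have finY: "finite Y" using Y finX finite_subset by blast
    have finNY: "finite NY" using finY finN by (simp add: NY_def)
    have FE: "F \<subseteq> E" using D_E by (auto simp: F_def)
    have NY_X: "u \<notin> X" if "u \<in> NY" for u
      using that indep Y DE by (auto simp: NY_def)
    have split: "card (ends e \<inter> Y) = 1 \<and> card (ends e \<inter> NY) = 1" if e: "e \<in> F" for e
    proof -
      obtain x where x: "x \<in> Y" "x \<in> ends e" using e by (auto simp: F_def)
      obtain u where u: "ends e = {x, u}" "x \<noteq> u" using obtain_other_end x(2) e FE by blast
      then have "(x, u) \<in> link D" using e by (auto simp: F_def link_def)
      then have "u \<in> NY" using x by (auto simp: NY_def)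
      then have "u \<notin> Y" "x \<notin> NY" using NY_X x(1) Y by blast+
      then have "ends e \<inter> Y = {x}" "ends e \<inter> NY = {u}" using u x \<open>u \<in> NY\<close> by auto
      then show ?thesis by simp
    qed
    have lower: "2 \<le> card (edges_at F x)" if x: "x \<in> Y" for x
    proof -
      have "x \<in> supp D" using x Y by (auto simp: X_def)
      then obtain e where "e \<in> edges_at D x" by (auto simp: supp_def edges_at_def)
      then have "card (edges_at D x) \<noteq> 0" using edges_at_finite[OF D_E] by auto
      moreover have "even (card (edges_at D x))" using D_even by (simp add: even_set_def)
      moreover have "edges_at F x = edges_at D x" using x by (auto simp: F_def edges_at_def)
      ultimately show ?thesis by (metis One_nat_def even_numeral less_2_cases not_less odd_one)
    qed
    have upper: "card (edges_at F u) \<le> 2" if u: "u \<in> NY" for u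
    proof (rule ccontr)
      assume "\<not> card (edges_at F u) \<le> 2"
      then have "3 \<le> card (link F `` {u})" by (simp add: card_edges_at[OF FE])
      then obtain T where T: "T \<subseteq> link F `` {u}" "card T = 3" using obtain_subset_with_card_n by metis
      then obtain x1 x2 x3 where T3: "T = {x1, x2, x3}" "x1 \<noteq> x2" "x2 \<noteq> x3" "x1 \<noteq> x3"
        by (auto simp: card_3_iff)
      have "(u, x) \<in> link D \<and> (w, x) \<in> link E" if "x \<in> T" for x
      proof -
        obtain e where e: "e \<in> F" "ends e = {u, x}" using T(1) \<open>x \<in> T\<close> by (auto simp: link_def)
        then have "x \<in> Y" using NY_X[OF u] Y by (auto simp: F_def)
        then show ?thesis using e Y by (auto simp: link_def F_def X_def)
      qed
      then show False using at_most_two_links[OF w, of x1 x2 x3 u] T3 by simp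
    qed
    have "2 * card Y = (\<Sum>x\<in>Y. 2)" by simp
    also have "\<dots> \<le> (\<Sum>x\<in>Y. card (edges_at F x))" by (rule sum_mono) (rule lower)
    also have "\<dots> = (\<Sum>e\<in>F. card (ends e \<inter> Y))" by (rule double_count[OF FE finY])
    also have "\<dots> = (\<Sum>e\<in>F. card (ends e \<inter> NY))" using split by (intro sum.cong) auto
    also have "\<dots> = (\<Sum>u\<in>NY. card (edges_at F u))" by (rule double_count[OF FE finNY, symmetric])
    also have "\<dots> \<le> (\<Sum>u\<in>NY. 2)" by (rule sum_mono) (rule upper)
    finally show ?thesis by (simp add: NY_def)
  qed
  obtain \<nu> where \<nu>: "inj_on \<nu> X" "\<forall>x\<in>X. \<nu> x \<in> link D `` {x}"
    using hall_matching[OF finX finN hall] .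
  show ?thesis
  proof (rule that[OF \<nu>(1)], intro ballI conjI)
    fix x assume x: "x \<in> X"
    then show l: "(x, \<nu> x) \<in> link D" using \<nu>(2) by blast
    have "\<nu> x \<notin> X" using indep[OF x] l DE by blast
    moreover have "\<nu> x \<in> supp D" using l by (auto simp: link_def supp_def)
    ultimately show "\<nu> x \<in> supp D - X" by blast
  qed
qed

text \<open>
  Let \<open>w\<close> be matched to \<open>z\<close>. The matching of all stars together with that of the neighbours of
  \<open>w\<close> on trails has \<open>card S + card X\<close> edges, and the edge \<open>zw\<close> has more neighbours than that.
  Since \<open>w\<close> itself meets at most \<open>card X + card Sw\<close> edges, enough of them are at \<open>z\<close>. If two
  centres are adjacent, \<open>w\<close> cannot see both and one more edge is gained.
\<close>

lemma star_degree:
  assumes deg: "\<And>I e. matching I \<Longrightarrow> e \<in> I \<Longrightarrow> Suc (card I) \<le> card (neighbours e)"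
    and z: "z \<in> S"
  shows "3 \<le> card (edges_at E z)" "inside S \<noteq> {} \<Longrightarrow> 4 \<le> card (edges_at E z)"
proof -
  let ?w = "\<mu> z"
  note w = \<mu>(2)[OF z] and zw = \<mu>(3)[OF z]
  define X where "X = {x \<in> supp D. (?w, x) \<in> link E}"
  define Sw where "Sw = {s \<in> S. (?w, s) \<in> link E}"
  obtain \<nu> where \<nu>': "inj_on \<nu> X" "\<forall>x\<in>X. \<nu> x \<in> supp D - X \<and> (x, \<nu> x) \<in> link D"
    using neighbours_matched[OF w] unfolding X_def .
  have \<nu>: "inj_on \<nu> X" "\<And>x. x \<in> X \<Longrightarrow> \<nu> x \<in> supp D - X" "\<And>x. x \<in> X \<Longrightarrow> (x, \<nu> x) \<in> link D"
    using \<nu>' by auto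
  have finS: "finite S" using finite_V finite_subset Z_split(4) by blast
  have finX: "finite X" using finite_supp[OF D_E] by (simp add: X_def)
  have XD: "X \<subseteq> supp D" by (auto simp: X_def)
  have SX: "S \<inter> X = {}" using XD Z_split(2) by blast
  define \<pi> where "\<pi> b = (if b \<in> S then \<mu> b else \<nu> b)" for b
  have \<pi>S: "\<pi> b = \<mu> b" "\<pi> b \<in> W" if "b \<in> S" for b using that \<mu>(2) by (auto simp: \<pi>_def)
  have \<pi>X: "\<pi> b = \<nu> b" "\<pi> b \<in> supp D - X" if "b \<in> X" for b using that \<nu>(2) SX by (auto simp: \<pi>_def)
  have inj: "inj_on \<pi> (S \<union> X)"
    unfolding inj_on_Un
  proof (intro conjI)
    show "inj_on \<pi> S" by (rule inj_on_cong[THEN iffD2, OF _ \<mu>(1)]) (rule \<pi>S(1))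
    show "inj_on \<pi> X" by (rule inj_on_cong[THEN iffD2, OF _ \<nu>(1)]) (rule \<pi>X(1))
    have "\<pi> ` S \<subseteq> W" "\<pi> ` X \<subseteq> supp D" using \<pi>S(2) \<pi>X(2) by auto
    then show "\<pi> ` (S - X) \<inter> \<pi> ` (X - S) = {}" using W_disjoint(1) by blast
  qed
  have apart: "\<pi> ` (S \<union> X) \<inter> (S \<union> X) = {}"
  proof -
    have "\<pi> b \<notin> S \<union> X" if "b \<in> S \<union> X" for b
    proof (cases "b \<in> S")
      case True
      then show ?thesis using \<pi>S(2)[OF True] W_disjoint XD by blast
    next
      case False
      then have "\<pi> b \<in> supp D - X" using \<pi>X(2) that by blast
      then show ?thesis using Z_split(2) by blast
    qed
    then show ?thesis by blast
  qed
  have linked: "(b, \<pi> b) \<in> link E" if "b \<in> S \<union> X" for b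
    using that \<mu>(3) \<nu>(3) \<pi>S(1) \<pi>X(1) link_mono[OF D_E] by auto
  let ?I = "(\<lambda>b. edge_of b (\<pi> b)) ` (S \<union> X)"
  have m1: "matching ?I" by (rule matching_of_partners(1)[OF inj apart]) (rule linked)
  have m2: "card ?I = card (S \<union> X)" by (rule matching_of_partners(2)[OF inj apart]) (rule linked)
  have "edge_of z ?w \<in> ?I" using z \<pi>S(1)[OF z] by force
  from deg[OF m1 this] have "Suc (card S + card X) \<le> card (neighbours (edge_of z ?w))"
    unfolding m2 card_Un_disjoint[OF finS finX SX] .
  moreover have "z \<noteq> ?w" using link_neq[OF order_refl zw] .
  ultimately have sum: "card S + card X + 3 \<le> card (edges_at E z) + card (edges_at E ?w)"
    using degree_sum[OF edge_of[OF zw]] by linarith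
  have "link E `` {?w} \<subseteq> X \<union> Sw"
  proof
    fix q assume "q \<in> link E `` {?w}"
    then have q: "(?w, q) \<in> link E" by blast
    then have "q \<in> Z" using link_Z[OF q] w by (auto simp: W_def)
    then show "q \<in> X \<union> Sw" using q Z_split(1) by (auto simp: X_def Sw_def)
  qed
  then have "card (edges_at E ?w) \<le> card (X \<union> Sw)"
    unfolding card_edges_at[OF order_refl] using finX finS by (intro card_mono) (auto simp: Sw_def)
  also have "\<dots> \<le> card X + card Sw" by (rule card_Un_le)
  finally have le: "card S + 3 \<le> card (edges_at E z) + card Sw" using sum by linarith
  have Sw_S: "Sw \<subseteq> S" by (auto simp: Sw_def)
  then have "card Sw \<le> card S" using finS by (rule card_mono[rotated])
  then show "3 \<le> card (edges_at E z)" using le by linarith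
  assume "inside S \<noteq> {}"
  then obtain e where e: "e \<in> E" "ends e \<subseteq> S" by (auto simp: inside_def)
  obtain s t where st: "ends e = {s, t}" using obtain_ends[OF e(1)] by metis
  have "Sw \<noteq> S"
  proof
    assume "Sw = S"
    then have "(?w, s) \<in> link E" "(?w, t) \<in> link E" using e(2) st by (auto simp: Sw_def)
    moreover have "(s, t) \<in> link E" using e(1) st by (auto simp: link_def)
    ultimately show False using link_triangle_free[of ?w s t] by blast
  qed
  then have "card Sw < card S" using Sw_S finS by (intro psubset_card_mono) auto
  then show "4 \<le> card (edges_at E z)" using le by linarith
qed

text \<open>
  Edges outside \<open>D\<close> are given to one of their covered ends. Only edges between two centres of
  stars are contested. They form a forest, so by Hall's theorem they can be charged to distinct
  ends \<open>\<psi> e\<close>; giving each to its other end costs every centre at most one edge.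
\<close>

theorem star_assignment:
  assumes deg: "\<And>I e. matching I \<Longrightarrow> e \<in> I \<Longrightarrow> Suc (card I) \<le> card (neighbours e)"
  obtains \<phi> where "\<forall>e\<in>E - D. \<phi> e \<in> ends e \<inter> Z" "\<forall>z\<in>S. 3 \<le> card {e \<in> E - D. \<phi> e = z}"
proof -
  have in_E: "inside S \<subseteq> E" by (auto simp: inside_def)
  have hall: "card Y \<le> card (\<Union> (ends ` Y))" if Y: "Y \<subseteq> inside S" for Y
  proof (cases "Y = {}")
    case False
    let ?U = "\<Union> (ends ` Y)"
    have US: "?U \<subseteq> S" using Y by (auto simp: inside_def)
    have "Y \<subseteq> inside ?U" using Y by (auto simp: inside_def)
    then have "card Y \<le> card (inside ?U)" using finite_sub by (intro card_mono) (auto simp: inside_def)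
    moreover obtain e where e: "e \<in> Y" using False by blast
    have "ends e \<noteq> {}" using card_ends[of e] e Y in_E by auto
    then have "?U \<noteq> {}" using e by blast
    ultimately show ?thesis using thin_acyclic[OF thin_SW, of ?U] US Z_split(4) by force
  qed simp
  have fin: "finite (ends e)" if "e \<in> inside S" for e using that in_E finite_ends by blast
  obtain \<psi> where \<psi>': "inj_on \<psi> (inside S)" "\<forall>e\<in>inside S. \<psi> e \<in> ends e"
    using hall_matching[OF finite_sub[OF in_E] fin hall] .
  have \<psi>: "inj_on \<psi> (inside S)" "\<And>e. e \<in> inside S \<Longrightarrow> \<psi> e \<in> ends e" using \<psi>' by auto
  define good where "good e p \<longleftrightarrow> p \<in> ends e \<inter> Z \<and> (e \<in> inside S \<longrightarrow> p \<noteq> \<psi> e)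
      \<and> (\<forall>z\<in>S. e \<notin> inside S \<longrightarrow> z \<in> ends e \<longrightarrow> p = z)" for e p
  have "\<exists>p. good e p"
    if e: "e \<in> E - D" for e
  proof (cases "e \<in> inside S")
    case True
    obtain p where "ends e = {\<psi> e, p}" "\<psi> e \<noteq> p" using obtain_other_end[of e "\<psi> e"] \<psi>(2)[OF True] e by blast
    moreover have "p \<in> S" using True calculation by (auto simp: inside_def)
    ultimately have "good e p" using True Z_split(1) by (auto simp: good_def)
    then show ?thesis ..
  next
    case False
    show ?thesis
    proof (cases "\<exists>z\<in>S. z \<in> ends e")
      case True
      then obtain z where z: "z \<in> S" "z \<in> ends e" by blast
      obtain p where p: "ends e = {z, p}" using obtain_other_end[of e z] z e by blast
      have "p \<notin> S" using False p z e by (auto simp: inside_def)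
      then have "good e z" using False z p Z_split(1) by (auto simp: good_def)
      then show ?thesis ..
    next
      case no: False
      obtain p where "p \<in> ends e" "p \<in> Z" using cover[of e] e by blast
      then have "good e p" using no False by (auto simp: good_def)
      then show ?thesis ..
    qed
  qed
  then obtain \<phi> where "\<And>e. e \<in> E - D \<Longrightarrow> good e (\<phi> e)" by metis
  then have \<phi>: "\<phi> e \<in> ends e \<inter> Z \<and> (e \<in> inside S \<longrightarrow> \<phi> e \<noteq> \<psi> e)
      \<and> (\<forall>z\<in>S. e \<notin> inside S \<longrightarrow> z \<in> ends e \<longrightarrow> \<phi> e = z)" if "e \<in> E - D" for e
    using that unfolding good_def by blast
  show ?thesis
  proof (rule that[of \<phi>]; intro ballI)
    show "\<phi> e \<in> ends e \<inter> Z" if "e \<in> E - D" for e using \<phi>[OF that] by blast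
    fix z assume z: "z \<in> S"
    let ?A = "{e \<in> E - D. \<phi> e = z}"
    define L where "L = {e \<in> inside S. \<psi> e = z}"
    have finA: "finite ?A" using finite_E by simp
    have "edges_at E z - L \<subseteq> ?A"
    proof
      fix e assume e: "e \<in> edges_at E z - L"
      then have eE: "e \<in> E" "z \<in> ends e" by (auto simp: edges_at_def)
      have "e \<notin> D" using eE(2) z Z_split(2) by (auto simp: supp_def)
      then have eD: "e \<in> E - D" using eE by blast
      have "\<phi> e = z"
      proof (cases "e \<in> inside S")
        case True
        then have "\<psi> e \<noteq> z" using e by (auto simp: L_def)
        obtain q where q: "ends e = {z, q}" using obtain_other_end[OF eE] by metis
        have "\<psi> e = q" using \<psi>(2)[OF True] q \<open>\<psi> e \<noteq> z\<close> by auto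
        then show ?thesis using \<phi>[OF eD] True q by auto
      next
        case False
        then show ?thesis using \<phi>[OF eD] z eE(2) by blast
      qed
      then show "e \<in> ?A" using eD by blast
    qed
    then have "card (edges_at E z - L) \<le> card ?A" using finA by (intro card_mono)
    moreover have "card (edges_at E z) - card L \<le> card (edges_at E z - L)" by (rule diff_card_le_card_Diff) (simp add: L_def finite_sub[OF in_E])
    moreover have "card L \<le> 1"
    proof -
      have "finite L" by (simp add: L_def finite_sub[OF in_E])
      moreover have "\<And>a b. a \<in> L \<Longrightarrow> b \<in> L \<Longrightarrow> a = b" using \<psi>(1) by (auto simp: L_def dest: inj_onD)
      ultimately show ?thesis by (simp add: card_le_Suc0_iff_eq)
    qed
    moreover have "card L = 0 \<or> inside S \<noteq> {}" by (auto simp: L_def)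
    ultimately show "3 \<le> card ?A" using star_degree[OF deg z] by linarith
  qed
qed

end

theorem (in triangle_free_incidence) trail_star_system_exists:
  assumes "\<And>I e. matching I \<Longrightarrow> e \<in> I \<Longrightarrow> Suc (card I) \<le> card (neighbours e)"
    and "\<And>I. matching I \<Longrightarrow> card I = Suc k \<Longrightarrow> card E \<le> (\<Sum>e\<in>I. card (neighbours e))"
  obtains D R \<phi> where "system D R" "card R \<le> k" "\<forall>e\<in>E - D. \<phi> e \<in> ends e \<inter> (supp D \<union> R)"
    "\<forall>z\<in>R - supp D. 3 \<le> card {e \<in> E - D. \<phi> e = z}"
proof -
  obtain D R where "optimal D R" using optimal_exists .
  then interpret optimal_system E ends D R by unfold_locales
  obtain \<phi> where \<phi>: "\<forall>e\<in>E - D. \<phi> e \<in> ends e \<inter> Z" "\<forall>z\<in>S. 3 \<le> card {e \<in> E - D. \<phi> e = z}"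
    using star_assignment[OF assms(1)] .
  show ?thesis
  proof (rule that[of D R \<phi>])
    show "card R \<le> k" by (rule card_reps_le[OF assms(2)])
    show "system D R" by (rule sys)
  qed (use \<phi> in \<open>auto simp: Z_def S_def\<close>)
qed

section \<open>Cycles in the line graph\<close>

context triangle_free_incidence
begin

definition adj :: "'a rel" where
  "adj = {(e, f). e \<in> E \<and> f \<in> E \<and> e \<noteq> f \<and> ends e \<inter> ends f \<noteq> {}}"

text \<open>
  Two cyclically consecutive elements share the end \<open>p\<close>. At such a place the cycle can be opened
  to absorb another edge at \<open>p\<close> or another cycle that visits \<open>p\<close>.
\<close>

definition visits :: "'b \<Rightarrow> 'a list \<Rightarrow> bool" where
  "visits p L \<longleftrightarrow> (\<exists>n. p \<in> ends (hd (rotate n L)) \<and> p \<in> ends (last (rotate n L)))"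

lemma visits_split:
  assumes "B \<noteq> []" "p \<in> ends (hd B)" "p \<in> ends (last (B @ A))"
  shows "visits p (A @ B)"
  unfolding visits_def using assms by (intro exI[of _ "length A"]) (simp add: rotate_append)

lemma visits_obtain_split:
  assumes "visits p L" "L \<noteq> []"
  obtains A B where "L = A @ B" "B \<noteq> []" "p \<in> ends (hd B)" "p \<in> ends (last (B @ A))"
proof -
  obtain n where n: "p \<in> ends (hd (rotate n L))" "p \<in> ends (last (rotate n L))"
    using assms(1) by (auto simp: visits_def)
  let ?k = "n mod length L"
  have "rotate n L = drop ?k L @ take ?k L" by (rule rotate_drop_take)
  moreover have "drop ?k L \<noteq> []" using mod_less_divisor[of "length L" n] assms(2) by (simp add: not_le)
  ultimately show ?thesis using that[of "take ?k L" "drop ?k L"] n by simp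
qed

lemma visits_rotate:
  assumes "visits p L"
  shows "visits p (rotate n L)"
proof (cases "L = []")
  case False
  obtain m where m: "p \<in> ends (hd (rotate m L))" "p \<in> ends (last (rotate m L))"
    using assms by (auto simp: visits_def)
  let ?j = "m + n * (length L - 1)"
  have j: "?j + n = m + n * length L" using False by (cases L) auto
  have "rotate ?j (rotate n L) = rotate (m + n * length L) L" by (simp only: rotate_rotate j)
  also have "\<dots> = rotate m L" 
    using rotate_conv_mod[of "m + n * length L" L] rotate_conv_mod[of m L] by simp
  finally show ?thesis unfolding visits_def using m by (intro exI[of _ ?j]) simp
qed (use assms in simp)

lemma visits_rotation:
  assumes "visits p (A @ B)"
  shows "visits p (B @ A)"
  using visits_rotate[OF assms, of "length A"] by (simp add: rotate_append)

lemma visits_cell_rotation: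
  assumes "cyc adj L" "visits p L"
  obtains K where "cyc adj K" "set K = set L" "p \<in> ends (hd K)" "p \<in> ends (last K)"
    "\<forall>q. visits q L \<longrightarrow> visits q K"
proof -
  obtain A B where AB: "L = A @ B" "B \<noteq> []" "p \<in> ends (hd B)" "p \<in> ends (last (B @ A))"
    using visits_obtain_split[OF assms(2) cyc_nonempty[OF assms(1)]] .
  show ?thesis
  proof (rule that[of "B @ A"])
    show "cyc adj (B @ A)" using assms(1) cyc_rotate AB(1) by blast
    show "set (B @ A) = set L" using AB by auto
    show "\<forall>q. visits q L \<longrightarrow> visits q (B @ A)" using visits_rotation AB(1) by blast
  qed (use AB in auto)
qed

lemma cyc_adj_E: "cyc adj L \<Longrightarrow> set L \<subseteq> E"
proof
  fix e assume L: "cyc adj L" "e \<in> set L"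
  obtain M where M: "cyc adj (e # M)" using cyc_rotate_to[OF L] by blast
  then have "(last (e # M), e) \<in> adj" by (auto simp: cyc_def)
  then show "e \<in> E" by (simp add: adj_def)
qed

lemma common_two_ends:
  assumes "e \<in> E" "f \<in> E" "p \<in> ends e" "q \<in> ends e" "p \<in> ends f" "q \<in> ends f" "p \<noteq> q"
  shows "e = f"
proof -
  obtain a b where "ends e = {p, a}" "ends f = {p, b}" using obtain_other_end[OF assms(1,3)] obtain_other_end[OF assms(2,5)] by metis
  then have "ends e = ends f" using assms(4,6,7) by auto
  then show ?thesis using edge_eqI assms by blast
qed

lemma cyc_hd_last_cell:
  assumes "cyc adj K" "p \<in> ends (hd K)" "p \<in> ends (last K)" "q \<in> ends (hd K)" "q \<in> ends (last K)"
  shows "q = p"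
proof (rule ccontr)
  assume "q \<noteq> p"
  have "hd K \<in> E" "last K \<in> E" using cyc_adj_E[OF assms(1)] cyc_nonempty[OF assms(1)] by auto
  then have "hd K = last K" using common_two_ends[of "hd K" "last K" p q] assms \<open>q \<noteq> p\<close> by blast
  moreover have "(last K, hd K) \<in> adj" using assms(1) by (simp add: cyc_def)
  ultimately show False by (simp add: adj_def)
qed

text \<open>
  The only pair of consecutive elements that is torn apart is the last and the first one. They
  share just the end \<open>p\<close>, which is visited again at the seam.
\<close>

lemma visits_append_cell:
  assumes K: "cyc adj K" "p \<in> ends (hd K)" "p \<in> ends (last K)"
    and M: "M \<noteq> []" "p \<in> ends (hd M)" and q: "visits q K"
  shows "visits q (K @ M)"
proof -
  have K0: "K \<noteq> []" using cyc_nonempty[OF K(1)] .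
  obtain A B where AB: "K = A @ B" "B \<noteq> []" "q \<in> ends (hd B)" "q \<in> ends (last (B @ A))"
    using visits_obtain_split[OF q K0] .
  show ?thesis
  proof (cases "A = []")
    case True
    then have "q = p" using cyc_hd_last_cell[OF K] AB by simp
    then show ?thesis using visits_split[of M p K] M K(3) K0 by simp
  next
    case False
    then show ?thesis using visits_split[of "B @ M" q A] AB M(1) by simp
  qed
qed

lemma cyc_merge:
  assumes "cyc adj L" "cyc adj M" "set L \<inter> set M = {}" "visits p L" "visits p M"
  obtains K where "cyc adj K" "set K = set L \<union> set M"
    "\<forall>q. visits q L \<or> visits q M \<longrightarrow> visits q K"
proof -
  obtain L' where L': "cyc adj L'" "set L' = set L" "p \<in> ends (hd L')" "p \<in> ends (last L')"
    "\<forall>q. visits q L \<longrightarrow> visits q L'" using visits_cell_rotation[OF assms(1,4)] .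
  obtain M' where M': "cyc adj M'" "set M' = set M" "p \<in> ends (hd M')" "p \<in> ends (last M')"
    "\<forall>q. visits q M \<longrightarrow> visits q M'" using visits_cell_rotation[OF assms(2,5)] .
  have ne: "L' \<noteq> []" "M' \<noteq> []" using cyc_nonempty L'(1) M'(1) by auto
  have disj: "set L' \<inter> set M' = {}" using L'(2) M'(2) assms(3) by simp
  have sub: "set L' \<subseteq> E" "set M' \<subseteq> E" using cyc_adj_E L'(1) M'(1) by auto
  have ends: "hd L' \<in> set L'" "last L' \<in> set L'" "hd M' \<in> set M'" "last M' \<in> set M'" using ne by auto
  have adj2: "(last L', hd M') \<in> adj" "(last M', hd L') \<in> adj"
    using ends sub disj L'(3,4) M'(3,4) by (auto simp: adj_def)
  have "cyc adj (L' @ M')"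
    using L'(1) M'(1) disj adj2 ne by (auto simp: cyc_def successively_append_iff)
  moreover have "visits q (L' @ M')" if "visits q L" for q
    using visits_append_cell[OF L'(1,3,4) ne(2) M'(3)] L'(5) that by blast
  moreover have "visits q (L' @ M')" if "visits q M" for q
    using visits_append_cell[OF M'(1,3,4) ne(1) L'(3)] M'(5) that visits_rotation by blast
  ultimately show ?thesis using that[of "L' @ M'"] L'(2) M'(2) by auto
qed

lemma cyc_insert:
  assumes "cyc adj L" "visits p L" "e \<in> E" "p \<in> ends e" "e \<notin> set L"
  obtains K where "cyc adj K" "set K = insert e (set L)" "\<forall>q. visits q L \<longrightarrow> visits q K"
proof -
  obtain L' where L': "cyc adj L'" "set L' = set L" "p \<in> ends (hd L')" "p \<in> ends (last L')"
    "\<forall>q. visits q L \<longrightarrow> visits q L'" using visits_cell_rotation[OF assms(1,2)] .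
  have ne: "L' \<noteq> []" using cyc_nonempty L'(1) .
  have "hd L' \<in> E" "last L' \<in> E" "hd L' \<noteq> e" "last L' \<noteq> e"
    using cyc_adj_E[OF L'(1)] ne hd_in_set[OF ne] last_in_set[OF ne] L'(2) assms(5) by blast+
  then have "(last L', e) \<in> adj" "(e, hd L') \<in> adj" using L'(3,4) assms by (auto simp: adj_def)
  then have "cyc adj (L' @ [e])"
    using L'(1,2) assms(5) ne by (auto simp: cyc_def successively_append_iff)
  moreover have "visits q (L' @ [e])" if "visits q L" for q
    using visits_append_cell[OF L'(1,3,4), of "[e]" q] assms(4) L'(5) that by simp
  ultimately show ?thesis using that[of "L' @ [e]"] L'(2) by auto
qed

text \<open>
  The first vertex of a longest path has a second neighbour, which must lie on the path.
\<close>

lemma longest_path_closes: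
  assumes "even_set F" "F \<noteq> {}"
  obtains cs where "distinct cs" "3 \<le> length cs" "successively (\<lambda>p q. (p, q) \<in> link F) cs"
    "(last cs, hd cs) \<in> link F"
proof -
  have FE: "F \<subseteq> E" using assms by (simp add: even_set_def)
  define good where "good vs \<longleftrightarrow> distinct vs \<and> 2 \<le> length vs \<and> successively (\<lambda>p q. (p, q) \<in> link F) vs" for vs
  have in_supp: "(p, q) \<in> link F \<Longrightarrow> p \<in> supp F \<and> q \<in> supp F" for p q by (auto simp: link_def supp_def)
  have bound: "length vs < Suc (card (supp F))" if g: "good vs" for vs
  proof -
    have "set vs \<subseteq> supp F"
    proof
      fix p assume "p \<in> set vs"
      then obtain i where i: "i < length vs" "vs ! i = p" by (auto simp: in_set_conv_nth)
      show "p \<in> supp F"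
      proof (cases "Suc i < length vs")
        case True
        then show ?thesis using g i in_supp by (auto simp: good_def successively_conv_nth)
      next
        case False
        then have "Suc (i - 1) < length vs" "Suc (i - 1) = i" using i g by (auto simp: good_def)
        then have "(vs ! (i - 1), vs ! i) \<in> link F" using g by (metis good_def successively_conv_nth)
        then show ?thesis using i in_supp by blast
      qed
    qed
    then have "card (set vs) \<le> card (supp F)" by (rule card_mono[OF finite_supp[OF FE]])
    then show ?thesis using g by (simp add: good_def distinct_card)
  qed
  obtain e where e: "e \<in> F" using assms by blast
  then obtain p q where pq: "ends e = {p, q}" "p \<noteq> q" using obtain_ends FE by blast
  then have "good [p, q]" using e by (auto simp: good_def link_def)
  then obtain vs where vs: "good vs" "\<And>us. good us \<Longrightarrow> length us \<le> length vs"
    using ex_has_greatest_nat[of good "[p, q]" length "Suc (card (supp F))"] bound by blast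
  obtain v0 v1 vr where v: "vs = v0 # v1 # vr"
    using vs(1) unfolding good_def by (cases vs; cases "tl vs") auto
  have l01: "(v0, v1) \<in> link F" using vs(1) by (simp add: good_def v)
  then obtain f where f: "f \<in> F" "ends f = {v0, v1}" by (auto simp: link_def)
  obtain g where g: "g \<in> F" "g \<noteq> f" "v0 \<in> ends g" using even_set_second_edge[OF assms(1) f(1)] f(2) by blast
  have gE: "g \<in> E" "f \<in> E" using f g FE by auto
  obtain w where w: "ends g = {v0, w}" "v0 \<noteq> w" using obtain_other_end[OF gE(1) g(3)] .
  have "w \<noteq> v1" using w f g(2) edge_eqI gE by auto
  have l0w: "(w, v0) \<in> link F" using g(1) w by (auto simp: link_def)
  have "w \<in> set vs"
  proof (rule ccontr)
    assume "w \<notin> set vs"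
    then have "good (w # vs)" using vs(1) l0w by (simp add: good_def v)
    then show False using vs(2)[of "w # vs"] by simp
  qed
  then have "w \<in> set vr" using v w(2) \<open>w \<noteq> v1\<close> by auto
  then obtain A B where AB: "vr = A @ w # B" by (meson split_list)
  let ?cs = "v0 # v1 # A @ [w]"
  have split: "vs = ?cs @ B" using v AB by simp
  have "successively (\<lambda>p q. (p, q) \<in> link F) ?cs" "distinct ?cs"
    using vs(1) unfolding good_def split successively_append_iff distinct_append by simp_all
  then show ?thesis using that[of ?cs] l0w by simp
qed

text \<open>
  The edges of a cycle with vertices \<open>cs\<close>, in cyclic order, form a cycle in the line graph;
  vertex \<open>j\<close> of \<open>cs\<close> is shared by edge \<open>j\<close> and its cyclic predecessor.
\<close>

lemma even_set_contains_cycle: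
  assumes "even_set F" "F \<noteq> {}"
  obtains L where "cyc adj L" "set L \<subseteq> F" "even_set (set L)" "\<forall>p\<in>supp (set L). visits p L"
proof -
  have FE: "F \<subseteq> E" using assms by (simp add: even_set_def)
  obtain cs where cs: "distinct cs" "3 \<le> length cs" "successively (\<lambda>p q. (p, q) \<in> link F) cs"
    "(last cs, hd cs) \<in> link F" using longest_path_closes[OF assms] .
  define n where "n = length cs"
  have n: "3 \<le> n" using cs by (simp add: n_def)
  define nx where "nx i = Suc i mod n" for i
  have nx_less: "nx i < n" for i using n by (simp add: nx_def)
  have nx: "nx i = (if Suc i = n then 0 else Suc i)" if "i < n" for i
    using that by (simp add: nx_def mod_Suc)
  have nx_cases: "Suc i = n \<and> nx i = 0 \<or> Suc i \<noteq> n \<and> nx i = Suc i" if "i < n" for i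
    using nx[OF that] by simp
  have cs_inj: "cs ! i = cs ! j \<longleftrightarrow> i = j" if "i < n" "j < n" for i j
    using that cs(1) nth_eq_iff_index_eq n_def by metis
  have ne: "cs \<noteq> []" using cs(2) by auto
  have lk: "(cs ! i, cs ! nx i) \<in> link F" if "i < n" for i
  proof (cases "Suc i = n")
    case True
    then have "i = length cs - 1" by (simp add: n_def)
    then have "last cs = cs ! i" "hd cs = cs ! 0" using ne by (auto simp: last_conv_nth hd_conv_nth)
    then show ?thesis using cs(4) nx[OF that] True by simp
  next
    case False
    then have "Suc i < length cs" using that n_def by simp
    then show ?thesis using cs(3) nx[OF that] False by (simp add: successively_conv_nth)
  qed
  define ed where "ed i = edge_of (cs ! i) (cs ! nx i)" for i
  have ed: "ed i \<in> F" "ends (ed i) = {cs ! i, cs ! nx i}" if i: "i < n" for i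
  proof -
    have l: "(cs ! i, cs ! nx i) \<in> link E" using lk[OF i] link_mono[OF FE] by blast
    show e: "ends (ed i) = {cs ! i, cs ! nx i}" using edge_of[OF l] by (simp add: ed_def)
    obtain f where f: "f \<in> F" "ends f = {cs ! i, cs ! nx i}" using lk[OF i] by (auto simp: link_def)
    have "ed i = f" using edge_of[OF l] f FE by (intro edge_eqI) (auto simp: ed_def)
    then show "ed i \<in> F" using f by simp
  qed
  have ed_at: "cs ! j \<in> ends (ed i) \<longleftrightarrow> j = i \<or> j = nx i" if "i < n" "j < n" for i j
    using ed(2)[OF that(1)] cs_inj[OF that(2,1)] cs_inj[OF that(2) nx_less] by simp
  have ed_inj: "i = j" if ij: "i < n" "j < n" "ed i = ed j" for i j
  proof (rule ccontr)
    assume "i \<noteq> j"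
    have "i = nx j" using ed_at[OF ij(2,1)] ed_at[OF ij(1,1)] ij(3) \<open>i \<noteq> j\<close> by simp
    moreover have "j = nx i" using ed_at[OF ij(1,2)] ed_at[OF ij(2,2)] ij(3) \<open>i \<noteq> j\<close> by simp
    ultimately show False using nx_cases[OF ij(1)] nx_cases[OF ij(2)] n by arith
  qed
  define L where "L = map ed [0..<n]"
  have L: "length L = n" "L \<noteq> []" "i < n \<Longrightarrow> L ! i = ed i" for i using n by (auto simp: L_def)
  have set_L: "set L = ed ` {..<n}" by (auto simp: L_def)
  have adj_nx: "(ed i, ed (nx i)) \<in> adj" if i: "i < n" for i
  proof -
    have "i \<noteq> nx i" using nx_cases[OF i] n by arith
    then have "ed i \<noteq> ed (nx i)" using ed_inj[OF i nx_less] by blast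
    moreover have "cs ! nx i \<in> ends (ed i) \<inter> ends (ed (nx i))"
      using ed_at[OF i nx_less] ed_at[OF nx_less nx_less] by simp
    ultimately show ?thesis using ed(1)[OF i] ed(1)[OF nx_less] FE by (auto simp: adj_def)
  qed
  have "cyc adj L"
    unfolding cyc_def
  proof (intro conjI)
    show "distinct L" unfolding L_def distinct_map using ed_inj by (auto intro: inj_onI)
    show "3 \<le> length L" using L n by simp
    show "path adj L"
      unfolding successively_conv_nth
    proof (intro allI impI)
      fix i assume i: "Suc i < length L"
      then have "nx i = Suc i" "i < n" using L(1) nx[of i] by auto
      then show "(L ! i, L ! Suc i) \<in> adj" using adj_nx[of i] L i by simp
    qed
    have "last L = ed (n - 1)" "hd L = ed 0" using L n by (auto simp: last_conv_nth hd_conv_nth)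
    moreover have "nx (n - 1) = 0" using nx[of "n - 1"] n by simp
    ultimately show "(last L, hd L) \<in> adj" using adj_nx[of "n - 1"] n by simp
  qed
  moreover have "set L \<subseteq> F" using set_L ed by auto
  moreover have pred: "\<exists>k<n. nx k = j" if j: "j < n" for j
  proof (cases j)
    case 0
    then show ?thesis using nx[of "n - 1"] n by (intro exI[of _ "n - 1"]) auto
  next
    case (Suc k)
    then show ?thesis using nx[of k] j by (intro exI[of _ k]) auto
  qed
  have even_L: "even_set (set L)"
    unfolding even_set_def
  proof (intro conjI allI)
    show "set L \<subseteq> E" using \<open>set L \<subseteq> F\<close> FE by blast
    fix p
    show "even (card (edges_at (set L) p))"
    proof (cases "p \<in> set cs")
      case True
      then obtain j where j: "j < n" "p = cs ! j" unfolding n_def in_set_conv_nth by blast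
      obtain k where k: "k < n" "nx k = j" using pred[OF j(1)] by blast
      have kj: "k \<noteq> j" using k(2) nx_cases[OF k(1)] n by arith
      have uniq: "i = k" if "i < n" "nx i = j" for i
        using that(2) k(2) nx_cases[OF k(1)] nx_cases[OF that(1)] by arith
      have "edges_at (set L) p = {ed j, ed k}"
      proof (intro equalityI subsetI)
        fix e assume "e \<in> edges_at (set L) p"
        then obtain i where i: "i < n" "e = ed i" "cs ! j \<in> ends (ed i)" using set_L j by (auto simp: edges_at_def)
        then show "e \<in> {ed j, ed k}" using ed_at[OF i(1) j(1)] uniq by auto
      next
        fix e assume "e \<in> {ed j, ed k}"
        then show "e \<in> edges_at (set L) p"
          using ed_at[OF j(1,1)] ed_at[OF k(1) j(1)] k(2) j k(1) set_L by (auto simp: edges_at_def)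
      qed
      moreover have "ed j \<noteq> ed k" using ed_inj[OF j(1) k(1)] kj by blast
      ultimately show ?thesis by simp
    next
      case False
      have "edges_at (set L) p = {}"
      proof -
        have "p \<notin> ends (ed i)" if "i < n" for i
          using ed(2)[OF that] False that nx_less[of i] n_def nth_mem by (metis insert_iff singletonD)
        then show ?thesis using set_L by (auto simp: edges_at_def)
      qed
      then show ?thesis by simp
    qed
  qed
  have "\<forall>p\<in>supp (set L). visits p L"
  proof
    fix p assume "p \<in> supp (set L)"
    then obtain i where "i < n" "p \<in> ends (ed i)" using set_L by (auto simp: supp_def)
    then obtain j where j: "j < n" "p = cs ! j" using ed(2) nx_less by blast
    obtain k where k: "k < n" "nx k = j" using pred[OF j(1)] by blast
    have in_ends: "p \<in> ends (ed j)" "p \<in> ends (ed k)" using ed_at[OF j(1,1)] ed_at[OF k(1) j(1)] k(2) j(2) by auto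
    have "hd (rotate j L) = ed j" using hd_rotate_conv_nth[OF L(2), of j] L j(1) by simp
    moreover have "last (rotate j L) = ed k"
    proof -
      have "last (rotate j L) = L ! ((j + (n - 1)) mod n)"
        using L n by (simp add: last_conv_nth nth_rotate)
      moreover have "(j + (n - 1)) mod n = k"
      proof (cases "Suc k = n")
        case True
        then have "j = 0" "k = n - 1" using k nx[OF k(1)] by auto
        then show ?thesis using n by simp
      next
        case False
        then have "j = Suc k" using k nx[OF k(1)] by auto
        then have "j + (n - 1) = k + n" using n by simp
        then show ?thesis using k(1) by simp
      qed
      ultimately show ?thesis using L k(1) by simp
    qed
    ultimately show "visits p L" unfolding visits_def using in_ends by metis
  qed
  then show ?thesis using that[of L] \<open>cyc adj L\<close> \<open>set L \<subseteq> F\<close> even_L by blast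
qed

end

section \<open>Cycle covers from systems\<close>

context triangle_free_incidence
begin

lemma extract_list:
  assumes "L \<in> set Ls"
  obtains Ys where "length Ls = Suc (length Ys)" "set Ls = insert L (set Ys)"
    "distinct (concat Ls) \<longleftrightarrow> distinct (L @ concat Ys)" "set (concat Ls) = set L \<union> set (concat Ys)"
proof -
  obtain Xs Zs where Ls: "Ls = Xs @ L # Zs" using assms by (meson split_list)
  show ?thesis
  proof (rule that[of "Xs @ Zs"])
    show "distinct (concat Ls) \<longleftrightarrow> distinct (L @ concat (Xs @ Zs))"
      unfolding Ls by (simp add: Int_Un_distrib Int_commute) blast
  qed (auto simp: Ls)
qed

definition cycle_decomposition :: "'a set \<Rightarrow> 'a list list \<Rightarrow> bool" where
  "cycle_decomposition F Ls \<longleftrightarrow> distinct (concat Ls) \<and> set (concat Ls) = F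
     \<and> (\<forall>L\<in>set Ls. cyc adj L \<and> (\<forall>p\<in>supp (set L). visits p L))"

lemma cycle_decomposition_exists:
  assumes "even_set F"
  shows "\<exists>Ls. cycle_decomposition F Ls"
  using assms
proof (induction "card F" arbitrary: F rule: less_induct)
  case less
  show ?case
  proof (cases "F = {}")
    case True
    then have "cycle_decomposition F []" by (simp add: cycle_decomposition_def)
    then show ?thesis ..
  next
    case False
    obtain L where L: "cyc adj L" "set L \<subseteq> F" "even_set (set L)" "\<forall>p\<in>supp (set L). visits p L"
      using even_set_contains_cycle[OF less.prems False] .
    have "(F - set L) \<union> (set L - F) = F - set L" using L(2) by auto
    then have ev: "even_set (F - set L)" using even_set_symdiff[OF less.prems L(3)] by simp
    have "finite F" using less.prems finite_sub by (simp add: even_set_def)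
    moreover have "F - set L \<subset> F" using L(2) cyc_nonempty[OF L(1)] by (cases L) auto
    ultimately have "card (F - set L) < card F" by (rule psubset_card_mono)
    then obtain Ls where "cycle_decomposition (F - set L) Ls" using less.hyps ev by blast
    moreover have "distinct L" using L(1) by (simp add: cyc_def)
    ultimately have "cycle_decomposition F (L # Ls)"
      using L by (auto simp: cycle_decomposition_def)
    then show ?thesis ..
  qed
qed

lemma supp_Un: "supp (A \<union> B) = supp A \<union> supp B" by (auto simp: supp_def)

text \<open>
  Two cycles that visit the same vertex can be merged, so a decomposition into the fewest cycles
  is separated.
\<close>

lemma separated_decomposition_exists:
  assumes "even_set F"
  obtains Ls where "cycle_decomposition F Ls"
    "\<forall>L\<in>set Ls. \<forall>M\<in>set Ls. \<forall>p. visits p L \<longrightarrow> visits p M \<longrightarrow> L = M"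
proof -
  obtain Ls0 where "cycle_decomposition F Ls0" using cycle_decomposition_exists[OF assms] by blast
  then obtain Ls where Ls: "cycle_decomposition F Ls"
    and min: "\<And>Ls'. cycle_decomposition F Ls' \<Longrightarrow> length Ls \<le> length Ls'"
    using ex_has_least_nat[of "cycle_decomposition F" Ls0 length] by blast
  have "L = M" if LM: "L \<in> set Ls" "M \<in> set Ls" and p: "visits p L" "visits p M" for L M p
  proof (rule ccontr)
    assume "L \<noteq> M"
    obtain Ys where Ys: "length Ls = Suc (length Ys)" "set Ls = insert L (set Ys)"
      "distinct (concat Ls) \<longleftrightarrow> distinct (L @ concat Ys)" "set (concat Ls) = set L \<union> set (concat Ys)"
      using extract_list[OF LM(1)] .
    have "M \<in> set Ys" using Ys(2) LM(2) \<open>L \<noteq> M\<close> by auto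
    then obtain Zs where Zs: "length Ys = Suc (length Zs)" "set Ys = insert M (set Zs)"
      "distinct (concat Ys) \<longleftrightarrow> distinct (M @ concat Zs)" "set (concat Ys) = set M \<union> set (concat Zs)"
      using extract_list by blast
    have cL: "cyc adj L" "cyc adj M" using Ls LM by (auto simp: cycle_decomposition_def)
    have d: "distinct (L @ concat Ys)" using Ls Ys(3) by (simp add: cycle_decomposition_def)
    then have disj: "set L \<inter> set M = {}" using Zs(4) by auto
    obtain K where K: "cyc adj K" "set K = set L \<union> set M"
      "\<forall>q. visits q L \<or> visits q M \<longrightarrow> visits q K" using cyc_merge[OF cL disj p] .
    have "cycle_decomposition F (K # Zs)"
      unfolding cycle_decomposition_def
    proof (intro conjI ballI)
      have "distinct K" using K(1) by (simp add: cyc_def)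
      then show "distinct (concat (K # Zs))" using d Zs(3,4) K(2) by auto
      show "set (concat (K # Zs)) = F" using Ls Ys(4) Zs(4) K(2) by (auto simp: cycle_decomposition_def)
      fix C assume "C \<in> set (K # Zs)"
      then consider "C = K" | "C \<in> set Ls" using Ys(2) Zs(2) by auto
      then have C: "cyc adj C \<and> (\<forall>q\<in>supp (set C). visits q C)"
      proof cases
        case 1
        have "\<forall>q\<in>supp (set L). visits q L" "\<forall>q\<in>supp (set M). visits q M"
          using Ls LM by (auto simp: cycle_decomposition_def)
        then show ?thesis using 1 K by (auto simp: supp_Un)
      next
        case 2
        then show ?thesis using Ls by (simp add: cycle_decomposition_def)
      qed
      then show "cyc adj C" by blast
      fix q assume "q \<in> supp (set C)"
      then show "visits q C" using C by blast
    qed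
    then show False using min[of "K # Zs"] Ys(1) Zs(1) by simp
  qed
  then show ?thesis using that[of Ls] Ls by blast
qed

text \<open>
  In a separated decomposition, edges with a common end lie in the same cycle. Therefore each
  cycle takes up a whole component of \<open>D\<close> and visits a representative of it, which no other
  cycle does.
\<close>

lemma decomposition_length:
  assumes sys: "system D R" and Ls: "cycle_decomposition D Ls"
    and sep: "\<forall>L\<in>set Ls. \<forall>M\<in>set Ls. \<forall>p. visits p L \<longrightarrow> visits p M \<longrightarrow> L = M"
  shows "length Ls \<le> card (R \<inter> supp D)"
proof -
  have D: "D = set (concat Ls)" using Ls by (simp add: cycle_decomposition_def)
  have step: "visits q L" if L: "L \<in> set Ls" "visits p L" and pq: "(p, q) \<in> link D" for L p q
  proof -
    obtain e where e: "e \<in> D" "ends e = {p, q}" using pq by (auto simp: link_def)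
    then obtain M where M: "M \<in> set Ls" "e \<in> set M" using D by auto
    then have "p \<in> supp (set M)" "q \<in> supp (set M)" using e(2) by (auto simp: supp_def)
    then have "visits p M" "visits q M" using Ls M(1) by (auto simp: cycle_decomposition_def)
    moreover have "L = M" using sep L M(1) \<open>visits p M\<close> by blast
    ultimately show ?thesis by simp
  qed
  have walk: "visits q L" if "(p, q) \<in> reach D" "L \<in> set Ls" "visits p L" for L p q
    using that(1) unfolding reach_def
    by (induction rule: rtrancl_induct) (use that step in blast)+
  have "\<exists>r. r \<in> R \<inter> supp D \<and> visits r L" if L: "L \<in> set Ls" for L
  proof -
    have cL: "cyc adj L" "\<forall>p\<in>supp (set L). visits p L" using Ls L by (auto simp: cycle_decomposition_def)
    have hL: "hd L \<in> set L" using cyc_nonempty[OF cL(1)] by simp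
    then have "hd L \<in> E" using cyc_adj_E[OF cL(1)] by blast
    then obtain p where p: "p \<in> ends (hd L)" using obtain_ends by (metis insertI1)
    have "visits p L" using cL(2) p hL by (auto simp: supp_def)
    moreover have pD: "p \<in> supp D" using p hL L D by (auto simp: supp_def)
    moreover obtain r where r: "r \<in> R" "(p, r) \<in> reach D" using sys pD by (auto simp: system_def)
    ultimately show ?thesis using walk[OF r(2) L] reach_supp[OF r(2) pD] r(1) by blast
  qed
  then obtain rep where rep: "\<And>L. L \<in> set Ls \<Longrightarrow> rep L \<in> R \<inter> supp D \<and> visits (rep L) L" by metis
  have "inj_on rep (set Ls)"
  proof (rule inj_onI)
    fix L M assume "L \<in> set Ls" "M \<in> set Ls" "rep L = rep M"
    then show "L = M" using rep[of L] rep[of M] sep by metis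
  qed
  moreover have "rep ` set Ls \<subseteq> R \<inter> supp D" using rep by blast
  moreover have "finite (R \<inter> supp D)" using sys finite_V finite_subset by (auto simp: system_def)
  ultimately have "card (set Ls) \<le> card (R \<inter> supp D)" by (rule card_inj_on_le)
  moreover have "distinct Ls"
  proof -
    have "distinct (concat Ls)" "[] \<notin> set Ls"
      using Ls cyc_nonempty by (auto simp: cycle_decomposition_def)
    then show ?thesis by (simp add: distinct_concat_iff removeAll_id)
  qed
  ultimately show ?thesis by (simp add: distinct_card)
qed

lemma insert_edges:
  assumes "finite F" "F \<inter> set (concat Ls) = {}" "distinct (concat Ls)" "\<forall>L\<in>set Ls. cyc adj L"
    and "\<forall>e\<in>F. e \<in> E \<and> (\<exists>p\<in>ends e. \<exists>L\<in>set Ls. visits p L)"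
  shows "\<exists>Ls'. length Ls' = length Ls \<and> distinct (concat Ls') \<and> set (concat Ls') = set (concat Ls) \<union> F
    \<and> (\<forall>L\<in>set Ls'. cyc adj L)"
  using assms
proof (induction F arbitrary: Ls rule: finite_induct)
  case empty
  then show ?case by (intro exI[of _ Ls]) simp
next
  case (insert e F)
  then obtain p L where p: "p \<in> ends e" "L \<in> set Ls" "visits p L" by blast
  obtain Ys where Ys: "length Ls = Suc (length Ys)" "set Ls = insert L (set Ys)"
    "distinct (concat Ls) \<longleftrightarrow> distinct (L @ concat Ys)" "set (concat Ls) = set L \<union> set (concat Ys)"
    using extract_list[OF p(2)] .
  have e: "e \<in> E" "e \<notin> set (concat Ls)" using insert.prems by auto
  have cL: "cyc adj L" using insert.prems(3) p(2) by blast
  have "e \<notin> set L" using e(2) Ys(4) by blast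
  then obtain K where K: "cyc adj K" "set K = Set.insert e (set L)" "\<forall>q. visits q L \<longrightarrow> visits q K"
    using cyc_insert[OF cL p(3) e(1) p(1)] by blast
  have "\<exists>Ls'. length Ls' = length (K # Ys) \<and> distinct (concat Ls')
      \<and> set (concat Ls') = set (concat (K # Ys)) \<union> F \<and> (\<forall>L\<in>set Ls'. cyc adj L)"
  proof (rule insert.IH)
    show "F \<inter> set (concat (K # Ys)) = {}" using insert.prems(1) insert.hyps(2) Ys(4) K(2) by auto
    have "distinct K" using K(1) by (simp add: cyc_def)
    then show "distinct (concat (K # Ys))" using insert.prems(2) Ys(3,4) K(2) e(2) by auto
    show "\<forall>L\<in>set (K # Ys). cyc adj L" using insert.prems(3) K(1) Ys(2) by simp
    show "\<forall>f\<in>F. f \<in> E \<and> (\<exists>p\<in>ends f. \<exists>L\<in>set (K # Ys). visits p L)"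
    proof
      fix f assume "f \<in> F"
      then obtain q M where "f \<in> E" "q \<in> ends f" "M \<in> set Ls" "visits q M" using insert.prems(4) by blast
      then show "f \<in> E \<and> (\<exists>p\<in>ends f. \<exists>L\<in>set (K # Ys). visits p L)"
        using K(3) Ys(2) by auto
    qed
  qed
  moreover have "set (concat (K # Ys)) \<union> F = set (concat Ls) \<union> Set.insert e F" using Ys(4) K(2) by auto
  ultimately show ?case using Ys(1) by simp
qed

text \<open>
  An edge assigned to a vertex of a trail is inserted into the cycle that visits this vertex,
  and the edges assigned to the centre of a star are pairwise adjacent, so they can be listed in
  any order.
\<close>

theorem cycle_cover_of_system:
  assumes sys: "system D R" and k: "card R \<le> k"
    and \<phi>: "\<forall>e\<in>E - D. \<phi> e \<in> ends e \<inter> (supp D \<union> R)"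
    and stars: "\<forall>z\<in>R - supp D. 3 \<le> card {e \<in> E - D. \<phi> e = z}"
  shows "cycle_cover adj E k"
proof -
  have D: "even_set D" "D \<subseteq> E" and finR: "finite R"
    using sys finite_V finite_subset by (auto simp: system_def even_set_def)
  obtain Ls where Ls: "cycle_decomposition D Ls"
    and sep: "\<forall>L\<in>set Ls. \<forall>M\<in>set Ls. \<forall>p. visits p L \<longrightarrow> visits p M \<longrightarrow> L = M"
    using separated_decomposition_exists[OF D(1)] .
  have LsD: "set (concat Ls) = D" "distinct (concat Ls)" "\<forall>L\<in>set Ls. cyc adj L"
    using Ls by (auto simp: cycle_decomposition_def)
  define F where "F = {e \<in> E - D. \<phi> e \<in> supp D}"
  have "\<exists>Ls'. length Ls' = length Ls \<and> distinct (concat Ls') \<and> set (concat Ls') = set (concat Ls) \<union> F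
    \<and> (\<forall>L\<in>set Ls'. cyc adj L)"
  proof (rule insert_edges)
    show "finite F" using finite_E by (simp add: F_def)
    show "F \<inter> set (concat Ls) = {}" using LsD(1) by (auto simp: F_def)
    show "\<forall>e\<in>F. e \<in> E \<and> (\<exists>p\<in>ends e. \<exists>L\<in>set Ls. visits p L)"
    proof
      fix e assume e: "e \<in> F"
      then have *: "e \<in> E" "\<phi> e \<in> ends e" "\<phi> e \<in> supp D" using \<phi> by (auto simp: F_def)
      then obtain f where "f \<in> D" "\<phi> e \<in> ends f" by (auto simp: supp_def)
      then obtain L where "L \<in> set Ls" "f \<in> set L" using LsD(1) by auto
      moreover from this have "visits (\<phi> e) L"
        using Ls \<open>\<phi> e \<in> ends f\<close> by (auto simp: cycle_decomposition_def supp_def)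
      ultimately show "e \<in> E \<and> (\<exists>p\<in>ends e. \<exists>L\<in>set Ls. visits p L)" using * by blast
    qed
  qed (use LsD in auto)
  then obtain Ls' where Ls': "length Ls' = length Ls" "distinct (concat Ls')" "set (concat Ls') = D \<union> F"
    "\<forall>L\<in>set Ls'. cyc adj L" unfolding LsD(1) by blast
  define star where "star z = {e \<in> E - D. \<phi> e = z}" for z
  have "\<exists>L. set L = star z \<and> distinct L" for z
    using finite_distinct_list[of "star z"] finite_E by (simp add: star_def)
  then obtain sl where sl: "\<And>z. set (sl z) = star z \<and> distinct (sl z)" by metis
  have cyc_star: "cyc adj (sl z)" if z: "z \<in> R - supp D" for z
  proof -
    have "3 \<le> card (star z)" using stars z unfolding star_def by blast
    moreover have "card (star z) = length (sl z)" using sl[of z] distinct_card[of "sl z"] by simp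
    ultimately have len: "3 \<le> length (sl z)" by simp
    have pair: "(e, f) \<in> adj" if "e \<in> set (sl z)" "f \<in> set (sl z)" "e \<noteq> f" for e f
    proof -
      have "e \<in> E - D" "f \<in> E - D" "\<phi> e = z" "\<phi> f = z" using that sl[of z] by (auto simp: star_def)
      moreover from this have "\<phi> e \<in> ends e" "\<phi> f \<in> ends f" using \<phi> by blast+
      ultimately show ?thesis using that(3) by (auto simp: adj_def)
    qed
    have dist: "distinct (sl z)" using sl by blast
    show ?thesis
      unfolding cyc_def
    proof (intro conjI)
      show "distinct (sl z)" by (rule dist)
      show "path adj (sl z)"
        unfolding successively_conv_nth
      proof (intro allI impI)
        fix i assume i: "Suc i < length (sl z)"
        then have "sl z ! i \<noteq> sl z ! Suc i" using nth_eq_iff_index_eq[OF dist, of i "Suc i"] by simp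
        then show "(sl z ! i, sl z ! Suc i) \<in> adj" using i by (intro pair nth_mem) simp_all
      qed
      have "sl z \<noteq> []" using len by auto
      then have e: "last (sl z) = sl z ! (length (sl z) - 1)" "hd (sl z) = sl z ! 0"
        by (auto simp: last_conv_nth hd_conv_nth)
      have "0 < length (sl z)" "length (sl z) - 1 < length (sl z)" using len by auto
      then have "last (sl z) \<noteq> hd (sl z)"
        unfolding e using nth_eq_iff_index_eq[OF dist, of "length (sl z) - 1" 0] len by simp
      then show "(last (sl z), hd (sl z)) \<in> adj"
        using \<open>sl z \<noteq> []\<close> by (intro pair last_in_set hd_in_set)
    qed (rule len)
  qed
  obtain zs where zs: "set zs = R - supp D" "distinct zs" using finite_distinct_list[of "R - supp D"] finR by blast
  have "distinct (concat (map sl ys))" if "distinct ys" for ys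
    using that
  proof (induction ys)
    case (Cons y ys)
    have "set (sl y) \<inter> set (concat (map sl ys)) = {}" using Cons.prems sl by (auto simp: star_def)
    then show ?case using Cons sl by simp
  qed simp
  then have dz: "distinct (concat (map sl zs))" using zs by blast
  have set_z: "set (concat (map sl zs)) = {e \<in> E - D. \<phi> e \<in> R - supp D}"
    using sl zs(1) by (auto simp: star_def)
  have union: "D \<union> F \<union> {e \<in> E - D. \<phi> e \<in> R - supp D} = E"
    using \<phi> D(2) by (auto simp: F_def)
  show ?thesis
    unfolding cycle_cover_def
  proof (intro exI[of _ "Ls' @ map sl zs"] conjI)
    have "length zs = card (R - supp D)" using zs distinct_card by metis
    moreover have "length Ls' \<le> card (R \<inter> supp D)" using decomposition_length[OF sys Ls sep] Ls'(1) by simp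
    moreover have "card R = card (R \<inter> supp D) + card (R - supp D)" using card_Int_Diff[OF finR] .
    ultimately show "length (Ls' @ map sl zs) \<le> k" using k by simp
    have "set (concat Ls') \<inter> set (concat (map sl zs)) = {}" unfolding Ls'(3) set_z by (auto simp: F_def)
    then show "distinct (concat (Ls' @ map sl zs))" using Ls'(2) dz by simp
    show "set (concat (Ls' @ map sl zs)) = E"
      using Ls'(3) set_z union by simp
    show "\<forall>L\<in>set (Ls' @ map sl zs). cyc adj L" using Ls'(4) cyc_star zs(1) by auto
  qed
qed

end

section \<open>Closed claw-free graphs as line graphs\<close>

text \<open>
  In a closed claw-free graph every edge lies in a unique maximal clique, and every vertex lies
  in at most two of them. With the maximal cliques as vertices and the vertices as edges one
  obtains a graph that has the given one as its line graph; it is triangle-free because three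
  pairwise adjacent vertices lie in a common maximal clique.
\<close>

locale closed_claw_free =
  fixes V :: "'a set" and G :: "'a rel"
  assumes graph: "simple_graph_on V G" and claws: "no_claw G" and closed: "locally_transitive G"
    and no_isolated: "x \<in> V \<Longrightarrow> \<exists>y. (x, y) \<in> G"
begin

lemma G_sym: "(a, b) \<in> G \<Longrightarrow> (b, a) \<in> G"
  using graph by (auto simp: simple_graph_on_def dest: symD)

lemma G_irrefl: "(a, a) \<notin> G"
  using graph by (auto simp: simple_graph_on_def irrefl_def)

lemma G_V: "(a, b) \<in> G \<Longrightarrow> a \<in> V \<and> b \<in> V"
  using graph by (auto simp: simple_graph_on_def)

lemma local_trans:
  "\<lbrakk>(x, u) \<in> G; (x, y) \<in> G; (x, v) \<in> G; (u, y) \<in> G; (y, v) \<in> G; u \<noteq> v\<rbrakk> \<Longrightarrow> (u, v) \<in> G"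
  using closed unfolding locally_transitive_def by blast

text \<open>
  For adjacent \<open>x\<close> and \<open>y\<close> this is the maximal clique that contains both.
\<close>

definition line :: "'a \<Rightarrow> 'a \<Rightarrow> 'a set" where
  "line x y = {x, y} \<union> {z. (x, z) \<in> G \<and> (y, z) \<in> G}"

definition simplicial :: "'a \<Rightarrow> bool" where
  "simplicial x \<longleftrightarrow> (\<forall>y z. (x, y) \<in> G \<longrightarrow> (x, z) \<in> G \<longrightarrow> y = z \<or> (y, z) \<in> G)"

text \<open>
  A simplicial vertex lies in only one maximal clique; the singleton serves as its private
  second end.
\<close>

definition cells :: "'a \<Rightarrow> 'a set set" where
  "cells x = {line x y | y. (x, y) \<in> G} \<union> (if simplicial x then {{x}} else {})"

lemma line_commute: "line x y = line y x" by (auto simp: line_def)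

lemma line_eq:
  assumes "(x, y) \<in> G" "(x, z) \<in> G" "(y, z) \<in> G"
  shows "line x y = line x z"
proof -
  have sub: "line x y \<subseteq> line x z" if a: "(x, y) \<in> G" "(x, z) \<in> G" "(y, z) \<in> G" for y z
  proof
    fix w assume "w \<in> line x y"
    then consider "w = x" | "w = y" | "(x, w) \<in> G" "(y, w) \<in> G" by (auto simp: line_def)
    then show "w \<in> line x z"
    proof cases
      case 2
      then show ?thesis using a G_sym by (auto simp: line_def)
    next
      case 3
      then show ?thesis using local_trans[of x z y w] a G_sym by (auto simp: line_def)
    qed (simp add: line_def)
  qed
  show ?thesis using sub[of y z] sub[of z y] assms G_sym by blast
qed

lemma line_clique:
  assumes "(x, y) \<in> G" "a \<in> line x y" "b \<in> line x y" "a \<noteq> b"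
  shows "(a, b) \<in> G"
proof -
  consider "a = x" | "a = y" | "(x, a) \<in> G" "(y, a) \<in> G" using assms(2) by (auto simp: line_def)
  then show ?thesis
  proof cases
    case 3
    have "b = x \<or> b = y \<or> (x, b) \<in> G \<and> (y, b) \<in> G" using assms(3) by (auto simp: line_def)
    then show ?thesis using 3 local_trans[of y a x b] assms(1,4) G_sym by blast
  qed (use assms G_sym in \<open>auto simp: line_def\<close>)
qed

lemma line_unique:
  assumes xy: "(x, y) \<in> G" and a: "a \<in> line x y" and b: "b \<in> line x y" and "a \<noteq> b"
  shows "line a b = line x y"
proof -
  have x: "x \<in> line x y" by (simp add: line_def)
  have from_x: "line x c = line x y" if "c \<in> line x y" "c \<noteq> x" for c
  proof (cases "c = y")
    case False
    then have "(x, c) \<in> G" "(c, y) \<in> G" using that G_sym by (auto simp: line_def)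
    then show ?thesis using line_eq[of x c y] xy by blast
  qed simp
  show ?thesis
  proof (cases "a = x \<or> b = x")
    case True
    then show ?thesis using from_x[OF a] from_x[OF b] assms(4) line_commute by metis
  next
    case False
    then have "(a, x) \<in> G" "(b, x) \<in> G" "(a, b) \<in> G"
      using line_clique[OF xy] a b x assms(4) by auto
    then have "line a b = line a x" using line_eq[of a b x] by blast
    then show ?thesis using from_x[OF a] False line_commute by metis
  qed
qed

lemma cell_mem: "c \<in> cells x \<Longrightarrow> x \<in> c"
  by (auto simp: cells_def line_def split: if_splits)

lemma cell_line:
  assumes "c \<in> cells x" "y \<in> c" "y \<noteq> x"
  shows "(x, y) \<in> G" "c = line x y"
proof -
  obtain z where z: "(x, z) \<in> G" "c = line x z"
    using assms by (auto simp: cells_def split: if_splits)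
  have x: "x \<in> line x z" by (simp add: line_def)
  show "(x, y) \<in> G" using line_clique[OF z(1) x] assms z(2) by metis
  show "c = line x y" using line_unique[OF z(1) x, of y] assms z(2) by metis
qed

lemma line_cell: "(x, y) \<in> G \<Longrightarrow> line x y \<in> cells x \<and> line x y \<in> cells y"
  using G_sym line_commute by (auto simp: cells_def)

text \<open>
  If \<open>u\<close> and \<open>v\<close> are nonadjacent neighbours of \<open>x\<close>, claw-freeness puts every neighbour of \<open>x\<close>
  into the clique of \<open>u\<close> or into that of \<open>v\<close>.
\<close>

lemma card_cells:
  assumes "x \<in> V"
  shows "card (cells x) = 2"
proof -
  obtain u where u: "(x, u) \<in> G" using no_isolated[OF assms] by blast
  show ?thesis
  proof (cases "simplicial x")
    case True
    have "line x y = line x u" if "(x, y) \<in> G" for y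
      using True line_eq[OF that u] that u by (auto simp: simplicial_def)
    then have "{line x y | y. (x, y) \<in> G} = {line x u}" using u by blast
    then have "cells x = {line x u, {x}}" using True by (simp add: cells_def insert_commute)
    moreover have "u \<in> line x u" "u \<noteq> x" using u G_irrefl by (auto simp: line_def)
    then have "line x u \<noteq> {x}" by blast
    ultimately show ?thesis by simp
  next
    case False
    then obtain u v where uv: "(x, u) \<in> G" "(x, v) \<in> G" "u \<noteq> v" "(u, v) \<notin> G"
      by (auto simp: simplicial_def)
    have "line x y = line x u \<or> line x y = line x v" if y: "(x, y) \<in> G" for y
    proof -
      have "y = u \<or> y = v \<or> (y, u) \<in> G \<or> (y, v) \<in> G"
        using no_clawD[OF claws uv(1,2) y uv(3)] uv(4) G_sym by blast
      then show ?thesis using line_eq[OF y uv(1)] line_eq[OF y uv(2)] by blast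
    qed
    then have "{line x y | y. (x, y) \<in> G} = {line x u, line x v}" using uv by blast
    then have "cells x = {line x u, line x v}" using False by (simp add: cells_def)
    moreover have "v \<notin> line x u" "v \<in> line x v" using uv G_irrefl by (auto simp: line_def)
    then have "line x u \<noteq> line x v" by blast
    ultimately show ?thesis by simp
  qed
qed

lemma adjacent_iff_common_cell:
  "x \<noteq> y \<Longrightarrow> cells x \<inter> cells y \<noteq> {} \<longleftrightarrow> (x, y) \<in> G"
proof
  assume "x \<noteq> y" "cells x \<inter> cells y \<noteq> {}"
  then show "(x, y) \<in> G" using cell_line(1) cell_mem by blast
next
  assume "(x, y) \<in> G"
  then show "cells x \<inter> cells y \<noteq> {}" using line_cell by blast
qed

lemma inj_cells: "inj_on cells V"
proof (rule inj_onI, rule ccontr)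
  fix x y assume xy: "x \<in> V" "y \<in> V" "cells x = cells y" "x \<noteq> y"
  have "cells x \<subseteq> {line x y}"
  proof
    fix c assume c: "c \<in> cells x"
    then have "y \<in> c" using cell_mem[of c y] xy(3) by simp
    then show "c \<in> {line x y}" using cell_line(2)[OF c] xy(4) by simp
  qed
  then have "card (cells x) \<le> card {line x y}" by (rule card_mono[rotated]) simp
  then show False using card_cells[OF xy(1)] by simp
qed

sublocale triangle_free_incidence V cells
proof
  show "finite V" using graph by (simp add: simple_graph_on_def)
  show "inj_on cells V" by (rule inj_cells)
  show "card (cells x) = 2" if "x \<in> V" for x using that by (rule card_cells)
  fix x y z p q r
  assume V: "x \<in> V" "y \<in> V" "z \<in> V" and ne: "p \<noteq> q" "q \<noteq> r" "p \<noteq> r"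
    and c: "cells x = {p, q}" "cells y = {q, r}" "cells z = {p, r}"
  have "p \<in> cells x" "p \<notin> cells y" "q \<in> cells y" "q \<in> cells x" "q \<notin> cells z"
    unfolding c using ne by simp_all
  then have "x \<noteq> y" "y \<noteq> z" "x \<noteq> z" by metis+
  have mem: "x \<in> p" "x \<in> q" "y \<in> q" "y \<in> r" "z \<in> p" "z \<in> r"
    using c cell_mem[of _ x] cell_mem[of _ y] cell_mem[of _ z] by simp_all
  have "q = line x y" using cell_line(2)[of q x y] c mem \<open>x \<noteq> y\<close> by auto
  moreover have "(x, z) \<in> G" using cell_line(1)[of p x z] c mem \<open>x \<noteq> z\<close> by auto
  moreover have "(y, z) \<in> G" using cell_line(1)[of r y z] c mem \<open>y \<noteq> z\<close> by auto
  ultimately have "z \<in> q" by (simp add: line_def)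
  then have "q = line z x" using cell_line(2)[of q x z] c \<open>x \<noteq> z\<close> line_commute by auto
  then have "q \<in> cells z" using line_cell \<open>(x, z) \<in> G\<close> G_sym by blast
  then show False using c ne by auto
qed

lemma adj_eq: "adj = G"
proof (intro equalityI subrelI)
  fix x y assume "(x, y) \<in> adj"
  then show "(x, y) \<in> G" using adjacent_iff_common_cell by (auto simp: adj_def)
next
  fix x y assume xy: "(x, y) \<in> G"
  then have "x \<noteq> y" using G_irrefl by blast
  then show "(x, y) \<in> adj" using xy G_V adjacent_iff_common_cell[of x y] by (auto simp: adj_def)
qed

lemma neighbours_eq: "x \<in> V \<Longrightarrow> neighbours x = G `` {x}"
  using adj_eq by (auto simp: neighbours_def adj_def)

lemma matching_independent: "matching I \<Longrightarrow> I \<subseteq> V \<and> (\<forall>x\<in>I. \<forall>y\<in>I. (x, y) \<notin> G)"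
proof (intro conjI ballI)
  assume m: "matching I"
  then show "I \<subseteq> V" by (simp add: matching_def)
  fix x y assume "x \<in> I" "y \<in> I"
  then show "(x, y) \<notin> G"
    using m adjacent_iff_common_cell[of x y] G_irrefl[of x] by (cases "x = y") (auto simp: matching_def)
qed

end

text \<open>
  Both conditions pass to the closure, because added edges raise degrees and leave fewer
  independent sets, and independent sets of a line graph are matchings.
\<close>

theorem claw_free_cycle_cover:
  assumes graph: "simple_graph_on V E" and claws: "no_claw E"
    and indep: "\<And>I v. \<lbrakk>I \<subseteq> V; \<forall>x\<in>I. \<forall>y\<in>I. (x, y) \<notin> E; v \<in> I\<rbrakk> \<Longrightarrow> Suc (card I) \<le> card (E `` {v})"
    and deg_sum: "\<And>I. \<lbrakk>I \<subseteq> V; \<forall>x\<in>I. \<forall>y\<in>I. (x, y) \<notin> E; card I = Suc k\<rbrakk> \<Longrightarrow> card V \<le> (\<Sum>v\<in>I. card (E `` {v}))"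
  shows "cycle_cover E V k"
proof -
  obtain G where G: "E \<subseteq> G" "simple_graph_on V G" "no_claw G" "locally_transitive G"
    "\<And>m. cycle_cover G V m \<Longrightarrow> cycle_cover E V m"
    using closure_exists[OF graph claws] by blast
  have finG: "finite (G `` {v})" for v
  proof (rule finite_subset)
    show "G `` {v} \<subseteq> V" using G(2) by (auto simp: simple_graph_on_def)
    show "finite V" using G(2) by (simp add: simple_graph_on_def)
  qed
  have mono: "card (E `` {v}) \<le> card (G `` {v})" for v
    using finG G(1) by (intro card_mono) auto
  interpret closed_claw_free V G
  proof
    fix x assume "x \<in> V"
    then have "Suc (card {x}) \<le> card (E `` {x})"
      using graph by (intro indep) (auto simp: simple_graph_on_def irrefl_def)
    then have "E `` {x} \<noteq> {}" by auto
    then show "\<exists>y. (x, y) \<in> G" using G(1) by blast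
  qed (use G in auto)
  have small: "Suc (card I) \<le> card (neighbours e)" if "matching I" "e \<in> I" for I e
  proof -
    have I: "I \<subseteq> V" "\<forall>x\<in>I. \<forall>y\<in>I. (x, y) \<notin> G" using matching_independent[OF that(1)] by auto
    have "\<forall>x\<in>I. \<forall>y\<in>I. (x, y) \<notin> E" using I(2) G(1) by blast
    then have "Suc (card I) \<le> card (E `` {e})" using indep[OF I(1)] that(2) by blast
    then show ?thesis using mono[of e] neighbours_eq[of e] that(2) I(1) by force
  qed
  have large: "card V \<le> (\<Sum>e\<in>I. card (neighbours e))" if "matching I" "card I = Suc k" for I
  proof -
    have I: "I \<subseteq> V" "\<forall>x\<in>I. \<forall>y\<in>I. (x, y) \<notin> G" using matching_independent[OF that(1)] by auto
    have "\<forall>x\<in>I. \<forall>y\<in>I. (x, y) \<notin> E" using I(2) G(1) by blast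
    then have "card V \<le> (\<Sum>v\<in>I. card (E `` {v}))" using deg_sum[OF I(1) _ that(2)] by blast
    also have "\<dots> \<le> (\<Sum>e\<in>I. card (neighbours e))"
      using mono neighbours_eq I(1) by (intro sum_mono) (auto simp: subset_iff)
    finally show ?thesis .
  qed
  obtain D R \<phi> where "system D R" "card R \<le> k" "\<forall>e\<in>V - D. \<phi> e \<in> cells e \<inter> (supp D \<union> R)"
    "\<forall>z\<in>R - supp D. 3 \<le> card {e \<in> V - D. \<phi> e = z}"
    using trail_star_system_exists[OF small large] .
  then have "cycle_cover adj V k" by (rule cycle_cover_of_system)
  then show ?thesis using G(5) adj_eq by simp
qed

section \<open>Two-factors of digraphs\<close>

definition cycle_arcs :: "'a list \<Rightarrow> 'a rel" where
  "cycle_arcs L = {(L ! i, L ! (Suc i mod length L)) | i. i < length L}"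

lemma cycle_arcs_subset:
  assumes "cyc E L"
  shows "cycle_arcs L \<subseteq> E"
proof
  fix a assume "a \<in> cycle_arcs L"
  then obtain i where i: "i < length L" "a = (L ! i, L ! (Suc i mod length L))" by (auto simp: cycle_arcs_def)
  show "a \<in> E"
  proof (cases "Suc i = length L")
    case True
    then have "i = length L - 1" "L \<noteq> []" by auto
    then have "last L = L ! i" "hd L = L ! 0" by (simp_all add: last_conv_nth hd_conv_nth)
    moreover have "(last L, hd L) \<in> E" using assms by (simp add: cyc_def)
    ultimately show ?thesis using i True by simp
  next
    case False
    then have "Suc i < length L" using i by simp
    then show ?thesis using assms i by (simp add: cyc_def successively_conv_nth)
  qed
qed

lemma cycle_arcs_field: "cycle_arcs L \<subseteq> set L \<times> set L"
proof
  fix a assume "a \<in> cycle_arcs L"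
  then obtain i where i: "i < length L" "a = (L ! i, L ! (Suc i mod length L))" by (auto simp: cycle_arcs_def)
  then have "Suc i mod length L < length L" by (intro mod_less_divisor) linarith
  then show "a \<in> set L \<times> set L" using i by simp
qed

lemma cycle_arcs_degree:
  assumes "cyc E L" "v \<in> set L"
  shows "card ((cycle_arcs L \<union> (cycle_arcs L)\<inverse>) `` {v}) = 2"
proof -
  define n where "n = length L"
  have n: "3 \<le> n" and d: "distinct L" using assms(1) by (auto simp: cyc_def n_def)
  obtain j where j: "j < n" "v = L ! j" using assms(2) unfolding n_def in_set_conv_nth by blast
  define k where "k = (if j = 0 then n - 1 else j - 1)"
  have "k < n \<and> Suc k mod n = j"
  proof (cases "j = 0")
    case True
    then have "Suc k = n" using n by (simp add: k_def)
    then show ?thesis using True by simp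
  next
    case False
    then have "Suc k = j" by (simp add: k_def)
    then show ?thesis using j(1) by simp
  qed
  then have k: "k < n" "Suc k mod n = j" by simp_all
  have nxt: "Suc i = n \<and> Suc i mod n = 0 \<or> Suc i \<noteq> n \<and> Suc i mod n = Suc i" if "i < n" for i
    using that by (simp add: mod_Suc)
  have less: "Suc i mod n < n" for i using n by simp
  have inj: "L ! a = L ! b \<longleftrightarrow> a = b" if "a < n" "b < n" for a b
    using that nth_eq_iff_index_eq[OF d] by (simp add: n_def)
  have succ_k: "i = k" if "i < n" "Suc i mod n = j" for i
    using nxt[OF that(1)] nxt[OF k(1)] k(2) that(2) by linarith
  have "(cycle_arcs L \<union> (cycle_arcs L)\<inverse>) `` {v} = {L ! (Suc j mod n), L ! k}"
  proof (intro equalityI subsetI)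
    fix b assume "b \<in> (cycle_arcs L \<union> (cycle_arcs L)\<inverse>) `` {v}"
    then consider "(v, b) \<in> cycle_arcs L" | "(b, v) \<in> cycle_arcs L" by blast
    then show "b \<in> {L ! (Suc j mod n), L ! k}"
    proof cases
      case 1
      then obtain i where i: "i < n" "v = L ! i" "b = L ! (Suc i mod n)" unfolding cycle_arcs_def n_def by blast
      have "L ! i = L ! j" using i(2) j(2) by (rule subst)
      then have "i = j" using inj[OF i(1) j(1)] by blast
      then show ?thesis using i(3) by blast
    next
      case 2
      then obtain i where i: "i < n" "b = L ! i" "v = L ! (Suc i mod n)" unfolding cycle_arcs_def n_def by blast
      have "L ! (Suc i mod n) = L ! j" using i(3) j(2) by (rule subst)
      then have "Suc i mod n = j" using inj[OF less j(1)] by blast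
      then have "i = k" using succ_k i(1) by blast
      then show ?thesis using i(2) by blast
    qed
  next
    fix b assume b: "b \<in> {L ! (Suc j mod n), L ! k}"
    have "(L ! j, L ! (Suc j mod n)) \<in> cycle_arcs L" "(L ! k, L ! (Suc k mod n)) \<in> cycle_arcs L"
      using j(1) k(1) unfolding cycle_arcs_def n_def by blast+
    then show "b \<in> (cycle_arcs L \<union> (cycle_arcs L)\<inverse>) `` {v}"
      using b j(2) k(2) by auto
  qed
  moreover have "Suc j mod n \<noteq> k" using nxt[OF j(1)] nxt[OF k(1)] k(2) n by linarith
  then have "L ! (Suc j mod n) \<noteq> L ! k" using inj[OF less k(1)] by simp
  ultimately show ?thesis by simp
qed

lemma cycle_arcs_connected:
  assumes "v \<in> set L" "w \<in> set L"
  shows "(v, w) \<in> (cycle_arcs L \<union> (cycle_arcs L)\<inverse>)\<^sup>*"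
proof -
  let ?A = "cycle_arcs L \<union> (cycle_arcs L)\<inverse>"
  have "sym ?A" by (auto simp: sym_def)
  then have s: "sym (?A\<^sup>*)" by (rule sym_rtrancl)
  have start: "(L ! 0, L ! i) \<in> ?A\<^sup>*" if "i < length L" for i
    using that
  proof (induction i)
    case (Suc i)
    then have "(L ! i, L ! (Suc i mod length L)) \<in> ?A" by (auto simp: cycle_arcs_def)
    then have "(L ! i, L ! Suc i) \<in> ?A" using Suc.prems by simp
    then show ?case using Suc by (meson Suc_lessD rtrancl.rtrancl_into_rtrancl)
  qed simp
  obtain i j where "i < length L" "v = L ! i" "j < length L" "w = L ! j"
    using assms by (auto simp: in_set_conv_nth)
  then have "(L ! 0, v) \<in> ?A\<^sup>*" "(L ! 0, w) \<in> ?A\<^sup>*" using start by auto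
  then show ?thesis using s by (meson rtrancl_trans symD)
qed

lemma distinct_concat_unique:
  assumes "distinct (concat Ls)" "L \<in> set Ls" "M \<in> set Ls" "v \<in> set L" "v \<in> set M"
  shows "L = M"
  using assms by (auto simp: distinct_concat_iff disjoint_iff)

lemma out_degree_image: "out_degree (with_proj G) v = card (parcs G `` {v})"
proof -
  have "out_arcs (with_proj G) v = Pair v ` (parcs G `` {v})" by (auto simp: out_arcs_def)
  moreover have "inj_on (Pair v) (parcs G `` {v})" by (auto simp: inj_on_def)
  ultimately show ?thesis by (simp add: out_degree_def card_image)
qed

text \<open>
  Every strongly connected component of the 2-factor meets some list, and a list lies in a
  single component, so there are at most as many components as lists.
\<close>

lemma (in pair_graph) two_factor_of_cycle_cover:
  assumes cover: "cycle_cover (parcs G) (pverts G) k"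
  shows "\<exists>H. two_factor H G \<and> card (pre_digraph.sccs (with_proj H)) \<le> k"
proof -
  obtain Ls where Ls: "length Ls \<le> k" "distinct (concat Ls)" "set (concat Ls) = pverts G"
    "\<forall>L\<in>set Ls. cyc (parcs G) L" using cover by (auto simp: cycle_cover_def)
  define A where "A = (\<Union>L\<in>set Ls. cycle_arcs L \<union> (cycle_arcs L)\<inverse>)"
  define H where "H = \<lparr>pverts = pverts G, parcs = A\<rparr>"
  have H_simps [simp]: "pverts H = pverts G" "parcs H = A" by (simp_all add: H_def)
  have symG: "sym (parcs G)" using pair_sym_arcs by (simp add: symmetric_def)
  have AG: "A \<subseteq> parcs G"
  proof
    fix a assume "a \<in> A"
    then obtain L where "L \<in> set Ls" "a \<in> cycle_arcs L \<union> (cycle_arcs L)\<inverse>" by (auto simp: A_def)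
    then show "a \<in> parcs G" using cycle_arcs_subset[of "parcs G" L] Ls(4) symG by (auto dest: symD)
  qed
  have AV: "A \<subseteq> pverts G \<times> pverts G" using AG in_arcsD1 in_arcsD2 by auto
  have symA: "sym A" by (auto simp: A_def sym_def)
  interpret H: pair_graph H
  proof
    show "finite (pverts H)" by simp
    show "finite (parcs H)" using finite_subset[OF AG pair_finite_arcs] by simp
    show "fst e \<noteq> snd e" if "e \<in> parcs H" for e using that AG pair_no_loops by auto
    show "symmetric H" using symA by (simp add: symmetric_def)
  qed (use AV in auto)
  have span: "spanning H G"
    using AG wf_digraph H.wf_digraph by (auto simp: spanning_def subgraph_def compatible_def with_proj_def)
  have degree: "out_degree H v = 2" if v: "v \<in> pverts H" for v
  proof -
    obtain L where L: "L \<in> set Ls" "v \<in> set L" using v Ls(3) by auto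
    have "A `` {v} = (cycle_arcs L \<union> (cycle_arcs L)\<inverse>) `` {v}"
    proof (intro equalityI subsetI)
      fix b assume "b \<in> A `` {v}"
      then obtain M where M: "M \<in> set Ls" "(v, b) \<in> cycle_arcs M \<union> (cycle_arcs M)\<inverse>" by (auto simp: A_def)
      then have "v \<in> set M" using cycle_arcs_field by blast
      then have "M = L" using distinct_concat_unique[OF Ls(2) M(1) L(1)] L(2) by blast
      then show "b \<in> (cycle_arcs L \<union> (cycle_arcs L)\<inverse>) `` {v}" using M(2) by blast
    qed (use L in \<open>auto simp: A_def\<close>)
    then show ?thesis using cycle_arcs_degree[of "parcs G" L v] Ls(4) L by (simp add: out_degree_image)
  qed
  have tf: "two_factor H G"
    unfolding two_factor_def by (intro conjI ballI H.pair_graph span degree)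
  have reach: "v \<rightarrow>\<^sup>*\<^bsub>H\<^esub> w" if L: "L \<in> set Ls" "v \<in> set L" "w \<in> set L" for L v w
  proof -
    have "(v, w) \<in> (cycle_arcs L \<union> (cycle_arcs L)\<inverse>)\<^sup>*" by (rule cycle_arcs_connected[OF L(2,3)])
    then show ?thesis
    proof (induction rule: rtrancl_induct)
      case base
      have "v \<in> pverts H" using L Ls(3) by auto
      then show ?case by (simp add: reachable_def)
    next
      case (step y z)
      have "(y, z) \<in> A" using step.hyps(2) L(1) unfolding A_def by blast
      moreover from this have "z \<in> pverts H" using AV by auto
      ultimately show ?case
        using step.IH rtrancl_on_into_rtrancl_on[of v y "pverts H" A z] by (simp add: reachable_def)
    qed
  qed
  have "\<exists>L\<in>set Ls. X \<inter> set L \<noteq> {}" if X: "X \<in> H.sccs_verts" for X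
  proof -
    obtain v where v: "v \<in> X" "v \<rightarrow>\<^sup>*\<^bsub>H\<^esub> v" using X unfolding H.in_sccs_verts_conv_reachable by blast
    have "v \<in> verts H" using v(2) by (rule reachable_in_vertsE)
    then have "v \<in> set (concat Ls)" using Ls(3) by simp
    then obtain L where "L \<in> set Ls" "v \<in> set L" by auto
    then show ?thesis using v(1) by blast
  qed
  then obtain f where f: "\<And>X. X \<in> H.sccs_verts \<Longrightarrow> f X \<in> set Ls \<and> X \<inter> set (f X) \<noteq> {}" by metis
  have "inj_on f H.sccs_verts"
  proof (rule inj_onI)
    fix X Y assume XY: "X \<in> H.sccs_verts" "Y \<in> H.sccs_verts" "f X = f Y"
    obtain v where v: "v \<in> X" "v \<in> set (f X)" using f[OF XY(1)] by blast
    obtain w where w: "w \<in> Y" "w \<in> set (f X)" using f[OF XY(2)] XY(3) by auto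
    have "f X \<in> set Ls" using f[OF XY(1)] by blast
    then have "v \<rightarrow>\<^sup>*\<^bsub>H\<^esub> w" "w \<rightarrow>\<^sup>*\<^bsub>H\<^esub> v" using reach v(2) w(2) by blast+
    then have "w \<in> X" using XY(1) v(1) unfolding H.in_sccs_verts_conv_reachable by blast
    then show "X = Y" using H.sccs_verts_disjoint[OF XY(1,2)] w(1) by blast
  qed
  moreover have "f ` H.sccs_verts \<subseteq> set Ls" using f by blast
  ultimately have "card H.sccs_verts \<le> card (set Ls)" by (rule card_inj_on_le) simp
  also have "\<dots> \<le> k" using card_length[of Ls] Ls(1) by linarith
  finally show ?thesis using tf H.card_sccs_verts by (intro exI[of _ H]) simp
qed

lemma (in pair_graph) simple_graph_on_arcs: "simple_graph_on (pverts G) (parcs G)"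
  unfolding simple_graph_on_def
proof (intro conjI)
  show "parcs G \<subseteq> pverts G \<times> pverts G" using in_arcsD1 in_arcsD2 by auto
  show "sym (parcs G)" using pair_sym_arcs by (simp add: symmetric_def)
  show "irrefl (parcs G)" unfolding irrefl_def using pair_no_loops by force
qed (rule pair_finite_verts)

lemma (in pair_graph) no_claw_arcs:
  assumes "claw_free G"
  shows "no_claw (parcs G)"
  unfolding no_claw_def
proof (intro allI impI, rule ccontr)
  fix c p q r
  assume c: "(c, p) \<in> parcs G" "(c, q) \<in> parcs G" "(c, r) \<in> parcs G" and ne: "p \<noteq> q" "q \<noteq> r" "p \<noteq> r"
    and non: "\<not> ((p, q) \<in> parcs G \<or> (q, r) \<in> parcs G \<or> (p, r) \<in> parcs G)"
  have S: "(a, b) \<in> parcs G \<longleftrightarrow> (b, a) \<in> parcs G" for a b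
    using simple_graph_on_arcs by (auto simp: simple_graph_on_def dest: symD)
  have I: "(a, a) \<notin> parcs G" for a
    using simple_graph_on_arcs by (auto simp: simple_graph_on_def irrefl_def)
  define H where "H = \<lparr>pverts = {c, p, q, r}, parcs = {c} \<times> {p, q, r} \<union> {p, q, r} \<times> {c}\<rparr>"
  have arcs: "parcs H = {e \<in> parcs G. fst e \<in> pverts H \<and> snd e \<in> pverts H}"
  proof (intro equalityI subsetI)
    fix e assume "e \<in> parcs H"
    then show "e \<in> {e \<in> parcs G. fst e \<in> pverts H \<and> snd e \<in> pverts H}"
      using c S by (auto simp: H_def)
  next
    fix e assume e: "e \<in> {e \<in> parcs G. fst e \<in> pverts H \<and> snd e \<in> pverts H}"
    obtain a b where ab: "e = (a, b)" by (cases e)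
    have "(a, b) \<in> parcs G" "a \<in> {c, p, q, r}" "b \<in> {c, p, q, r}" using e ab by (auto simp: H_def)
    moreover have "(q, p) \<notin> parcs G" "(r, q) \<notin> parcs G" "(r, p) \<notin> parcs G" using non S by auto
    ultimately show "e \<in> parcs H" using non I ab by (auto simp: H_def)
  qed
  have cne: "c \<noteq> p" "c \<noteq> q" "c \<noteq> r" using c I by auto
  have "complete_bipartite_digraph 1 3 H"
    unfolding complete_bipartite_digraph_pair_def
    by (intro conjI exI[of _ "{c}"] exI[of _ "{p, q, r}"]) (use ne cne in \<open>auto simp: H_def\<close>)
  moreover have "induced_subgraph H G"
    unfolding induced_subgraph_def subgraph_def
  proof (intro conjI)
    show "verts H \<subseteq> verts G" using c in_arcsD1 in_arcsD2 by (auto simp: H_def)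
    show "arcs H \<subseteq> arcs G" using arcs by auto
    show "wf_digraph H" by unfold_locales (use arcs in auto)
    show "arcs H = {e \<in> arcs G. tail G e \<in> verts H \<and> head G e \<in> verts H}" using arcs by simp
  qed (auto simp: compatible_def wf_digraph)
  ultimately show False using assms by (auto simp: claw_free_def)
qed

theorem theorem7:
  fixes G :: "'a pair_pre_digraph" and k n :: nat
  assumes "k \<ge> 1"
    and "pair_graph G"
    and "claw_free G"
    and "card (pverts G) = n"
    and "degree_sum_min (k + 1) G \<ge> enat n"
    and "\<And>I. independent_set G I \<Longrightarrow> I \<noteq> {} \<Longrightarrow> int (card I) \<le> int (min_degree_in G I) - 1"
  shows "\<exists>H. two_factor H G \<and> card (pre_digraph.sccs (with_proj H)) \<le> k"
proof -
  interpret pair_graph G by fact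
  let ?V = "pverts G" and ?E = "parcs G"
  have fin: "finite {I. independent_set G I}"
    by (rule finite_subset[of _ "Pow ?V"]) (auto simp: independent_set_def)
  have "cycle_cover ?E ?V k"
  proof (rule claw_free_cycle_cover)
    show "simple_graph_on ?V ?E" by (rule simple_graph_on_arcs)
    show "no_claw ?E" using assms(3) by (rule no_claw_arcs)
  next
    fix I v assume I: "I \<subseteq> ?V" "\<forall>x\<in>I. \<forall>y\<in>I. (x, y) \<notin> ?E" "v \<in> I"
    then have "independent_set G I" by (simp add: independent_set_def)
    then have "int (card I) \<le> int (min_degree_in G I) - 1" using assms(6) I(3) by blast
    moreover have "min_degree_in G I \<le> out_degree G v"
      unfolding min_degree_in_def
    proof (rule Min_le)
      have "finite I" using I(1) pair_finite_verts finite_subset by blast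
      then show "finite {out_degree G v | v. v \<in> I}" by simp
    qed (use I(3) in blast)
    ultimately show "Suc (card I) \<le> card (?E `` {v})" by (simp add: out_degree_image)
  next
    fix I assume I: "I \<subseteq> ?V" "\<forall>x\<in>I. \<forall>y\<in>I. (x, y) \<notin> ?E" "card I = Suc k"
    then have indep: "independent_set G I" by (simp add: independent_set_def)
    have "finite {card I | I. independent_set G I}" using fin by simp
    then have "k + 1 \<le> independence_number G"
      unfolding independence_number_def
    proof (rule Max_ge)
      show "k + 1 \<in> {card I | I. independent_set G I}" using indep I(3) by (intro CollectI exI[of _ I]) simp
    qed
    then have "n \<le> Min {\<Sum>v\<in>I. out_degree G v | I. independent_set G I \<and> card I = k + 1}"
      using assms(5) by (simp add: degree_sum_min_def)
    also have "\<dots> \<le> (\<Sum>v\<in>I. out_degree G v)"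
    proof (rule Min_le)
      show "finite {\<Sum>v\<in>I. out_degree G v | I. independent_set G I \<and> card I = k + 1}"
        using fin by simp
      show "(\<Sum>v\<in>I. out_degree G v) \<in> {\<Sum>v\<in>I. out_degree G v | I. independent_set G I \<and> card I = k + 1}"
        using indep I(3) by (intro CollectI exI[of _ I]) simp
    qed
    finally show "card ?V \<le> (\<Sum>v\<in>I. card (?E `` {v}))" using assms(4) by (simp add: out_degree_image)
  qed
  then show ?thesis by (rule two_factor_of_cycle_cover)
qed

end
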